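(* Let $d\ge 4$ and let $W_d$ be a $d$-web on a two-dimensional manifold $M$ given in local coordinates $x,y$ by the foliations $\{x=\mathrm{const}\}$, $\{y=\mathrm{const}\}$, $\{f=\mathrm{const}\}$, $\{g_4=\mathrm{const}\},\dots,\{g_d=\mathrm{const}\}$, with web functions $f$ and $g=g_4,g_5,\dots,g_d$. Then $W_d$ is linearizable if and only if $$I_1(f,g)=0,\quad I_2(f,g)=0,\quad I(f,g,g_5)=0,\ \dots,\ I(f,g,g_d)=0 .$$
   Context: All objects are smooth and the considerations are local: $M$ is a simply connected domain in $\mathbb R^2$ with coordinates $x,y$. A $d$-web on $M$ consists of $d$ one-dimensional foliations that are pairwise transversal at every point; so here any two of $dx,dy,df,dg_4,\dots,dg_d$ are linearly independent at every point (any $d$-web has locally such a form). The web is linearizable if it is (locally) equivalent to a linear web, i.e. every point has a neighborhood that admits a diffeomorphism onto an open subset of the projective plane taking the leaves of all the foliations of the web into straight lines. Notation: $$\partial_1=-\frac1{f_x}\frac{\partial}{\partial x},\qquad \partial_2=-\frac1{f_y}\frac{\partial}{\partial y},\qquad H=\frac{f_{xy}}{f_xf_y},\qquad K=\partial_1(H)-\partial_2(H).$$ For a smooth function $\mu$ put $$I_1(\mu)=-\partial_1^2(\mu)+2\partial_1\partial_2(\mu)+(\mu+H)\partial_1(\mu)-2(2H+\mu)\partial_2(\mu)+H\mu^2+(2H^2-\partial_2(H))\mu-\partial_1(K)+2HK,$$ $$I_2(\mu)=-\partial_2^2(\mu)+2\partial_1\partial_2(\mu)+2(\mu-H)\partial_1(\mu)-(H+\mu)\partial_2(\mu)-H\mu^2+(2H^2-\partial_1(H))\mu-\partial_2(K)+2HK,$$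 where $\partial_1\partial_2(\mu)=\partial_1(\partial_2(\mu))$. For $i=1,2$, $$I_i(f,g)=I_i\!\left(\frac{\partial_1(a)-a\,\partial_2(a)}{a-a^2}\right),\qquad a=\frac{\partial_1(g)}{\partial_2(g)} .$$ For $\alpha=5,\dots,d$, $I(f,g,g_\alpha)=I(f,g_\alpha)-I(f,g)$, where $$I(f,p)=\frac{(\partial_1p)^2\,\partial_2^2p-2\,\partial_1p\,\partial_2p\,\partial_1\partial_2p+(\partial_2p)^2\,\partial_1^2p}{\partial_1p\,\partial_2p\,(\partial_2p-\partial_1p)} .$$ (For $d=4$ there are no conditions of the type $I(f,g,g_\alpha)=0$.) *)

theory Defs
  imports "HOL-Analysis.Analysis"
begin

type_synonym plane = "real \<times> real"

section \<open>Smooth maps on open sets\<close>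

text \<open>Meant for open \<open>S\<close> and finite-dimensional domains: all iterated directional derivatives of
  order up to \<open>n\<close> exist on \<open>S\<close> and are continuous there.\<close>

primrec Ck_on :: "nat \<Rightarrow> 'a::real_normed_vector set \<Rightarrow> ('a \<Rightarrow> 'b::real_normed_vector) \<Rightarrow> bool" where
  "Ck_on 0 S u \<longleftrightarrow> continuous_on S u"
| "Ck_on (Suc n) S u \<longleftrightarrow> (\<forall>p\<in>S. u differentiable (at p)) \<and>
     (\<forall>v. Ck_on n S (\<lambda>p. frechet_derivative u (at p) v))"

definition smooth_on :: "'a::real_normed_vector set \<Rightarrow> ('a \<Rightarrow> 'b::real_normed_vector) \<Rightarrow> bool" where
  "smooth_on S u \<longleftrightarrow> (\<forall>n. Ck_on n S u)"

definition pdx :: "(plane \<Rightarrow> real) \<Rightarrow> plane \<Rightarrow> real" where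
  "pdx u p = frechet_derivative u (at p) (1, 0)"

definition pdy :: "(plane \<Rightarrow> real) \<Rightarrow> plane \<Rightarrow> real" where
  "pdy u p = frechet_derivative u (at p) (0, 1)"

section \<open>The real projective plane\<close>

text \<open>Points are the one-dimensional subspaces of \<open>\<real>\<^sup>3\<close>; straight lines consist of the points
  contained in a two-dimensional subspace.\<close>

type_synonym space3 = "real \<times> real \<times> real"

definition proj_plane :: "space3 set set" where
  "proj_plane = {P. subspace P \<and> dim P = 1}"

definition proj_line :: "space3 set set \<Rightarrow> bool" where
  "proj_line l \<longleftrightarrow> (\<exists>W. subspace W \<and> dim W = 2 \<and> l = {P \<in> proj_plane. P \<subseteq> W})"

text \<open>The standard affine atlas of \<open>[u : v : w]\<close>, given by the inverses of the charts. These are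
  injective, and their ranges (the complements of the three coordinate lines) cover the
  projective plane. Openness and smoothness below are those of the manifold defined by this atlas.\<close>

definition affine_params :: "(plane \<Rightarrow> space3 set) set" where
  "affine_params =
     {\<lambda>(s, t). span {(1, s, t)}, \<lambda>(s, t). span {(s, 1, t)}, \<lambda>(s, t). span {(s, t, 1)}}"

definition proj_open :: "space3 set set \<Rightarrow> bool" where
  "proj_open V \<longleftrightarrow> V \<subseteq> proj_plane \<and> (\<forall>\<psi>\<in>affine_params. open (\<psi> -` V))"

definition smooth_into_proj :: "plane set \<Rightarrow> (plane \<Rightarrow> space3 set) \<Rightarrow> bool" where
  "smooth_into_proj U \<Phi> \<longleftrightarrow> \<Phi> ` U \<subseteq> proj_plane \<and>
     (\<forall>\<psi>\<in>affine_params. open {p \<in> U. \<Phi> p \<in> range \<psi>} \<and>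
        smooth_on {p \<in> U. \<Phi> p \<in> range \<psi>} (\<lambda>p. inv \<psi> (\<Phi> p)))"

definition smooth_from_proj :: "space3 set set \<Rightarrow> (space3 set \<Rightarrow> plane) \<Rightarrow> bool" where
  "smooth_from_proj V \<Theta> \<longleftrightarrow> (\<forall>\<psi>\<in>affine_params. smooth_on (\<psi> -` V) (\<lambda>q. \<Theta> (\<psi> q)))"

definition diffeo_onto_proj_open :: "plane set \<Rightarrow> (plane \<Rightarrow> space3 set) \<Rightarrow> bool" where
  "diffeo_onto_proj_open U \<Phi> \<longleftrightarrow>
     inj_on \<Phi> U \<and> proj_open (\<Phi> ` U) \<and>
     smooth_into_proj U \<Phi> \<and> smooth_from_proj (\<Phi> ` U) (inv_into U \<Phi>)"

section \<open>Webs\<close>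

text \<open>A \<open>d\<close>-web is given by web functions \<open>w 1, \<dots>, w d\<close>, whose differentials are pairwise linearly
  independent at every point.\<close>

definition web :: "plane set \<Rightarrow> nat \<Rightarrow> (nat \<Rightarrow> plane \<Rightarrow> real) \<Rightarrow> bool" where
  "web M d w \<longleftrightarrow>
     (\<forall>i\<in>{1..d}. smooth_on M (w i)) \<and>
     (\<forall>i\<in>{1..d}. \<forall>j\<in>{1..d}. i \<noteq> j \<longrightarrow> (\<forall>p\<in>M. \<forall>s t :: real.
        (\<forall>v. s * frechet_derivative (w i) (at p) v + t * frechet_derivative (w j) (at p) v = 0)
          \<longrightarrow> s = 0 \<and> t = 0))"

text \<open>The leaves in \<open>U\<close> of the foliation \<open>{u = const}\<close> are the connected components of the level sets
  of the restriction of \<open>u\<close> to \<open>U\<close>.\<close>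

definition leaves :: "plane set \<Rightarrow> (plane \<Rightarrow> real) \<Rightarrow> plane set set" where
  "leaves U u = (\<Union>c. components {p \<in> U. u p = c})"

definition linearizable :: "plane set \<Rightarrow> nat \<Rightarrow> (nat \<Rightarrow> plane \<Rightarrow> real) \<Rightarrow> bool" where
  "linearizable M d w \<longleftrightarrow>
     (\<forall>p\<in>M. \<exists>U \<Phi>. open U \<and> p \<in> U \<and> U \<subseteq> M \<and> diffeo_onto_proj_open U \<Phi> \<and>
        (\<forall>i\<in>{1..d}. \<forall>L \<in> leaves U (w i). \<exists>l. proj_line l \<and> \<Phi> ` L \<subseteq> l))"

text \<open>The values \<open>g 0, \<dots>, g 3\<close> are irrelevant.\<close>

definition web_funs :: "(plane \<Rightarrow> real) \<Rightarrow> (nat \<Rightarrow> plane \<Rightarrow> real) \<Rightarrow> nat \<Rightarrow> plane \<Rightarrow> real" where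
  "web_funs f g i = (if i = 1 then fst else if i = 2 then snd else if i = 3 then f else g i)"

section \<open>Differential invariants\<close>

definition D1 :: "(plane \<Rightarrow> real) \<Rightarrow> (plane \<Rightarrow> real) \<Rightarrow> plane \<Rightarrow> real" where
  "D1 f u p = - (1 / pdx f p) * pdx u p"

definition D2 :: "(plane \<Rightarrow> real) \<Rightarrow> (plane \<Rightarrow> real) \<Rightarrow> plane \<Rightarrow> real" where
  "D2 f u p = - (1 / pdy f p) * pdy u p"

definition HH :: "(plane \<Rightarrow> real) \<Rightarrow> plane \<Rightarrow> real" where
  "HH f p = pdy (pdx f) p / (pdx f p * pdy f p)"

definition KK :: "(plane \<Rightarrow> real) \<Rightarrow> plane \<Rightarrow> real" where
  "KK f p = D1 f (HH f) p - D2 f (HH f) p"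

definition I1_op :: "(plane \<Rightarrow> real) \<Rightarrow> (plane \<Rightarrow> real) \<Rightarrow> plane \<Rightarrow> real" where
  "I1_op f \<mu> p =
     - D1 f (D1 f \<mu>) p + 2 * D1 f (D2 f \<mu>) p
     + (\<mu> p + HH f p) * D1 f \<mu> p - 2 * (2 * HH f p + \<mu> p) * D2 f \<mu> p
     + HH f p * (\<mu> p)\<^sup>2 + (2 * (HH f p)\<^sup>2 - D2 f (HH f) p) * \<mu> p
     - D1 f (KK f) p + 2 * HH f p * KK f p"

definition I2_op :: "(plane \<Rightarrow> real) \<Rightarrow> (plane \<Rightarrow> real) \<Rightarrow> plane \<Rightarrow> real" where
  "I2_op f \<mu> p =
     - D2 f (D2 f \<mu>) p + 2 * D1 f (D2 f \<mu>) p
     + 2 * (\<mu> p - HH f p) * D1 f \<mu> p - (HH f p + \<mu> p) * D2 f \<mu> p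
     - HH f p * (\<mu> p)\<^sup>2 + (2 * (HH f p)\<^sup>2 - D1 f (HH f) p) * \<mu> p
     - D2 f (KK f) p + 2 * HH f p * KK f p"

definition basic_inv :: "(plane \<Rightarrow> real) \<Rightarrow> (plane \<Rightarrow> real) \<Rightarrow> plane \<Rightarrow> real" where
  "basic_inv f g p = D1 f g p / D2 f g p"

definition mu :: "(plane \<Rightarrow> real) \<Rightarrow> (plane \<Rightarrow> real) \<Rightarrow> plane \<Rightarrow> real" where
  "mu f g p =
     (D1 f (basic_inv f g) p - basic_inv f g p * D2 f (basic_inv f g) p)
     / (basic_inv f g p - (basic_inv f g p)\<^sup>2)"

definition I1 :: "(plane \<Rightarrow> real) \<Rightarrow> (plane \<Rightarrow> real) \<Rightarrow> plane \<Rightarrow> real" where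
  "I1 f g = I1_op f (mu f g)"

definition I2 :: "(plane \<Rightarrow> real) \<Rightarrow> (plane \<Rightarrow> real) \<Rightarrow> plane \<Rightarrow> real" where
  "I2 f g = I2_op f (mu f g)"

definition I_pair :: "(plane \<Rightarrow> real) \<Rightarrow> (plane \<Rightarrow> real) \<Rightarrow> plane \<Rightarrow> real" where
  "I_pair f u p =
     ((D1 f u p)\<^sup>2 * D2 f (D2 f u) p
        - 2 * D1 f u p * D2 f u p * D1 f (D2 f u) p
        + (D2 f u p)\<^sup>2 * D1 f (D1 f u) p)
     / (D1 f u p * D2 f u p * (D2 f u p - D1 f u p))"

definition I_triple ::
    "(plane \<Rightarrow> real) \<Rightarrow> (plane \<Rightarrow> real) \<Rightarrow> (plane \<Rightarrow> real) \<Rightarrow> plane \<Rightarrow> real" where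
  "I_triple f g h p = I_pair f h p - I_pair f g p"

end

theory Submission
  imports Defs
begin

text \<open>Let \<open>(u, v)\<close> be affine coordinates in which the leaves \<open>x = const\<close> and \<open>y = const\<close> are
  straight. Then \<open>k = u\<close> and \<open>k = v\<close> solve \<open>k\<^bsub>xx\<^esub> = a k\<^bsub>x\<^esub>\<close>, \<open>k\<^bsub>yy\<^esub> = b k\<^bsub>y\<^esub>\<close>, \<open>k\<^bsub>xy\<^esub> = s k\<^bsub>x\<^esub> + t k\<^bsub>y\<^esub>\<close>,
  and whether the leaves of \<open>w\<close> are straight depends only on \<open>m = a - 2 t\<close> and \<open>n = b - 2 s\<close>. For
  \<open>w = f\<close> this means that \<open>m\<close> and \<open>n\<close> are given by a single function \<open>\<nu>\<close>, and for \<open>w = g\<^sub>i\<close> that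
  \<open>\<nu> = I(f, g\<^sub>i) + H\<close>, which is the function \<open>\<mu>\<close> of the web; hence the conditions \<open>I(f, g, g\<^sub>i) = 0\<close>.
  Compatibility of the system for \<open>k\<close> forces Liouville's two conditions on \<open>m\<close> and \<open>n\<close>, which are
  nonzero multiples of \<open>I\<^sub>1 = 0\<close> and \<open>I\<^sub>2 = 0\<close>. Conversely, under Liouville's conditions the
  homogeneous form of the system, normalized to trace zero, is integrable; quotients of
  three independent solutions are coordinates in which all leaves are straight.\<close>

section \<open>Calculus of smooth maps\<close>

text \<open>The functions \<open>m\<close> and \<open>n\<close> are what a change of projective
  chart leaves alone: dividing solutions of the homogeneous system by one of them,
  \<open>U0\<close>, shifts \<open>a\<close>, \<open>b\<close> by twice and \<open>s\<close>,
  \<open>t\<close> by once a logarithmic derivative of \<open>U0\<close>, and this drops out of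
  \<open>a - 2 t\<close> and \<open>b - 2 s\<close>. Recovering \<open>a\<close>, \<open>b\<close>,
  \<open>s\<close>, \<open>t\<close> directly would mean solving nonlinear equations for the unknown
  shift. A third, homogeneous coordinate makes the problem linear; its only freedom is rescaling,
  which the trace condition fixes, so that all coefficients become explicit in \<open>m\<close>,
  \<open>n\<close> and their first derivatives. Hence the factors 1/3, 2/9 and 1/9. Straightness of
  one foliation is one linear equation between \<open>m\<close> and \<open>n\<close>, void for the
  two coordinate foliations. The equation of \<open>f\<close> leaves the one unknown
  \<open>\<nu>\<close>, and transversality lets each \<open>g i\<close> determine it. For the linear
  system, a fixed point of integration along an L-shaped path satisfies the equation in
  \<open>y\<close> at once; the equation in \<open>x\<close> is the real issue, and there the
  integrability condition is used.\<close>

lemma Ck_on_has_derivative: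
  "Ck_on (Suc n) S u \<Longrightarrow> p \<in> S \<Longrightarrow> (u has_derivative frechet_derivative u (at p)) (at p)"
  using frechet_derivative_works[of u "at p"] by simp

lemma Ck_on_cong:
  assumes "open S" "\<And>p. p \<in> S \<Longrightarrow> u p = v p" "Ck_on n S u"
  shows "Ck_on n S v"
  using assms(2,3)
proof (induction n arbitrary: u v)
  case 0
  then show ?case using continuous_on_cong by (metis Ck_on.simps(1))
next
  case (Suc n)
  have der: "(v has_derivative frechet_derivative u (at p)) (at p)" if "p \<in> S" for p
    using Suc.prems(1) Ck_on_has_derivative[OF Suc.prems(2) that] that assms(1)
    by (metis has_derivative_transform_within_open)
  then have "frechet_derivative v (at p) = frechet_derivative u (at p)" if "p \<in> S" for p
    using frechet_derivative_at that by metis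
  then show ?case
    using Suc.IH[of "\<lambda>p. frechet_derivative u (at p) w" "\<lambda>p. frechet_derivative v (at p) w" for w]
      Suc.prems(2) der by (auto simp: differentiable_def)
qed

lemma Ck_on_SucD: "Ck_on (Suc n) S u \<Longrightarrow> Ck_on n S u"
proof (induction n arbitrary: u)
  case 0
  then show ?case
    by (auto intro!: continuous_at_imp_continuous_on differentiable_imp_continuous_within)
qed auto

lemma Ck_on_subset: "Ck_on n S u \<Longrightarrow> T \<subseteq> S \<Longrightarrow> Ck_on n T u"
  by (induction n arbitrary: u) (auto intro: continuous_on_subset)

lemma smooth_on_subset: "smooth_on S u \<Longrightarrow> T \<subseteq> S \<Longrightarrow> smooth_on T u"
  by (auto simp: smooth_on_def intro: Ck_on_subset)

lemma smooth_on_cong: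
  "open S \<Longrightarrow> (\<And>p. p \<in> S \<Longrightarrow> u p = v p) \<Longrightarrow> smooth_on S u \<Longrightarrow> smooth_on S v"
  by (auto simp: smooth_on_def intro: Ck_on_cong)

lemma smooth_on_imp_differentiable: "smooth_on S u \<Longrightarrow> p \<in> S \<Longrightarrow> u differentiable (at p)"
  unfolding smooth_on_def by (metis Ck_on.simps(2))

lemma smooth_on_imp_continuous_on: "smooth_on S u \<Longrightarrow> continuous_on S u"
  unfolding smooth_on_def by (metis Ck_on.simps(1))

lemma smooth_on_frechet_derivative:
  "smooth_on S u \<Longrightarrow> smooth_on S (\<lambda>p. frechet_derivative u (at p) v)"
  unfolding smooth_on_def by (metis Ck_on.simps(2))

text \<open>Lets a proof supply the derivative by an explicit formula \<open>D\<close> instead of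
  \<open>frechet_derivative\<close>; on an open set the two agree by uniqueness. The inductions on
  the order below rest on this.\<close>

lemma Ck_on_SucI:
  assumes "open S" "\<And>p. p \<in> S \<Longrightarrow> (u has_derivative D p) (at p)"
    and "\<And>v. Ck_on n S (\<lambda>p. D p v)"
  shows "Ck_on (Suc n) S u"
proof -
  have "D p = frechet_derivative u (at p)" if "p \<in> S" for p
    using assms(2) frechet_derivative_at that by metis
  then have "Ck_on n S (\<lambda>p. frechet_derivative u (at p) v)" for v
    using assms(1,3) by (metis (mono_tags, lifting) Ck_on_cong)
  then show ?thesis
    using assms(2) by (auto simp: differentiable_def)
qed

section \<open>Closure properties of C^n maps\<close>

lemma Ck_on_const [simp]: "Ck_on n S (\<lambda>_. c)"
  by (induction n arbitrary: c) auto

lemma Ck_on_linear: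
  assumes "bounded_linear h" "open S" "Ck_on n S u"
  shows "Ck_on n S (\<lambda>p. h (u p))"
  using assms(3)
proof (induction n arbitrary: u)
  case 0
  then show ?case
    using assms(1) by (simp add: bounded_linear.continuous_on)
next
  case (Suc n)
  show ?case
  proof (rule Ck_on_SucI[OF assms(2)])
    show "((\<lambda>p. h (u p)) has_derivative (\<lambda>v. h (frechet_derivative u (at p) v))) (at p)"
      if "p \<in> S" for p
      using Ck_on_has_derivative[OF Suc.prems that] by (rule bounded_linear.has_derivative[OF assms(1)])
  qed (use Suc in auto)
qed

lemma Ck_on_bounded_linear: "bounded_linear h \<Longrightarrow> open S \<Longrightarrow> Ck_on n S h"
proof (cases n)
  case 0
  then show "bounded_linear h \<Longrightarrow> ?thesis"
    by (simp add: linear_continuous_on)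
next
  case (Suc m)
  then show "bounded_linear h \<Longrightarrow> open S \<Longrightarrow> ?thesis"
    using Ck_on_SucI[of S h "\<lambda>p. h" m] by (auto intro: bounded_linear_imp_has_derivative)
qed

lemma Ck_on_add:
  assumes "open S" "Ck_on n S u" "Ck_on n S v"
  shows "Ck_on n S (\<lambda>p. u p + v p)"
  using assms(2,3)
proof (induction n arbitrary: u v)
  case (Suc n)
  show ?case
  proof (rule Ck_on_SucI[OF assms(1)])
    show "((\<lambda>p. u p + v p) has_derivative
        (\<lambda>w. frechet_derivative u (at p) w + frechet_derivative v (at p) w)) (at p)"
      if "p \<in> S" for p
      using that by (intro has_derivative_add Ck_on_has_derivative[OF Suc.prems(1)]
          Ck_on_has_derivative[OF Suc.prems(2)])
  qed (use Suc in auto)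
qed (auto intro: continuous_on_add)

lemma Ck_on_bilinear:
  assumes "bounded_bilinear h" "open S" "Ck_on n S u" "Ck_on n S v"
  shows "Ck_on n S (\<lambda>p. h (u p) (v p))"
  using assms(3,4)
proof (induction n arbitrary: u v)
  case 0
  then show ?case
    using bounded_bilinear.continuous_on[OF assms(1)] by auto
next
  case (Suc n)
  show ?case
  proof (rule Ck_on_SucI[OF assms(2)])
    show "((\<lambda>p. h (u p) (v p)) has_derivative
        (\<lambda>w. h (u p) (frechet_derivative v (at p) w) + h (frechet_derivative u (at p) w) (v p)))
        (at p)" if "p \<in> S" for p
      using that by (intro bounded_bilinear.FDERIV[OF assms(1)] Ck_on_has_derivative[OF Suc.prems(1)]
          Ck_on_has_derivative[OF Suc.prems(2)])
    show "Ck_on n S (\<lambda>p. h (u p) (frechet_derivative v (at p) w) + h (frechet_derivative u (at p) w) (v p))"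
      for w
      using Suc.IH Suc.prems Ck_on_SucD[OF Suc.prems(1)] Ck_on_SucD[OF Suc.prems(2)]
      by (intro Ck_on_add assms(2)) auto
  qed
qed

lemma Ck_on_sum:
  assumes "finite I" "open S" "\<And>i. i \<in> I \<Longrightarrow> Ck_on n S (u i)"
  shows "Ck_on n S (\<lambda>p. \<Sum>i\<in>I. u i p)"
  using assms(1,3) by (induction I rule: finite_induct) (auto intro: Ck_on_add assms(2))

text \<open>The derivative of \<open>v\<close> is applied to a vector that varies with the point.
  Expanding this vector in \<open>Basis\<close> leaves directional derivatives of \<open>v\<close>
  in fixed directions, again composed with \<open>u\<close>, so an induction over arbitrary
  \<open>v\<close> closes; here the Euclidean codomain of \<open>u\<close> enters.\<close>

lemma Ck_on_compose:
  fixes u :: "'a::real_normed_vector \<Rightarrow> 'b::euclidean_space"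
  assumes "open S" "open T" "Ck_on n S u" "Ck_on n T v" "\<And>p. p \<in> S \<Longrightarrow> u p \<in> T"
  shows "Ck_on n S (\<lambda>p. v (u p))"
  using assms(3,4)
proof (induction n arbitrary: v)
  case 0
  then show ?case
    using assms(5) by (auto intro: continuous_on_compose2)
next
  case (Suc n)
  show ?case
  proof (rule Ck_on_SucI[OF assms(1)])
    fix p assume "p \<in> S"
    have v: "(v has_derivative frechet_derivative v (at (u p))) (at (u p))"
      using \<open>p \<in> S\<close> assms(5) by (intro Ck_on_has_derivative[OF Suc.prems(2)])
    then have lin: "linear (frechet_derivative v (at (u p)))"
      using has_derivative_linear by blast
    have "((\<lambda>p. v (u p)) has_derivative
        (\<lambda>w. frechet_derivative v (at (u p)) (frechet_derivative u (at p) w))) (at p)"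
      using Ck_on_has_derivative[OF Suc.prems(1) \<open>p \<in> S\<close>] v by (rule has_derivative_compose)
    also have "(\<lambda>w. frechet_derivative v (at (u p)) (frechet_derivative u (at p) w)) =
      (\<lambda>w. \<Sum>b\<in>Basis. (frechet_derivative u (at p) w \<bullet> b) *\<^sub>R frechet_derivative v (at (u p)) b)"
      by (subst euclidean_representation[symmetric], subst linear_sum[OF lin])
        (simp add: linear_cmul[OF lin] del: euclidean_representation)
    finally show "((\<lambda>p. v (u p)) has_derivative
      (\<lambda>w. \<Sum>b\<in>Basis. (frechet_derivative u (at p) w \<bullet> b) *\<^sub>R frechet_derivative v (at (u p)) b)) (at p)" .
  next
    fix w
    show "Ck_on n S (\<lambda>p. \<Sum>b\<in>Basis. (frechet_derivative u (at p) w \<bullet> b) *\<^sub>R frechet_derivative v (at (u p)) b)"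
      using Suc.prems Suc.IH[of "\<lambda>q. frechet_derivative v (at q) b" for b] Ck_on_SucD[OF Suc.prems(1)]
      by (intro Ck_on_sum Ck_on_bilinear[OF bounded_bilinear_scaleR] assms(1)
          Ck_on_linear[OF bounded_linear_inner_left]) auto
  qed
qed

text \<open>The derivative of \<open>inverse\<close> is a polynomial in \<open>inverse\<close>
  itself, so order \<open>n\<close> yields order \<open>n + 1\<close>.\<close>

lemma Ck_on_inverse: "Ck_on n (- {0::real}) inverse"
proof (induction n)
  case 0
  then show ?case by (auto intro: continuous_on_inverse)
next
  case (Suc n)
  show ?case
  proof (rule Ck_on_SucI)
    show "(inverse has_derivative (\<lambda>w. - (inverse p * w * inverse p))) (at p)"
      if "p \<in> - {0}" for p :: real
      using that by (auto intro!: has_derivative_inverse')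
    have *: "- (inverse p * w * inverse p) = - w *\<^sub>R (inverse p * inverse p)" for p w :: real
      by simp
    show "Ck_on n (- {0}) (\<lambda>p. - (inverse p * w * inverse p))" for w :: real
      unfolding *
      by (intro Ck_on_linear[OF bounded_linear_scaleR_right] Ck_on_bilinear[OF bounded_bilinear_mult] Suc) auto
  qed auto
qed

section \<open>Closure properties of smooth maps\<close>

named_theorems smooth

lemma smooth_on_const [smooth]: "smooth_on S (\<lambda>_. c)"
  by (simp add: smooth_on_def)

lemma smooth_on_id [smooth]: "open S \<Longrightarrow> smooth_on S (\<lambda>p. p)"
  by (simp add: smooth_on_def Ck_on_bounded_linear)

lemma smooth_on_fst [smooth]: "open S \<Longrightarrow> smooth_on S u \<Longrightarrow> smooth_on S (\<lambda>p. fst (u p))"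
  by (simp add: smooth_on_def Ck_on_linear bounded_linear_fst)

lemma smooth_on_snd [smooth]: "open S \<Longrightarrow> smooth_on S u \<Longrightarrow> smooth_on S (\<lambda>p. snd (u p))"
  by (simp add: smooth_on_def Ck_on_linear bounded_linear_snd)

lemma smooth_on_fst_fun [smooth]: "open S \<Longrightarrow> smooth_on S fst"
  by (simp add: smooth_on_def Ck_on_bounded_linear bounded_linear_fst)

lemma smooth_on_snd_fun [smooth]: "open S \<Longrightarrow> smooth_on S snd"
  by (simp add: smooth_on_def Ck_on_bounded_linear bounded_linear_snd)

lemma smooth_on_add [smooth]:
  "open S \<Longrightarrow> smooth_on S u \<Longrightarrow> smooth_on S v \<Longrightarrow> smooth_on S (\<lambda>p. u p + v p)"
  by (simp add: smooth_on_def Ck_on_add)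

lemma smooth_on_minus [smooth]: "open S \<Longrightarrow> smooth_on S u \<Longrightarrow> smooth_on S (\<lambda>p. - u p)"
  by (simp add: smooth_on_def Ck_on_linear bounded_linear_minus bounded_linear_ident)

lemma smooth_on_diff [smooth]:
  "open S \<Longrightarrow> smooth_on S u \<Longrightarrow> smooth_on S v \<Longrightarrow> smooth_on S (\<lambda>p. u p - v p)"
  using smooth_on_add[of S u "\<lambda>p. - v p"] smooth_on_minus[of S v] by simp

lemma smooth_on_mult [smooth]:
  fixes u v :: "_ \<Rightarrow> real"
  shows "open S \<Longrightarrow> smooth_on S u \<Longrightarrow> smooth_on S v \<Longrightarrow> smooth_on S (\<lambda>p. u p * v p)"
  by (simp add: smooth_on_def Ck_on_bilinear bounded_bilinear_mult)

lemma smooth_on_power [smooth]: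
  fixes u :: "_ \<Rightarrow> real"
  shows "open S \<Longrightarrow> smooth_on S u \<Longrightarrow> smooth_on S (\<lambda>p. u p ^ n)"
  by (induction n) (auto intro: smooth)

lemma smooth_on_compose:
  fixes u :: "'a::real_normed_vector \<Rightarrow> 'b::euclidean_space"
  shows "open S \<Longrightarrow> open T \<Longrightarrow> smooth_on S u \<Longrightarrow> smooth_on T v \<Longrightarrow> (\<And>p. p \<in> S \<Longrightarrow> u p \<in> T) \<Longrightarrow>
    smooth_on S (\<lambda>p. v (u p))"
  unfolding smooth_on_def by (blast intro: Ck_on_compose)

lemma smooth_on_divide [smooth]:
  fixes u v :: "_ \<Rightarrow> real"
  assumes "open S" "smooth_on S u" "smooth_on S v" "\<And>p. p \<in> S \<Longrightarrow> v p \<noteq> 0"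
  shows "smooth_on S (\<lambda>p. u p / v p)"
proof -
  have "smooth_on S (\<lambda>p. inverse (v p))"
    by (rule smooth_on_compose[of S "- {0}"]) (use assms Ck_on_inverse in \<open>auto simp: smooth_on_def\<close>)
  then show ?thesis
    using assms by (auto simp: divide_inverse intro: smooth)
qed

lemma smooth_on_Pair [smooth]:
  assumes "open S" "smooth_on S u" "smooth_on S v"
  shows "smooth_on S (\<lambda>p. (u p, v p))"
proof -
  have "bounded_linear (\<lambda>x. (x, 0))" "bounded_linear (\<lambda>x. (0, x))"
    by (auto intro!: bounded_linear_Pair bounded_linear_ident bounded_linear_zero)
  then have "smooth_on S (\<lambda>p. (u p, 0) + (0, v p))"
    using assms by (intro smooth_on_add) (auto simp: smooth_on_def intro: Ck_on_linear)
  then show ?thesis by simp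
qed

lemma smooth_on_pdx [smooth]: "smooth_on S u \<Longrightarrow> smooth_on S (pdx u)"
  unfolding pdx_def[abs_def] by (rule smooth_on_frechet_derivative)

lemma smooth_on_pdy [smooth]: "smooth_on S u \<Longrightarrow> smooth_on S (pdy u)"
  unfolding pdy_def[abs_def] by (rule smooth_on_frechet_derivative)

section \<open>Rules for the two partial derivatives\<close>

lemma pd_eqI:
  assumes "(u has_derivative D) (at p)"
  shows "pdx u p = D (1, 0)" "pdy u p = D (0, 1)"
  unfolding pdx_def pdy_def frechet_derivative_at[OF assms, symmetric] by simp_all

lemma frechet_derivative_pd:
  assumes "u differentiable (at p)"
  shows "frechet_derivative u (at p) v = fst v * pdx u p + snd v * pdy u p"
proof -
  have lin: "linear (frechet_derivative u (at p))"
    using assms linear_frechet_derivative by blast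
  have v: "v = fst v *\<^sub>R (1, 0) + snd v *\<^sub>R (0, 1)"
    by (cases v) simp
  show ?thesis
    by (subst v, subst linear_add[OF lin]) (simp add: linear_cmul[OF lin] pdx_def pdy_def del: scaleR_Pair)
qed

lemma has_derivative_pd:
  assumes "u differentiable (at p)"
  shows "(u has_derivative (\<lambda>v. fst v * pdx u p + snd v * pdy u p)) (at p)"
proof -
  have "frechet_derivative u (at p) = (\<lambda>v. fst v * pdx u p + snd v * pdy u p)"
    using frechet_derivative_pd[OF assms] by (rule ext)
  then show ?thesis
    using assms frechet_derivative_works[of u "at p"] by simp
qed

lemma pd_cong:
  assumes "open S" "p \<in> S" "\<And>q. q \<in> S \<Longrightarrow> u q = v q" "u differentiable (at p)"
  shows "pdx u p = pdx v p" "pdy u p = pdy v p"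
  using has_derivative_transform_within_open[OF has_derivative_pd[OF assms(4)] assms(1-3)]
  by (auto simp: pd_eqI[of v])

lemma pd_const [simp]: "pdx (\<lambda>_. c) p = 0" "pdy (\<lambda>_. c) p = 0"
  by (auto simp: pd_eqI[of _ "\<lambda>_. 0"])

lemma pd_fst [simp]: "pdx fst p = 1" "pdy fst p = 0"
  using pd_eqI[OF bounded_linear_imp_has_derivative[OF bounded_linear_fst]] by simp_all

lemma pd_snd [simp]: "pdx snd p = 0" "pdy snd p = 1"
  using pd_eqI[OF bounded_linear_imp_has_derivative[OF bounded_linear_snd]] by simp_all

context
  fixes u v :: "plane \<Rightarrow> real" and p :: plane
  assumes u: "u differentiable (at p)" and v: "v differentiable (at p)"
begin

lemma pd_add:
  "pdx (\<lambda>q. u q + v q) p = pdx u p + pdx v p" "pdy (\<lambda>q. u q + v q) p = pdy u p + pdy v p"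
  using pd_eqI[OF has_derivative_add[OF has_derivative_pd[OF u] has_derivative_pd[OF v]]] by simp_all

lemma pd_diff:
  "pdx (\<lambda>q. u q - v q) p = pdx u p - pdx v p" "pdy (\<lambda>q. u q - v q) p = pdy u p - pdy v p"
  using pd_eqI[OF has_derivative_diff[OF has_derivative_pd[OF u] has_derivative_pd[OF v]]] by simp_all

lemma pd_mult:
  "pdx (\<lambda>q. u q * v q) p = pdx u p * v p + u p * pdx v p"
  "pdy (\<lambda>q. u q * v q) p = pdy u p * v p + u p * pdy v p"
  using pd_eqI[OF has_derivative_mult[OF has_derivative_pd[OF u] has_derivative_pd[OF v]]] by simp_all

lemma pd_divide:
  assumes "v p \<noteq> 0"
  shows "pdx (\<lambda>q. u q / v q) p = (pdx u p * v p - u p * pdx v p) / (v p)\<^sup>2"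
    "pdy (\<lambda>q. u q / v q) p = (pdy u p * v p - u p * pdy v p) / (v p)\<^sup>2"
  using pd_eqI[OF has_derivative_divide'[OF has_derivative_pd[OF u] has_derivative_pd[OF v] assms]]
  by (simp_all add: power2_eq_square)

end

context
  fixes u :: "plane \<Rightarrow> real" and p :: plane
  assumes u: "u differentiable (at p)"
begin

lemma pd_minus: "pdx (\<lambda>q. - u q) p = - pdx u p" "pdy (\<lambda>q. - u q) p = - pdy u p"
  using pd_eqI[OF has_derivative_minus[OF has_derivative_pd[OF u]]] by simp_all

lemma pd_cmult: "pdx (\<lambda>q. c * u q) p = c * pdx u p" "pdy (\<lambda>q. c * u q) p = c * pdy u p"
  using pd_eqI[OF has_derivative_mult_right[OF has_derivative_pd[OF u]]] by simp_all

lemma pd_cdivide: "pdx (\<lambda>q. u q / c) p = pdx u p / c" "pdy (\<lambda>q. u q / c) p = pdy u p / c"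
  using pd_cmult[of "inverse c"] by (simp_all add: divide_inverse mult.commute)

lemma differentiable_cdivide: "(\<lambda>q. u q / c) differentiable (at p)"
  unfolding divide_inverse using u by (intro differentiable_mult differentiable_const)

end

section \<open>Symmetry of the mixed second derivatives\<close>

lemma has_real_derivative_slices:
  assumes "u differentiable (at (x, y))"
  shows "((\<lambda>t. u (t, y)) has_real_derivative pdx u (x, y)) (at x)"
    "((\<lambda>t. u (x, t)) has_real_derivative pdy u (x, y)) (at y)"
proof -
  have u: "(u has_derivative (\<lambda>v. fst v * pdx u (x, y) + snd v * pdy u (x, y))) (at (x, y))"
    using assms by (rule has_derivative_pd)
  have "((\<lambda>t. (t, y)) has_derivative (\<lambda>h. (h, 0))) (at x)"
    "((\<lambda>t. (x, t)) has_derivative (\<lambda>h. (0, h))) (at y)"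
    by (auto intro!: derivative_eq_intros)
  then show "((\<lambda>t. u (t, y)) has_real_derivative pdx u (x, y)) (at x)"
    "((\<lambda>t. u (x, t)) has_real_derivative pdy u (x, y)) (at y)"
    using has_derivative_compose u unfolding has_field_derivative_def
    by (fastforce simp: mult.commute[of _ "pdx u (x, y)"] mult.commute[of _ "pdy u (x, y)"])+
qed

text \<open>Both mixed partial derivatives are values of the second difference quotient of \<open>u\<close> over a small
  square, by two applications of the mean value theorem.\<close>

lemma mixed_difference:
  assumes sq: "{a..b} \<times> {c..d} \<subseteq> S" and ab: "a < b" "c < d" and u: "smooth_on S u"
  obtains p where "p \<in> {a..b} \<times> {c..d}"
    "u (b, d) - u (b, c) - u (a, d) + u (a, c) = (b - a) * (d - c) * pdy (pdx u) p"
proof -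
  have "((\<lambda>x. u (x, d) - u (x, c)) has_real_derivative pdx u (x, d) - pdx u (x, c)) (at x)"
    if "a \<le> x" "x \<le> b" for x
    using that sq ab
    by (intro DERIV_diff has_real_derivative_slices smooth_on_imp_differentiable[OF u]) auto
  then obtain x where x: "a < x" "x < b"
    "(u (b, d) - u (b, c)) - (u (a, d) - u (a, c)) = (b - a) * (pdx u (x, d) - pdx u (x, c))"
    using MVT2[OF ab(1), of "\<lambda>x. u (x, d) - u (x, c)" "\<lambda>x. pdx u (x, d) - pdx u (x, c)"] by auto
  have "((\<lambda>y. pdx u (x, y)) has_real_derivative pdy (pdx u) (x, y)) (at y)"
    if "c \<le> y" "y \<le> d" for y
    using that sq x
    by (intro has_real_derivative_slices smooth_on_imp_differentiable[OF smooth_on_pdx[OF u]]) auto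
  then obtain y where y: "c < y" "y < d" "pdx u (x, d) - pdx u (x, c) = (d - c) * pdy (pdx u) (x, y)"
    using MVT2[OF ab(2), of "\<lambda>y. pdx u (x, y)" "\<lambda>y. pdy (pdx u) (x, y)"] by auto
  show ?thesis
    by (rule that[of "(x, y)"]) (use x y in auto)
qed

lemma mixed_difference':
  assumes sq: "{a..b} \<times> {c..d} \<subseteq> S" and ab: "a < b" "c < d" and u: "smooth_on S u"
  obtains p where "p \<in> {a..b} \<times> {c..d}"
    "u (b, d) - u (b, c) - u (a, d) + u (a, c) = (b - a) * (d - c) * pdx (pdy u) p"
proof -
  have "((\<lambda>y. u (b, y) - u (a, y)) has_real_derivative pdy u (b, y) - pdy u (a, y)) (at y)"
    if "c \<le> y" "y \<le> d" for y
    using that sq ab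
    by (intro DERIV_diff has_real_derivative_slices smooth_on_imp_differentiable[OF u]) auto
  then obtain y where y: "c < y" "y < d"
    "(u (b, d) - u (a, d)) - (u (b, c) - u (a, c)) = (d - c) * (pdy u (b, y) - pdy u (a, y))"
    using MVT2[OF ab(2), of "\<lambda>y. u (b, y) - u (a, y)" "\<lambda>y. pdy u (b, y) - pdy u (a, y)"] by auto
  have "((\<lambda>x. pdy u (x, y)) has_real_derivative pdx (pdy u) (x, y)) (at x)"
    if "a \<le> x" "x \<le> b" for x
    using that sq y
    by (intro has_real_derivative_slices smooth_on_imp_differentiable[OF smooth_on_pdy[OF u]]) auto
  then obtain x where x: "a < x" "x < b" "pdy u (b, y) - pdy u (a, y) = (b - a) * pdx (pdy u) (x, y)"
    using MVT2[OF ab(1), of "\<lambda>x. pdy u (x, y)" "\<lambda>x. pdx (pdy u) (x, y)"] by auto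
  show ?thesis
  proof (rule that[of "(x, y)"])
    have "u (b, d) - u (b, c) - u (a, d) + u (a, c) = (u (b, d) - u (a, d)) - (u (b, c) - u (a, c))"
      by simp
    then show "u (b, d) - u (b, c) - u (a, d) + u (a, c) = (b - a) * (d - c) * pdx (pdy u) (x, y)"
      unfolding y(3) x(3) by simp
  qed (use x y in auto)
qed

lemma open_contains_square:
  fixes S :: "plane set"
  assumes "open S" "(x, y) \<in> S"
  obtains r where "r > 0" "{x - r..x + r} \<times> {y - r..y + r} \<subseteq> S"
proof -
  obtain a b where ab: "open a" "x \<in> a" "open b" "y \<in> b" "a \<times> b \<subseteq> S"
    using assms open_prod_elim by (metis mem_Sigma_iff)
  obtain e where e: "e > 0" "cball x e \<subseteq> a"
    using ab open_contains_cball by metis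
  obtain f where f: "f > 0" "cball y f \<subseteq> b"
    using ab open_contains_cball by metis
  show ?thesis
  proof (rule that[of "min e f"])
    show "{x - min e f..x + min e f} \<times> {y - min e f..y + min e f} \<subseteq> S"
      using e f ab(5) by (force simp: subset_eq dist_real_def)
  qed (use e f in auto)
qed

text \<open>Let \<open>e\<close> be half the supposed gap. On a small square continuity keeps each
  mixed derivative within \<open>e\<close> of its value at \<open>p\<close>; but the second
  difference is the area times some value of either one, so the two families of values meet.\<close>

lemma pd_commute:
  assumes "open S" "smooth_on S u" "p \<in> S"
  shows "pdy (pdx u) p = pdx (pdy u) p"
proof (rule ccontr)
  assume ne: "pdy (pdx u) p \<noteq> pdx (pdy u) p"
  obtain x y where p: "p = (x, y)" by (cases p)
  define e where "e = \<bar>pdy (pdx u) p - pdx (pdy u) p\<bar> / 2"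
  have e: "e > 0" using ne by (simp add: e_def)
  have "continuous_on S (pdy (pdx u))" "continuous_on S (pdx (pdy u))"
    using assms by (auto intro!: smooth_on_imp_continuous_on smooth)
  then have "open (S \<inter> pdy (pdx u) -` ball (pdy (pdx u) p) e)"
      "open (S \<inter> pdx (pdy u) -` ball (pdx (pdy u) p) e)"
    using assms(1) by (auto intro: continuous_open_preimage)
  then have "open ((S \<inter> pdy (pdx u) -` ball (pdy (pdx u) p) e) \<inter>
      (S \<inter> pdx (pdy u) -` ball (pdx (pdy u) p) e))"
    by blast
  then obtain r where r: "r > 0" "{x - r..x + r} \<times> {y - r..y + r} \<subseteq>
      (S \<inter> pdy (pdx u) -` ball (pdy (pdx u) p) e) \<inter> (S \<inter> pdx (pdy u) -` ball (pdx (pdy u) p) e)"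
    by (rule open_contains_square[of _ x y]) (use assms e p in auto)
  then have S: "{x - r..x + r} \<times> {y - r..y + r} \<subseteq> S" by auto
  have lt: "x - r < x + r" "y - r < y + r" using r by auto
  obtain q1 where q1: "q1 \<in> {x - r..x + r} \<times> {y - r..y + r}"
    "u (x + r, y + r) - u (x + r, y - r) - u (x - r, y + r) + u (x - r, y - r) =
      (x + r - (x - r)) * (y + r - (y - r)) * pdy (pdx u) q1"
    using mixed_difference[OF S lt assms(2)] by blast
  obtain q2 where q2: "q2 \<in> {x - r..x + r} \<times> {y - r..y + r}"
    "u (x + r, y + r) - u (x + r, y - r) - u (x - r, y + r) + u (x - r, y - r) =
      (x + r - (x - r)) * (y + r - (y - r)) * pdx (pdy u) q2"
    using mixed_difference'[OF S lt assms(2)] by blast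
  have "pdy (pdx u) q1 = pdx (pdy u) q2"
    using q1(2) q2(2) r(1) by simp
  moreover have "\<bar>pdy (pdx u) p - pdy (pdx u) q1\<bar> < e" "\<bar>pdx (pdy u) p - pdx (pdy u) q2\<bar> < e"
    using q1(1) q2(1) r(2) by (auto simp: dist_real_def)
  ultimately show False
    using e_def by (smt (verit) field_sum_of_halves)
qed

section \<open>Integrable linear systems\<close>

text \<open>Both the integrand and the upper limit vary. Substituting
  \<open>t = c + s * (y - c)\<close> fixes the interval to [0, 1] and moves the whole dependence
  into the integrand, where continuity of parameter integrals applies.\<close>

lemma continuous_on_integral_upper:
  fixes g :: "real \<Rightarrow> real \<Rightarrow> 'e::euclidean_space"
  assumes g: "continuous_on ({a..b} \<times> {c..d}) (\<lambda>(x, t). g x t)"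
  shows "continuous_on ({a..b} \<times> {c..d}) (\<lambda>(x, y). integral {c..y} (g x))"
proof -
  have gx: "continuous_on {c..d} (g x)" if "x \<in> {a..b}" for x
    using that by (intro continuous_on_compose2[OF g, of _ "\<lambda>t. (x, t)", simplified])
      (auto intro!: continuous_intros)
  have eq: "integral {c..y} (g x) = integral {0..1} (\<lambda>s. (y - c) *\<^sub>R g x (c + s * (y - c)))"
    if "x \<in> {a..b}" "y \<in> {c..d}" for x y
  proof -
    have mem: "c + s * (y - c) \<in> {c..y}" if "s \<in> {0..1}" for s
      using that \<open>y \<in> {c..d}\<close> mult_right_mono[of s 1 "y - c"] by auto
    have cont: "continuous_on {c..y} (g x)"
      using gx[OF that(1)] that(2) by (auto intro: continuous_on_subset)
    have "((\<lambda>s. integral {c..c + s * (y - c)} (g x)) has_vector_derivative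
        (y - c) *\<^sub>R g x (c + s * (y - c))) (at s within {0..1})" if "s \<in> {0..1}" for s
    proof -
      have "((\<lambda>s. c + s * (y - c)) has_vector_derivative y - c) (at s within {0..1})"
        by (auto intro!: derivative_eq_intros)
      moreover have "((\<lambda>u. integral {c..u} (g x)) has_vector_derivative g x (c + s * (y - c)))
          (at (c + s * (y - c)) within (\<lambda>s. c + s * (y - c)) ` {0..1})"
        using integral_has_vector_derivative[OF cont mem[OF that]]
        by (rule has_vector_derivative_within_subset) (use mem in auto)
      ultimately show ?thesis
        using vector_diff_chain_within by (fastforce simp: o_def)
    qed
    then have "((\<lambda>s. (y - c) *\<^sub>R g x (c + s * (y - c))) has_integral
        (integral {c..c + 1 * (y - c)} (g x) - integral {c..c + 0 * (y - c)} (g x))) {0..1}"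
      by (intro fundamental_theorem_of_calculus) auto
    then show ?thesis
      by (simp add: has_integral_iff)
  qed
  have mem: "c + s * (y - c) \<in> {c..d}" if "s \<in> {0..1}" "y \<in> {c..d}" for s y
    using that mult_right_mono[of s 1 "y - c"] by auto
  have "continuous_on (({a..b} \<times> {c..d}) \<times> {0..1::real})
      (\<lambda>q. (snd (fst q) - c) *\<^sub>R g (fst (fst q)) (c + snd q * (snd (fst q) - c)))"
    using mem
    by (intro continuous_intros continuous_on_compose2[OF g,
          of _ "\<lambda>q. (fst (fst q), c + snd q * (snd (fst q) - c))", simplified]) auto
  then have "continuous_on (({a..b} \<times> {c..d}) \<times> cbox 0 (1::real))
      (\<lambda>(p, s). (snd p - c) *\<^sub>R g (fst p) (c + s * (snd p - c)))"
    by (simp add: case_prod_unfold)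
  from integral_continuous_on_param[OF this]
  have "continuous_on ({a..b} \<times> {c..d}) (\<lambda>p. integral {0..1} (\<lambda>s. (snd p - c) *\<^sub>R g (fst p) (c + s * (snd p - c))))"
    by simp
  then show ?thesis
    by (rule continuous_on_eq) (auto simp: eq)
qed

section \<open>A contraction on small rectangles\<close>

context
  fixes h :: "'m::euclidean_space \<Rightarrow> 'e::euclidean_space \<Rightarrow> 'e" and M N My Nx :: "plane \<Rightarrow> 'm"
    and a b c d C :: real
  assumes h: "bounded_bilinear h"
    and less: "a < b" "c < d"
    and cont: "continuous_on ({a..b} \<times> {c..d}) M" "continuous_on ({a..b} \<times> {c..d}) N"
    and C: "C \<ge> 0" "\<And>p v. p \<in> {a..b} \<times> {c..d} \<Longrightarrow> norm (h (M p) v) \<le> C * norm v"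
      "\<And>p v. p \<in> {a..b} \<times> {c..d} \<Longrightarrow> norm (h (N p) v) \<le> C * norm v"
    and small: "(b - a) * C \<le> 1 / 8" "(d - c) * C \<le> 1 / 8"
begin

lemma continuous_on_h:
  "continuous_on S u \<Longrightarrow> continuous_on S v \<Longrightarrow> continuous_on S (\<lambda>p. h (u p) (v p))"
  by (rule bounded_bilinear.continuous_on[OF h])

lemma continuous_on_slice:
  assumes "continuous_on ({a..b} \<times> {c..d}) F"
  shows "x \<in> {a..b} \<Longrightarrow> continuous_on {c..d} (\<lambda>t. F (x, t))"
    "y \<in> {c..d} \<Longrightarrow> continuous_on {a..b} (\<lambda>s. F (s, y))"
  by (rule continuous_on_compose2[OF assms]; auto intro!: continuous_intros)+

text \<open>Integration of the system from the corner \<open>(a, c)\<close>, along the bottom edge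
  and then vertically. A function equal to a constant plus its own image satisfies the
  \<open>y\<close>-equation everywhere, but the \<open>x\<close>-equation evidently only on the
  bottom edge.\<close>

definition integral_op :: "(plane \<Rightarrow> 'e) \<Rightarrow> plane \<Rightarrow> 'e" where
  "integral_op F p = integral {a..fst p} (\<lambda>s. h (M (s, c)) (F (s, c))) +
     integral {c..snd p} (\<lambda>t. h (N (fst p, t)) (F (fst p, t)))"

lemma continuous_on_integral_op:
  assumes F: "continuous_on ({a..b} \<times> {c..d}) F"
  shows "continuous_on ({a..b} \<times> {c..d}) (integral_op F)"
proof -
  have "continuous_on ({a..b} \<times> {c..d}) (\<lambda>(x, t). h (N (x, t)) (F (x, t)))"
    using continuous_on_h[OF cont(2) F] by (simp add: case_prod_unfold)
  from continuous_on_integral_upper[OF this]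
  have 1: "continuous_on ({a..b} \<times> {c..d}) (\<lambda>p. integral {c..snd p} (\<lambda>t. h (N (fst p, t)) (F (fst p, t))))"
    by (simp add: case_prod_unfold)
  have "continuous_on {a..b} (\<lambda>s. h (M (s, c)) (F (s, c)))"
    using less by (intro continuous_on_slice(2)[OF continuous_on_h[OF cont(1) F]]) auto
  then have "continuous_on {a..b} (\<lambda>x. integral {a..x} (\<lambda>s. h (M (s, c)) (F (s, c))))"
    by (intro indefinite_integral_continuous_1 integrable_continuous_real)
  then have 2: "continuous_on ({a..b} \<times> {c..d}) (\<lambda>p. integral {a..fst p} (\<lambda>s. h (M (s, c)) (F (s, c))))"
    by (rule continuous_on_compose2) (auto intro!: continuous_intros)
  show ?thesis
    unfolding integral_op_def[abs_def] by (rule continuous_on_add[OF 2 1])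
qed

text \<open>Each leg of the path contributes at most \<open>B / 8\<close> by \<open>small\<close>. A
  quarter rather than a half is wanted because the contraction below evaluates the operator at two
  points.\<close>

lemma integral_op_diff_bound:
  assumes F: "continuous_on ({a..b} \<times> {c..d}) F" and G: "continuous_on ({a..b} \<times> {c..d}) G"
    and p: "p \<in> {a..b} \<times> {c..d}" and B: "\<And>q. q \<in> {a..b} \<times> {c..d} \<Longrightarrow> norm (F q - G q) \<le> B"
  shows "norm (integral_op F p - integral_op G p) \<le> B / 4"
proof -
  obtain x y where xy: "p = (x, y)" "x \<in> {a..b}" "y \<in> {c..d}"
    using p by auto
  have "0 \<le> B"
    using B[OF p] norm_ge_zero order_trans by blast
  then have CB: "0 \<le> C * B" using C by simp
  have est: "norm (h (M q) (F q) - h (M q) (G q)) \<le> C * B"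
    "norm (h (N q) (F q) - h (N q) (G q)) \<le> C * B" if "q \<in> {a..b} \<times> {c..d}" for q
    using C(2,3)[OF that, of "F q - G q"] mult_left_mono[OF B[OF that] C(1)]
    by (auto simp: bounded_bilinear.diff_right[OF h])
  have hM: "continuous_on {a..x} (\<lambda>s. h (M (s, c)) (F (s, c)))"
    "continuous_on {a..x} (\<lambda>s. h (M (s, c)) (G (s, c)))"
    by (rule continuous_on_subset[OF continuous_on_slice(2)[OF continuous_on_h[OF cont(1)]]];
        use xy less F G in auto)+
  have hN: "continuous_on {c..y} (\<lambda>t. h (N (x, t)) (F (x, t)))"
    "continuous_on {c..y} (\<lambda>t. h (N (x, t)) (G (x, t)))"
    by (rule continuous_on_subset[OF continuous_on_slice(1)[OF continuous_on_h[OF cont(2)]]];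
        use xy less F G in auto)+
  have "norm (integral {a..x} (\<lambda>s. h (M (s, c)) (F (s, c)) - h (M (s, c)) (G (s, c)))) \<le> C * B * (x - a)"
    using est xy less by (intro integral_bound continuous_on_diff hM) auto
  also have "\<dots> \<le> C * B * (b - a)"
    using xy by (intro mult_left_mono CB) auto
  also have "\<dots> \<le> B / 8"
    using mult_right_mono[OF small(1) \<open>0 \<le> B\<close>] by (simp add: algebra_simps)
  finally have 1: "norm (integral {a..x} (\<lambda>s. h (M (s, c)) (F (s, c)) - h (M (s, c)) (G (s, c)))) \<le> B / 8" .
  have "norm (integral {c..y} (\<lambda>t. h (N (x, t)) (F (x, t)) - h (N (x, t)) (G (x, t)))) \<le> C * B * (y - c)"
    using est xy less by (intro integral_bound continuous_on_diff hN) auto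
  also have "\<dots> \<le> C * B * (d - c)"
    using xy by (intro mult_left_mono CB) auto
  also have "\<dots> \<le> B / 8"
    using mult_right_mono[OF small(2) \<open>0 \<le> B\<close>] by (simp add: algebra_simps)
  finally have 2: "norm (integral {c..y} (\<lambda>t. h (N (x, t)) (F (x, t)) - h (N (x, t)) (G (x, t)))) \<le> B / 8" .
  have "integral_op F p - integral_op G p =
    integral {a..x} (\<lambda>s. h (M (s, c)) (F (s, c)) - h (M (s, c)) (G (s, c))) +
    integral {c..y} (\<lambda>t. h (N (x, t)) (F (x, t)) - h (N (x, t)) (G (x, t)))"
    using hM hN by (simp add: integral_op_def xy integral_diff integrable_continuous_real)
  then show ?thesis
    using norm_triangle_le[OF add_mono[OF 1 2]] by simp
qed

text \<open>The initial value is to be prescribed at \<open>p0\<close>, not at the corner where the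
  path starts. So the contraction is \<open>v + integral_op F p - integral_op F p0\<close>, whose
  value at \<open>p0\<close> is \<open>v\<close>; the constant \<open>w\<close> is then whatever
  remains.\<close>

lemma integral_op_fixpoint:
  assumes p0: "p0 \<in> {a..b} \<times> {c..d}"
  obtains F w where "continuous_on ({a..b} \<times> {c..d}) F" "F p0 = v"
    "\<And>p. p \<in> {a..b} \<times> {c..d} \<Longrightarrow> F p = w + integral_op F p"
proof -
  \<comment> \<open>Clamping extends functions on the rectangle to bounded continuous functions on
    the whole plane, which form a complete type for Banach's theorem.\<close>
  define cl where "cl = clamp (a, c) (b, d)"
  have box: "cbox (a, c) (b, d) = {a..b} \<times> {c..d}"
    by (simp add: cbox_Pair_eq)
  have le: "\<And>i. i \<in> Basis \<Longrightarrow> (a, c) \<bullet> i \<le> (b, d) \<bullet> i"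
    using less by (auto simp: Basis_prod_def)
  have cl: "cl p \<in> {a..b} \<times> {c..d}" for p
    unfolding cl_def box[symmetric] using le by (rule clamp_in_interval)
  have cl_id: "cl p = p" if "p \<in> {a..b} \<times> {c..d}" for p
    unfolding cl_def using that by (intro clamp_cancel_cbox) (simp add: box)
  define T where "T F p = v + integral_op F (cl p) - integral_op F p0" for F p
  have T: "T F \<in> bcontfun" if F: "continuous_on ({a..b} \<times> {c..d}) F" for F
  proof -
    have K: "continuous_on (cbox (a, c) (b, d)) (\<lambda>q. v + integral_op F q - integral_op F p0)"
      unfolding box by (intro continuous_intros continuous_on_integral_op F)
    have "continuous_on UNIV (\<lambda>p. v + integral_op F (cl p) - integral_op F p0)"
      unfolding cl_def by (rule clamp_continuous_on[OF K])
    moreover have "bounded (range (\<lambda>p. v + integral_op F (cl p) - integral_op F p0))"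
      unfolding cl_def
      by (rule clamp_bounded[OF compact_imp_bounded[OF compact_continuous_image[OF K compact_cbox]]])
    ultimately show ?thesis
      unfolding bcontfun_def T_def by simp
  qed
  have Tapp: "apply_bcontfun (Bcontfun (T (apply_bcontfun F))) = T (apply_bcontfun F)" for F
    by (intro Bcontfun_inverse T) auto
  have "\<exists>!F. Bcontfun (T (apply_bcontfun F)) = F"
  proof (rule banach_fix_type[of "1 / 2"], safe)
    fix F G :: "plane \<Rightarrow>\<^sub>C 'e"
    show "dist (Bcontfun (T (apply_bcontfun F))) (Bcontfun (T (apply_bcontfun G))) \<le> 1 / 2 * dist F G"
    proof (rule dist_bound)
      fix p
      have "norm (apply_bcontfun F q - apply_bcontfun G q) \<le> dist F G" for q
        using dist_bounded[of F q G] by (simp add: dist_norm)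
      then have "norm (integral_op F (cl p) - integral_op G (cl p)) \<le> dist F G / 4"
        "norm (integral_op F p0 - integral_op G p0) \<le> dist F G / 4"
        by (intro integral_op_diff_bound cl p0; auto)+
      then have "norm ((integral_op F (cl p) - integral_op G (cl p)) - (integral_op F p0 - integral_op G p0))
          \<le> dist F G / 4 + dist F G / 4"
        using norm_triangle_ineq4[of "integral_op F (cl p) - integral_op G (cl p)"
            "integral_op F p0 - integral_op G p0"] by linarith
      then show "dist (Bcontfun (T (apply_bcontfun F)) p) (Bcontfun (T (apply_bcontfun G)) p) \<le> 1 / 2 * dist F G"
        unfolding Tapp T_def by (simp add: dist_norm algebra_simps)
    qed
  qed auto
  then obtain F where "Bcontfun (T (apply_bcontfun F)) = F"
    by blast
  then have F: "apply_bcontfun F p = T (apply_bcontfun F) p" for p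
    using Tapp[of F] by simp
  show ?thesis
  proof (rule that)
    show "apply_bcontfun F p0 = v"
      by (subst F) (simp add: T_def cl_id p0)
    show "apply_bcontfun F p = (v - integral_op F p0) + integral_op F p"
      if "p \<in> {a..b} \<times> {c..d}" for p
      by (subst F) (simp add: T_def cl_id that)
  qed auto
qed

section \<open>Integrability makes the fixed point solve both equations\<close>

context
  fixes F :: "plane \<Rightarrow> 'e" and w :: 'e
  assumes F: "continuous_on ({a..b} \<times> {c..d}) F"
    and Fw: "\<And>p. p \<in> {a..b} \<times> {c..d} \<Longrightarrow> F p = w + integral_op F p"
    and cont': "continuous_on ({a..b} \<times> {c..d}) My" "continuous_on ({a..b} \<times> {c..d}) Nx"
    and My: "\<And>x y. x \<in> {a..b} \<Longrightarrow> y \<in> {c..d} \<Longrightarrow>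
      ((\<lambda>y. M (x, y)) has_vector_derivative My (x, y)) (at y within {c..d})"
    and Nx: "\<And>x y. x \<in> {a..b} \<Longrightarrow> y \<in> {c..d} \<Longrightarrow>
      ((\<lambda>x. N (x, y)) has_vector_derivative Nx (x, y)) (at x within {a..b})"
    and compat: "\<And>p v. p \<in> {a..b} \<times> {c..d} \<Longrightarrow>
      h (My p) v + h (M p) (h (N p) v) = h (Nx p) v + h (N p) (h (M p) v)"
    and C': "\<And>p v. p \<in> {a..b} \<times> {c..d} \<Longrightarrow> norm (h (Nx p) v) \<le> C * norm v"
    and ba: "b - a \<le> 1"
begin

lemma fixpoint_derivative_y:
  assumes x: "x \<in> {a..b}" and y: "y \<in> {c..d}"
  shows "((\<lambda>y. F (x, y)) has_vector_derivative h (N (x, y)) (F (x, y))) (at y within {c..d})"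
proof -
  have "((\<lambda>y. (w + integral {a..x} (\<lambda>s. h (M (s, c)) (F (s, c)))) +
      integral {c..y} (\<lambda>t. h (N (x, t)) (F (x, t)))) has_vector_derivative
      (0 + h (N (x, y)) (F (x, y)))) (at y within {c..d})"
    by (intro has_vector_derivative_add has_vector_derivative_const integral_has_vector_derivative
        continuous_on_slice(1)[OF continuous_on_h[OF cont(2) F]] x y)
  then have "((\<lambda>y. (w + integral {a..x} (\<lambda>s. h (M (s, c)) (F (s, c)))) +
      integral {c..y} (\<lambda>t. h (N (x, t)) (F (x, t)))) has_vector_derivative
      h (N (x, y)) (F (x, y))) (at y within {c..d})"
    by simp
  then show ?thesis
    by (rule has_vector_derivative_transform[OF y, rotated]) (use x Fw in \<open>simp add: integral_op_def algebra_simps\<close>)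
qed

text \<open>Continuing \<open>F\<close> from the left edge along the horizontal direction gives a second candidate;
  the defect \<open>F_by_x - F\<close> solves a homogeneous linear equation in \<open>y\<close> with zero initial value.\<close>

definition F_by_x :: "plane \<Rightarrow> 'e" where
  "F_by_x p = F (a, snd p) + integral {a..fst p} (\<lambda>s. h (M (s, snd p)) (F (s, snd p)))"

lemma F_by_x_derivative_x:
  assumes x: "x \<in> {a..b}" and y: "y \<in> {c..d}"
  shows "((\<lambda>x. F_by_x (x, y)) has_vector_derivative h (M (x, y)) (F (x, y))) (at x within {a..b})"
proof -
  have "((\<lambda>x. F (a, y) + integral {a..x} (\<lambda>s. h (M (s, y)) (F (s, y)))) has_vector_derivative
      (0 + h (M (x, y)) (F (x, y)))) (at x within {a..b})"
    by (intro has_vector_derivative_add has_vector_derivative_const integral_has_vector_derivative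
        continuous_on_slice(2)[OF continuous_on_h[OF cont(1) F]] x y)
  then show ?thesis
    by (simp add: F_by_x_def)
qed

text \<open>Differentiating under the integral gives the integrand \<open>Dy\<close>. By
  \<open>compat\<close> it differs from \<open>E\<close>, the derivative of
  \<open>h N F_by_x\<close> along the horizontal segment, exactly by \<open>h Nx\<close> applied to
  the defect. Integrating \<open>E\<close> produces boundary terms, and everything left involves the
  defect only.\<close>

lemma defect_derivative_y:
  assumes x: "x \<in> {a..b}" and y: "y \<in> {c..d}"
  shows "((\<lambda>y. F_by_x (x, y) - F (x, y)) has_vector_derivative
      h (N (x, y)) (F_by_x (x, y) - F (x, y)) -
      integral {a..x} (\<lambda>s. h (Nx (s, y)) (F_by_x (s, y) - F (s, y)))) (at y within {c..d})"
proof -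
  have sub: "{a..x} \<subseteq> {a..b}" "a \<in> {a..b}" using x less by auto
  define Dy where "Dy p = h (M p) (h (N p) (F p)) + h (My p) (F p)" for p
  have Dy_cont: "continuous_on ({a..b} \<times> {c..d}) Dy"
    unfolding Dy_def[abs_def] by (intro continuous_intros continuous_on_h cont cont' F)
  have "((\<lambda>y. integral (cbox a x) (\<lambda>s. h (M (s, y)) (F (s, y)))) has_vector_derivative
      integral (cbox a x) (\<lambda>s. Dy (s, y))) (at y within {c..d})"
  proof (rule leibniz_rule_vector_derivative)
    show "((\<lambda>y. h (M (s, y)) (F (s, y))) has_vector_derivative Dy (s, t)) (at t within {c..d})"
      if "t \<in> {c..d}" "s \<in> cbox a x" for s t
      unfolding Dy_def using that sub
      by (intro bounded_bilinear.has_vector_derivative[OF h] My fixpoint_derivative_y) auto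
    show "(\<lambda>s. h (M (s, t)) (F (s, t))) integrable_on cbox a x" if "t \<in> {c..d}" for t
      using that sub
      by (auto intro!: integrable_continuous_real
          continuous_on_subset[OF continuous_on_slice(2)[OF continuous_on_h[OF cont(1) F]]])
    have "continuous_on ({c..d} \<times> cbox a x) (\<lambda>q. Dy (snd q, fst q))"
      by (rule continuous_on_compose2[OF Dy_cont]) (use sub in \<open>auto intro!: continuous_intros\<close>)
    then show "continuous_on ({c..d} \<times> cbox a x) (\<lambda>(y, s). Dy (s, y))"
      by (simp add: case_prod_unfold)
  qed (use y in auto)
  then have 1: "((\<lambda>y. F_by_x (x, y) - F (x, y)) has_vector_derivative
      h (N (a, y)) (F (a, y)) + integral {a..x} (\<lambda>s. Dy (s, y)) - h (N (x, y)) (F (x, y))) (at y within {c..d})"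
    unfolding F_by_x_def using x y sub
    by (auto intro!: has_vector_derivative_add has_vector_derivative_diff fixpoint_derivative_y)
  define E where "E s = h (N (s, y)) (h (M (s, y)) (F (s, y))) + h (Nx (s, y)) (F_by_x (s, y))" for s
  have G: "((\<lambda>x. h (N (x, y)) (F_by_x (x, y))) has_vector_derivative E s) (at s within {a..x})"
    if "s \<in> {a..x}" for s
    unfolding E_def using that sub y
    by (intro has_vector_derivative_within_subset[OF bounded_bilinear.has_vector_derivative[OF h]]
        has_vector_derivative_within_subset[OF Nx]
        has_vector_derivative_within_subset[OF F_by_x_derivative_x]) auto
  have E_int: "(E has_integral h (N (x, y)) (F_by_x (x, y)) - h (N (a, y)) (F_by_x (a, y))) {a..x}"
    using x G by (intro fundamental_theorem_of_calculus) auto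
  have F_at_a: "F_by_x (a, y) = F (a, y)"
    by (simp add: F_by_x_def)
  have Dy_int: "((\<lambda>s. Dy (s, y)) has_integral integral {a..x} (\<lambda>s. Dy (s, y))) {a..x}"
    using sub y by (intro integrable_integral integrable_continuous_real
        continuous_on_subset[OF continuous_on_slice(2)[OF Dy_cont]])
  have "Dy (s, y) - E s = - h (Nx (s, y)) (F_by_x (s, y) - F (s, y))" if "s \<in> {a..x}" for s
    using compat[of "(s, y)" "F (s, y)"] that sub y
    by (auto simp: Dy_def E_def bounded_bilinear.diff_right[OF h] algebra_simps)
  then have "((\<lambda>s. - h (Nx (s, y)) (F_by_x (s, y) - F (s, y))) has_integral
      integral {a..x} (\<lambda>s. Dy (s, y)) - (h (N (x, y)) (F_by_x (x, y)) - h (N (a, y)) (F_by_x (a, y)))) {a..x}"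
    by (rule has_integral_eq[OF _ has_integral_diff[OF Dy_int E_int]])
  from has_integral_neg[OF this]
  have "((\<lambda>s. h (Nx (s, y)) (F_by_x (s, y) - F (s, y))) has_integral
      - (integral {a..x} (\<lambda>s. Dy (s, y)) - (h (N (x, y)) (F_by_x (x, y)) - h (N (a, y)) (F_by_x (a, y))))) {a..x}"
    by simp
  from integral_unique[OF this]
  have "h (N (a, y)) (F (a, y)) + integral {a..x} (\<lambda>s. Dy (s, y)) - h (N (x, y)) (F (x, y)) =
      h (N (x, y)) (F_by_x (x, y) - F (x, y)) -
      integral {a..x} (\<lambda>s. h (Nx (s, y)) (F_by_x (s, y) - F (s, y)))"
    by (simp only: F_at_a bounded_bilinear.diff_right[OF h]) simp
  with 1 show ?thesis
    by simp
qed

lemma F_by_x_continuous: "continuous_on ({a..b} \<times> {c..d}) F_by_x"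
proof -
  have "continuous_on ({c..d} \<times> {a..b}) (\<lambda>q. h (M (snd q, fst q)) (F (snd q, fst q)))"
    by (rule continuous_on_compose2[OF continuous_on_h[OF cont(1) F], of _ "\<lambda>q. (snd q, fst q)"])
      (auto intro!: continuous_intros)
  then have "continuous_on ({c..d} \<times> {a..b}) (\<lambda>(y, s). h (M (s, y)) (F (s, y)))"
    by (simp add: case_prod_unfold)
  from continuous_on_integral_upper[OF this]
  have U: "continuous_on ({c..d} \<times> {a..b}) (\<lambda>q. integral {a..snd q} (\<lambda>s. h (M (s, fst q)) (F (s, fst q))))"
    by (simp add: case_prod_unfold)
  have 1: "continuous_on ({a..b} \<times> {c..d})
      (\<lambda>p. integral {a..fst p} (\<lambda>s. h (M (s, snd p)) (F (s, snd p))))"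
  proof -
    have "continuous_on ({a..b} \<times> {c..d}) (\<lambda>p. (snd p, fst p))"
      by (intro continuous_intros)
    moreover have "(\<lambda>p. (snd p, fst p)) ` ({a..b} \<times> {c..d}) \<subseteq> {c..d} \<times> {a..b}"
      by auto
    ultimately show ?thesis
      using continuous_on_compose2[OF U] by fastforce
  qed
  have "continuous_on ({a..b} \<times> {c..d}) (\<lambda>p. F (a, snd p))"
    by (rule continuous_on_compose2[OF F]) (use less in \<open>auto intro!: continuous_intros\<close>)
  from continuous_on_add[OF this 1] show ?thesis
    by (simp add: F_by_x_def[abs_def])
qed

text \<open>A Gronwall argument in one stroke: let \<open>B\<close> be the maximal norm of the
  defect. Its \<open>y\<close>-derivative is at most \<open>2 * C * B\<close>, as
  \<open>b - a\<close> is at most 1, and it vanishes on the bottom edge; so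
  \<open>B \<le> 2 * C * B * (d - c) \<le> B / 4\<close>, which forces \<open>B = 0\<close>.\<close>

lemma F_by_x_eq:
  assumes "p \<in> {a..b} \<times> {c..d}"
  shows "F_by_x p = F p"
proof -
  let ?Q = "{a..b} \<times> {c..d}"
  have R: "continuous_on ?Q (\<lambda>p. norm (F_by_x p - F p))"
    by (intro continuous_intros F F_by_x_continuous)
  obtain q where q: "q \<in> ?Q" "\<And>p. p \<in> ?Q \<Longrightarrow> norm (F_by_x p - F p) \<le> norm (F_by_x q - F q)"
    using continuous_attains_sup[OF _ _ R] assms by (auto simp: compact_Times)
  define B where "B = norm (F_by_x q - F q)"
  have B: "B \<ge> 0" "\<And>p. p \<in> ?Q \<Longrightarrow> norm (F_by_x p - F p) \<le> B"
    using q by (auto simp: B_def)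
  obtain x y where xy: "q = (x, y)" "x \<in> {a..b}" "y \<in> {c..d}"
    using q by auto
  let ?D = "\<lambda>y. h (N (x, y)) (F_by_x (x, y) - F (x, y)) -
      integral {a..x} (\<lambda>s. h (Nx (s, y)) (F_by_x (s, y) - F (s, y)))"
  have D: "norm (?D t) \<le> 2 * C * B" if t: "t \<in> {c..d}" for t
  proof -
    have "norm (h (N (x, t)) (F_by_x (x, t) - F (x, t))) \<le> C * B"
      using xy t by (intro order_trans[OF C(3)] mult_left_mono B C(1)) auto
    moreover have "norm (integral {a..x} (\<lambda>s. h (Nx (s, t)) (F_by_x (s, t) - F (s, t)))) \<le> C * B * (x - a)"
    proof (rule integral_bound)
      show "continuous_on {a..x} (\<lambda>s. h (Nx (s, t)) (F_by_x (s, t) - F (s, t)))"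
        using xy t by (intro continuous_on_subset[OF continuous_on_slice(2)[OF continuous_on_h[OF cont'(2)]]]
            continuous_intros F F_by_x_continuous) auto
      show "norm (h (Nx (s, t)) (F_by_x (s, t) - F (s, t))) \<le> C * B" if "s \<in> {a..x}" for s
        using xy t that by (intro order_trans[OF C'] mult_left_mono B C(1)) auto
    qed (use xy in auto)
    moreover have "C * B * (x - a) \<le> C * B * 1"
      using xy ba B C(1) by (intro mult_left_mono) auto
    ultimately show ?thesis
      using norm_triangle_ineq4[of "h (N (x, t)) (F_by_x (x, t) - F (x, t))"
          "integral {a..x} (\<lambda>s. h (Nx (s, t)) (F_by_x (s, t) - F (s, t)))"] by linarith
  qed
  have "norm ((F_by_x (x, y) - F (x, y)) - (F_by_x (x, c) - F (x, c))) \<le> 2 * C * B * norm (y - c)"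
  proof (rule differentiable_bound[of "{c..d}"])
    show "((\<lambda>y. F_by_x (x, y) - F (x, y)) has_derivative (\<lambda>r. r *\<^sub>R ?D t)) (at t within {c..d})"
      if "t \<in> {c..d}" for t
      using defect_derivative_y[OF xy(2) that] by (simp add: has_vector_derivative_def)
    show "onorm (\<lambda>r::real. r *\<^sub>R ?D t) \<le> 2 * C * B" if "t \<in> {c..d}" for t
      using D[OF that] by (simp add: onorm_scaleR_left onorm_id)
  qed (use xy less in auto)
  moreover have "F_by_x (x, c) = F (x, c)"
    using xy less by (simp add: F_by_x_def Fw integral_op_def)
  ultimately have "B \<le> 2 * C * B * (y - c)"
    using xy by (simp add: B_def)
  also have "\<dots> \<le> 2 * C * B * (d - c)"
    using xy B C(1) by (intro mult_left_mono) auto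
  also have "\<dots> \<le> 2 * (B * (1 / 8))"
    using mult_left_mono[OF small(2) B(1)] by (simp add: algebra_simps)
  finally have "B \<le> 0" by simp
  then show ?thesis
    using B(2)[OF assms] by (metis eq_iff_diff_eq_0 norm_le_zero_iff order_trans)
qed

lemma fixpoint_derivative_x:
  assumes x: "x \<in> {a..b}" and y: "y \<in> {c..d}"
  shows "((\<lambda>x. F (x, y)) has_vector_derivative h (M (x, y)) (F (x, y))) (at x within {a..b})"
  using F_by_x_derivative_x[OF x y]
  by (rule has_vector_derivative_transform[OF x, rotated]) (use y F_by_x_eq in auto)

end

end

text \<open>\<open>compat\<close> says that the two mixed second derivatives of a solution agree; it
  is required for every vector \<open>v\<close> because every initial value has to be attained. The
  bilinear map \<open>h\<close> stands for a matrix acting on a vector.\<close>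

theorem linear_frobenius:
  fixes h :: "'m::euclidean_space \<Rightarrow> 'e::euclidean_space \<Rightarrow> 'e" and M N My Nx :: "plane \<Rightarrow> 'm"
  assumes h: "bounded_bilinear h" and S: "open S" "p0 \<in> S"
    and cont: "continuous_on S M" "continuous_on S N" "continuous_on S My" "continuous_on S Nx"
    and My: "\<And>x y. (x, y) \<in> S \<Longrightarrow> ((\<lambda>y. M (x, y)) has_vector_derivative My (x, y)) (at y)"
    and Nx: "\<And>x y. (x, y) \<in> S \<Longrightarrow> ((\<lambda>x. N (x, y)) has_vector_derivative Nx (x, y)) (at x)"
    and compat: "\<And>p v. p \<in> S \<Longrightarrow> h (My p) v + h (M p) (h (N p) v) = h (Nx p) v + h (N p) (h (M p) v)"
  obtains T F where "open T" "p0 \<in> T" "T \<subseteq> S" "continuous_on T F" "F p0 = v"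
    "\<forall>x y. (x, y) \<in> T \<longrightarrow> ((\<lambda>x. F (x, y)) has_vector_derivative h (M (x, y)) (F (x, y))) (at x)"
    "\<forall>x y. (x, y) \<in> T \<longrightarrow> ((\<lambda>y. F (x, y)) has_vector_derivative h (N (x, y)) (F (x, y))) (at y)"
proof -
  obtain x0 y0 where p0: "p0 = (x0, y0)" by (cases p0)
  obtain r where r: "r > 0" "{x0 - r..x0 + r} \<times> {y0 - r..y0 + r} \<subseteq> S"
    using open_contains_square S p0 by metis
  let ?Qr = "{x0 - r..x0 + r} \<times> {y0 - r..y0 + r}"
  obtain K where K: "K \<ge> 0" "\<And>m v. norm (h m v) \<le> norm m * norm v * K"
    using bounded_bilinear.nonneg_bounded[OF h] by blast
  have "\<exists>B \<ge> 0. \<forall>p\<in>?Qr. norm (X p) \<le> B" if "continuous_on S X" for X :: "plane \<Rightarrow> 'm"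
  proof -
    have "compact (X ` ?Qr)"
      using that r by (intro compact_continuous_image compact_Times) (auto intro: continuous_on_subset)
    then show ?thesis
      using compact_imp_bounded bounded_pos by (metis image_eqI less_imp_le)
  qed
  then obtain B1 B2 B3 where B: "B1 \<ge> 0" "\<And>p. p \<in> ?Qr \<Longrightarrow> norm (M p) \<le> B1"
    "B2 \<ge> 0" "\<And>p. p \<in> ?Qr \<Longrightarrow> norm (N p) \<le> B2" "B3 \<ge> 0" "\<And>p. p \<in> ?Qr \<Longrightarrow> norm (Nx p) \<le> B3"
    using cont by metis
  define C where "C = (B1 + B2 + B3) * K"
  have C: "C \<ge> 0" "\<And>p v. p \<in> ?Qr \<Longrightarrow> norm (h (M p) v) \<le> C * norm v"
    "\<And>p v. p \<in> ?Qr \<Longrightarrow> norm (h (N p) v) \<le> C * norm v" "\<And>p v. p \<in> ?Qr \<Longrightarrow> norm (h (Nx p) v) \<le> C * norm v"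
  proof -
    show "C \<ge> 0" using B K by (simp add: C_def)
    have *: "norm (h m v) \<le> C * norm v" if "norm m \<le> B1 + B2 + B3" for m v
    proof -
      have "norm m * norm v * K \<le> (B1 + B2 + B3) * norm v * K"
        using that K(1) by (intro mult_right_mono) auto
      then show ?thesis
        using K(2)[of m v] by (simp add: C_def algebra_simps)
    qed
    show "norm (h (M p) v) \<le> C * norm v" "norm (h (N p) v) \<le> C * norm v" "norm (h (Nx p) v) \<le> C * norm v"
      if "p \<in> ?Qr" for p v
      by (rule *; use B(1,3,5) B(2,4,6)[OF that] in linarith)+
  qed
  \<comment> \<open>The sides of the new square have length \<open>2 * e\<close>: the bound 1/2
    makes them at most 1, and the last bound makes their product with \<open>C\<close> at most 1/8.
    Using \<open>C + 1\<close> avoids division by zero.\<close>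
  define e where "e = min r (min (1 / 2) (1 / (16 * (C + 1))))"
  have e: "e > 0" "e \<le> r"
    using r C(1) by (auto simp: e_def)
  have e2: "e \<le> 1 / 2"
    unfolding e_def by (rule min.coboundedI2, rule min.coboundedI1, rule order_refl)
  have "e * (C + 1) \<le> 1 / 16"
  proof -
    have "e \<le> 1 / (16 * (C + 1))"
      unfolding e_def by (rule min.coboundedI2, rule min.coboundedI2, rule order_refl)
    from mult_right_mono[OF this, of "C + 1"] have "e * (C + 1) \<le> 1 / (16 * (C + 1)) * (C + 1)"
      using C(1) by simp
    also have "\<dots> = 1 / 16"
      using C(1) by (simp add: divide_simps)
    finally show ?thesis .
  qed
  then have eC: "e * C \<le> 1 / 16"
    using e by (simp add: algebra_simps)
  let ?a = "x0 - e" and ?b = "x0 + e" and ?c = "y0 - e" and ?d = "y0 + e"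
  let ?Q = "{?a..?b} \<times> {?c..?d}"
  have Q: "?Q \<subseteq> ?Qr" "?Q \<subseteq> S"
    using e r(2) by auto
  have small: "(?b - ?a) * C \<le> 1 / 8" "(?d - ?c) * C \<le> 1 / 8" "?a < ?b" "?c < ?d" "?b - ?a \<le> 1"
    using e e2 eC by (auto simp: algebra_simps)
  have contQ: "continuous_on ?Q M" "continuous_on ?Q N" "continuous_on ?Q My" "continuous_on ?Q Nx"
    using cont Q(2) by (auto intro: continuous_on_subset)
  have CQ: "norm (h (M p) v) \<le> C * norm v" "norm (h (N p) v) \<le> C * norm v"
    "norm (h (Nx p) v) \<le> C * norm v" if "p \<in> ?Q" for p v
    using C(2-4) Q(1) that by blast+
  have p0Q: "p0 \<in> ?Q"
    using p0 e by auto
  note hyps = h small(3,4) contQ(1,2) C(1) CQ(1,2) small(1,2)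
  obtain F w where F: "continuous_on ?Q F" "F p0 = v"
    "\<And>p. p \<in> ?Q \<Longrightarrow> F p = w + integral_op h M N ?a ?c F p"
    using integral_op_fixpoint[OF hyps p0Q] by blast
  have My': "((\<lambda>y. M (x, y)) has_vector_derivative My (x, y)) (at y within {?c..?d})"
    and Nx': "((\<lambda>x. N (x, y)) has_vector_derivative Nx (x, y)) (at x within {?a..?b})"
    if "x \<in> {?a..?b}" "y \<in> {?c..?d}" for x y
    using that Q(2) by (blast intro: has_vector_derivative_at_within My Nx)+
  have compat': "h (My p) v + h (M p) (h (N p) v) = h (Nx p) v + h (N p) (h (M p) v)"
    if "p \<in> ?Q" for p v
    using compat that Q(2) by blast
  note fixpoint_hyps = hyps F(1,3) contQ(3,4) My' Nx' compat' CQ(3) small(5)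
  note Fx = fixpoint_derivative_x[OF fixpoint_hyps]
  note Fy = fixpoint_derivative_y[OF fixpoint_hyps]
  \<comment> \<open>In the open rectangle the derivatives within the closed sides become ordinary
    ones.\<close>
  let ?T = "{?a<..<?b} \<times> {?c<..<?d}"
  show ?thesis
  proof (rule that)
    show "open ?T" by (intro open_Times) auto
    show "p0 \<in> ?T" using e p0 by auto
    show "?T \<subseteq> S" using Q(2) by (auto simp: subset_eq)
    show "continuous_on ?T F" using F(1) by (rule continuous_on_subset) auto
    have "((\<lambda>x. F (x, y)) has_vector_derivative h (M (x, y)) (F (x, y))) (at x)"
      "((\<lambda>y. F (x, y)) has_vector_derivative h (N (x, y)) (F (x, y))) (at y)"
      if "(x, y) \<in> ?T" for x y
    proof -
      have "at x within {?a..?b} = at x" "at y within {?c..?d} = at y"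
        using that by (auto intro!: at_within_interior)
      then show "((\<lambda>x. F (x, y)) has_vector_derivative h (M (x, y)) (F (x, y))) (at x)"
        "((\<lambda>y. F (x, y)) has_vector_derivative h (N (x, y)) (F (x, y))) (at y)"
        using Fx[of x y] Fy[of x y] that by auto
    qed
    then show "\<forall>x y. (x, y) \<in> ?T \<longrightarrow> ((\<lambda>x. F (x, y)) has_vector_derivative h (M (x, y)) (F (x, y))) (at x)"
      "\<forall>x y. (x, y) \<in> ?T \<longrightarrow> ((\<lambda>y. F (x, y)) has_vector_derivative h (N (x, y)) (F (x, y))) (at y)"
      by blast+
  qed (rule F(2))
qed

section \<open>Local coordinates and leaves\<close>

definition jac :: "(plane \<Rightarrow> real) \<Rightarrow> (plane \<Rightarrow> real) \<Rightarrow> plane \<Rightarrow> real" where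
  "jac u v p = pdx u p * pdy v p - pdy u p * pdx v p"

lemma smooth_on_jac [smooth]: "open S \<Longrightarrow> smooth_on S u \<Longrightarrow> smooth_on S v \<Longrightarrow> smooth_on S (jac u v)"
  unfolding jac_def[abs_def] by (intro smooth)

lemma has_derivative_Pair_pd:
  assumes "u differentiable (at p)" "v differentiable (at p)"
  shows "((\<lambda>q. (u q, v q)) has_derivative
    (\<lambda>h. (fst h * pdx u p + snd h * pdy u p, fst h * pdx v p + snd h * pdy v p))) (at p)"
  using assms by (intro has_derivative_Pair has_derivative_pd)

section \<open>The inverse function theorem in the plane\<close>

context
  fixes U :: "plane set" and u v :: "plane \<Rightarrow> real"
  assumes U: "open U" and u: "smooth_on U u" and v: "smooth_on U v"
begin

lemma Cramer_inverse:
  assumes "jac u v q \<noteq> 0"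
  shows "(\<lambda>h. ((fst h * pdy v q - snd h * pdy u q) / jac u v q, (snd h * pdx u q - fst h * pdx v q) / jac u v q)) \<circ>
    (\<lambda>h. (fst h * pdx u q + snd h * pdy u q, fst h * pdx v q + snd h * pdy v q)) = id"
proof -
  have "(a * pdx u q + b * pdy u q) * pdy v q - (a * pdx v q + b * pdy v q) * pdy u q = a * jac u v q"
    "(a * pdx v q + b * pdy v q) * pdx u q - (a * pdx u q + b * pdy u q) * pdx v q = b * jac u v q" for a b
    by (simp_all add: jac_def algebra_simps)
  then show ?thesis
    using assms by (auto simp: fun_eq_iff)
qed

lemma bounded_linear_Cramer:
  "bounded_linear (\<lambda>h. ((fst h * a - snd h * b) / j, (snd h * c - fst h * d) / j :: real))"
  by (intro bounded_linear_Pair bounded_linear_divide bounded_linear_compose[OF bounded_linear_divide]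
      bounded_linear_sub bounded_linear_mult_const bounded_linear_fst bounded_linear_snd)

text \<open>Openness is invariance of domain, and the derivative of \<open>g\<close> is given by
  Cramer's rule. That derivative is a smooth function composed with \<open>g\<close>, so each order
  of differentiability of \<open>g\<close> yields the next.\<close>

lemma inverse_function_smooth:
  assumes inj: "inj_on (\<lambda>p. (u p, v p)) U" and J: "\<And>q. q \<in> U \<Longrightarrow> jac u v q \<noteq> 0"
  defines "V \<equiv> (\<lambda>p. (u p, v p)) ` U" and "g \<equiv> inv_into U (\<lambda>p. (u p, v p))"
  shows "open V" "smooth_on V g"
    "\<And>y. y \<in> V \<Longrightarrow> (g has_derivative (\<lambda>h. ((fst h * pdy v (g y) - snd h * pdy u (g y)) / jac u v (g y),
        (snd h * pdx u (g y) - fst h * pdx v (g y)) / jac u v (g y)))) (at y)"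
proof -
  have cont: "continuous_on U (\<lambda>p. (u p, v p))"
    using u v by (intro continuous_on_Pair smooth_on_imp_continuous_on)
  show V: "open V"
    unfolding V_def by (rule invariance_of_domain[OF cont U inj])
  have gU: "g y \<in> U" "(u (g y), v (g y)) = y" if "y \<in> V" for y
    using that inv_into_into[of y "\<lambda>p. (u p, v p)" U] f_inv_into_f[of y "\<lambda>p. (u p, v p)" U]
    by (auto simp: V_def g_def)
  have g_cont: "continuous_on V g"
    unfolding V_def using U cont
  proof (rule continuous_on_inverse_open)
    show "g (u q, v q) = q" if "q \<in> U" for q
      unfolding g_def using inv_into_f_f[OF inj that] by simp
  qed auto
  show der: "(g has_derivative (\<lambda>h. ((fst h * pdy v (g y) - snd h * pdy u (g y)) / jac u v (g y),
        (snd h * pdx u (g y) - fst h * pdx v (g y)) / jac u v (g y)))) (at y)" if y: "y \<in> V" for y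
  proof (rule has_derivative_inverse_basic[where f = "\<lambda>p. (u p, v p)"])
    show "((\<lambda>p. (u p, v p)) has_derivative (\<lambda>h. (fst h * pdx u (g y) + snd h * pdy u (g y),
        fst h * pdx v (g y) + snd h * pdy v (g y)))) (at (g y))"
      using gU[OF y] u v by (intro has_derivative_Pair_pd) (auto intro: smooth_on_imp_differentiable)
    show "continuous (at y) g"
      using g_cont V y by (simp add: continuous_on_eq_continuous_at)
  qed (use V y gU J Cramer_inverse bounded_linear_Cramer in auto)
  have "Ck_on n V g" for n
  proof (induction n)
    case 0
    then show ?case using g_cont by simp
  next
    case (Suc n)
    show ?case
    proof (rule Ck_on_SucI[OF V der])
      fix h :: plane
      have "smooth_on U (\<lambda>q. ((fst h * pdy v q - snd h * pdy u q) / jac u v q,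
          (snd h * pdx u q - fst h * pdx v q) / jac u v q))"
        using U u v J by (intro smooth) auto
      then have "Ck_on n U (\<lambda>q. ((fst h * pdy v q - snd h * pdy u q) / jac u v q,
          (snd h * pdx u q - fst h * pdx v q) / jac u v q))"
        by (simp add: smooth_on_def)
      from Ck_on_compose[OF V U Suc this] gU
      show "Ck_on n V (\<lambda>y. ((fst h * pdy v (g y) - snd h * pdy u (g y)) / jac u v (g y),
          (snd h * pdx u (g y) - fst h * pdx v (g y)) / jac u v (g y)))"
        by blast
    qed
  qed
  then show "smooth_on V g"
    by (simp add: smooth_on_def)
qed

lemma jac_nonzero_locally_injective:
  assumes p: "p \<in> U" and J: "jac u v p \<noteq> 0"
  obtains r where "r > 0" "ball p r \<subseteq> U" "inj_on (\<lambda>q. (u q, v q)) (ball p r)"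
    "\<And>q. q \<in> ball p r \<Longrightarrow> jac u v q \<noteq> 0"
proof -
  let ?D = "\<lambda>q h. (fst h * pdx u q + snd h * pdy u q, fst h * pdx v q + snd h * pdy v q)"
  have pd: "smooth_on U (pdx u)" "smooth_on U (pdy u)" "smooth_on U (pdx v)" "smooth_on U (pdy v)"
    using u v by (auto intro: smooth)
  \<comment> \<open>The injectivity theorem asks for a derivative continuous in operator norm.
    \<open>B\<close> is continuous, vanishes at \<open>p\<close>, and dominates the norm of the
    change of the derivative.\<close>
  define B where "B q = \<bar>pdx u q - pdx u p\<bar> + \<bar>pdy u q - pdy u p\<bar> + \<bar>pdx v q - pdx v p\<bar> + \<bar>pdy v q - pdy v p\<bar>" for q
  have "continuous_on U B"
    unfolding B_def[abs_def] using pd by (intro continuous_intros smooth_on_imp_continuous_on)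
  then have B: "continuous (at p) B"
    using U p by (simp add: continuous_on_eq_continuous_at)
  obtain r where r: "r > 0" "ball p r \<subseteq> U" "inj_on (\<lambda>q. (u q, v q)) (ball p r)"
  proof (rule has_derivative_locally_injective[where f = "\<lambda>q. (u q, v q)" and f' = ?D,
        OF p U bounded_linear_Cramer Cramer_inverse[OF J]])
    show "((\<lambda>q. (u q, v q)) has_derivative ?D q) (at q)" if "q \<in> U" for q
      using that u v by (intro has_derivative_Pair_pd) (auto intro: smooth_on_imp_differentiable)
    fix e :: real
    assume "e > 0"
    then obtain d where d: "d > 0" "\<And>q. dist q p < d \<Longrightarrow> dist (B q) (B p) < e"
      using B unfolding continuous_at_eps_delta by blast
    have "onorm (\<lambda>h. ?D q h - ?D p h) \<le> B q" for q
    proof (rule onorm_le)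
      fix h :: plane
      have bnd: "\<bar>fst h * a + snd h * b\<bar> \<le> norm h * (\<bar>a\<bar> + \<bar>b\<bar>)" for a b
      proof -
        have "\<bar>fst h * a + snd h * b\<bar> \<le> \<bar>fst h\<bar> * \<bar>a\<bar> + \<bar>snd h\<bar> * \<bar>b\<bar>"
          by (metis abs_mult abs_triangle_ineq)
        also have "\<dots> \<le> norm h * \<bar>a\<bar> + norm h * \<bar>b\<bar>"
          using norm_fst_le[of "fst h" "snd h"] norm_snd_le[of "snd h" "fst h"]
          by (intro add_mono mult_right_mono) auto
        finally show ?thesis by (simp add: algebra_simps)
      qed
      have "?D q h - ?D p h = (fst h * (pdx u q - pdx u p) + snd h * (pdy u q - pdy u p),
          fst h * (pdx v q - pdx v p) + snd h * (pdy v q - pdy v p))"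
        by (simp add: algebra_simps)
      then have "norm (?D q h - ?D p h) \<le> \<bar>fst h * (pdx u q - pdx u p) + snd h * (pdy u q - pdy u p)\<bar> +
          \<bar>fst h * (pdx v q - pdx v p) + snd h * (pdy v q - pdy v p)\<bar>"
        using norm_Pair_le by (metis real_norm_def)
      also have "\<dots> \<le> norm h * (\<bar>pdx u q - pdx u p\<bar> + \<bar>pdy u q - pdy u p\<bar>) +
          norm h * (\<bar>pdx v q - pdx v p\<bar> + \<bar>pdy v q - pdy v p\<bar>)"
        by (intro add_mono bnd)
      finally show "norm (?D q h - ?D p h) \<le> B q * norm h"
        by (simp add: B_def algebra_simps)
    qed
    moreover have "B q < e" if "dist p q < d" for q
      using d(2)[of q] that by (simp add: B_def dist_commute dist_real_def)
    ultimately have "onorm (\<lambda>h. ?D q h - ?D p h) < e" if "dist p q < d" for q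
      using that order_le_less_trans by blast
    then show "\<exists>d>0. \<forall>q. dist p q < d \<longrightarrow> onorm (\<lambda>h. ?D q h - ?D p h) < e"
      using d(1) by blast
  qed blast
  have "continuous_on U (jac u v)"
    using U u v by (intro smooth_on_imp_continuous_on smooth)
  then have "open (U \<inter> jac u v -` (- {0}))"
    using U by (intro continuous_open_preimage) auto
  then obtain s where s: "s > 0" "ball p s \<subseteq> U \<inter> jac u v -` (- {0})"
    using p J open_contains_ball by (metis ComplI IntI singletonD vimageI)
  show ?thesis
  proof (rule that)
    show "min r s > 0" "ball p (min r s) \<subseteq> U" "inj_on (\<lambda>q. (u q, v q)) (ball p (min r s))"
      using r s by (auto intro: inj_on_subset)
    show "jac u v q \<noteq> 0" if "q \<in> ball p (min r s)" for q
      using s(2) that by (auto simp: subset_eq)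
  qed
qed

end

text \<open>A coordinate \<open>z\<close> with \<open>jac z w p \<noteq> 0\<close> completes
  \<open>w\<close> to local coordinates, and the curve is the inverse chart restricted to constant
  \<open>w\<close>. Its velocity is the field \<open>(w_y, - w_x)\<close> scaled by
  \<open>\<rho> = 1 / jac z w\<close>. The last clause records that near \<open>p\<close> the curve
  exhausts the level set.\<close>

lemma level_curve:
  assumes U: "open U" and w: "smooth_on U w" and p: "p \<in> U" "pdx w p \<noteq> 0 \<or> pdy w p \<noteq> 0"
  obtains \<gamma> :: "real \<Rightarrow> plane" and \<rho> :: "real \<Rightarrow> real" and s0 e
  where "e > 0" "\<gamma> s0 = p" "\<forall>s\<in>ball s0 e. \<gamma> s \<in> U \<and> w (\<gamma> s) = w p \<and> \<rho> s \<noteq> 0 \<and>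
      (\<gamma> has_derivative (\<lambda>h. (h * \<rho> s * pdy w (\<gamma> s), - (h * \<rho> s * pdx w (\<gamma> s))))) (at s)"
    "eventually (\<lambda>q. w q = w p \<longrightarrow> q \<in> \<gamma> ` ball s0 e) (nhds p)"
proof -
  obtain z where z: "z = fst \<or> z = snd" "jac z w p \<noteq> 0"
    using p(2) by (metis jac_def pd_fst pd_snd add_0 diff_0 diff_zero mult_1 mult_zero_left neg_equal_0_iff_equal)
  have zs: "smooth_on U z"
    using z U by (auto intro: smooth)
  obtain r where r: "r > 0" "ball p r \<subseteq> U" "inj_on (\<lambda>q. (z q, w q)) (ball p r)"
    "\<And>q. q \<in> ball p r \<Longrightarrow> jac z w q \<noteq> 0"
    using jac_nonzero_locally_injective[OF U zs w p(1) z(2)] by blast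
  let ?\<phi> = "\<lambda>q. (z q, w q)"
  define V where "V = ?\<phi> ` ball p r"
  define g where "g = inv_into (ball p r) ?\<phi>"
  have sm: "smooth_on (ball p r) z" "smooth_on (ball p r) w"
    using zs w r(2) by (auto intro: smooth_on_subset)
  have ift: "open V"
    "\<And>y. y \<in> V \<Longrightarrow> (g has_derivative (\<lambda>h. ((fst h * pdy w (g y) - snd h * pdy z (g y)) / jac z w (g y),
        (snd h * pdx z (g y) - fst h * pdx w (g y)) / jac z w (g y)))) (at y)"
    using inverse_function_smooth(1,3)[OF open_ball sm r(3)] r(4) unfolding V_def g_def by blast+
  have \<phi>p: "?\<phi> p \<in> V"
    using r(1) by (auto simp: V_def)
  obtain e where e: "e > 0" "ball (?\<phi> p) e \<subseteq> V"
    using ift(1) \<phi>p open_contains_ball by blast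
  have inV: "(s, w p) \<in> V" if "s \<in> ball (z p) e" for s
    using that e(2) by (auto simp: dist_Pair_Pair dist_real_def)
  have g: "g y \<in> ball p r" "z (g y) = fst y" "w (g y) = snd y" if "y \<in> V" for y
    using that inv_into_into[of y ?\<phi> "ball p r"] f_inv_into_f[of y ?\<phi> "ball p r"]
    by (auto simp: V_def g_def simp del: mem_ball)
  have g_left: "g (?\<phi> q) = q" if "q \<in> ball p r" for q
    unfolding g_def using r(3) that by (rule inv_into_f_f)
  show ?thesis
  proof (rule that[of e "\<lambda>s. g (s, w p)" "z p" "\<lambda>s. 1 / jac z w (g (s, w p))"])
    show "e > 0" "g (z p, w p) = p"
      using e g_left r(1) by auto
    have "g (s, w p) \<in> U \<and> w (g (s, w p)) = w p \<and> 1 / jac z w (g (s, w p)) \<noteq> 0 \<and>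
      ((\<lambda>s. g (s, w p)) has_derivative (\<lambda>h. (h * (1 / jac z w (g (s, w p))) * pdy w (g (s, w p)),
        - (h * (1 / jac z w (g (s, w p))) * pdx w (g (s, w p)))))) (at s)" if s: "s \<in> ball (z p) e" for s
    proof -
    have "((\<lambda>s. (s, w p)) has_derivative (\<lambda>h. (h, 0))) (at s)"
      by (auto intro!: derivative_eq_intros)
    from has_derivative_compose[OF this ift(2)[OF inV[OF s]]]
    have "((\<lambda>s. g (s, w p)) has_derivative (\<lambda>h. (h * (1 / jac z w (g (s, w p))) * pdy w (g (s, w p)),
        - (h * (1 / jac z w (g (s, w p))) * pdx w (g (s, w p)))))) (at s)"
      by simp
    then show ?thesis
      using g[OF inV[OF s]] r(2,4) by auto
    qed
    then show "\<forall>s\<in>ball (z p) e. g (s, w p) \<in> U \<and> w (g (s, w p)) = w p \<and> 1 / jac z w (g (s, w p)) \<noteq> 0 \<and>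
      ((\<lambda>s. g (s, w p)) has_derivative (\<lambda>h. (h * (1 / jac z w (g (s, w p))) * pdy w (g (s, w p)),
        - (h * (1 / jac z w (g (s, w p))) * pdx w (g (s, w p)))))) (at s)"
      by blast
  next
    have "continuous_on U z"
      using zs by (rule smooth_on_imp_continuous_on)
    then have "open (ball p r \<inter> z -` ball (z p) e)"
      using r(2) by (intro continuous_open_preimage) (auto intro: continuous_on_subset)
    moreover have "p \<in> ball p r \<inter> z -` ball (z p) e"
      using r(1) e(1) by auto
    moreover have "w q = w p \<longrightarrow> q \<in> (\<lambda>s. g (s, w p)) ` ball (z p) e"
      if "q \<in> ball p r \<inter> z -` ball (z p) e" for q
      using that g_left[of q] by (auto simp: image_iff intro!: bexI[of _ "z q"])
    ultimately show "eventually (\<lambda>q. w q = w p \<longrightarrow> q \<in> (\<lambda>s. g (s, w p)) ` ball (z p) e) (nhds p)"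
      unfolding eventually_nhds by blast
  qed
qed

lemma level_curve_derivative:
  assumes k: "k differentiable (at (\<gamma> s))"
    and \<gamma>: "(\<gamma> has_derivative (\<lambda>h. (h * \<rho> * pdy w (\<gamma> s), - (h * \<rho> * pdx w (\<gamma> s))))) (at s)"
  shows "((\<lambda>s. k (\<gamma> s)) has_real_derivative - \<rho> * jac w k (\<gamma> s)) (at s)"
proof -
  have "((\<lambda>s. k (\<gamma> s)) has_derivative (\<lambda>h. (h * \<rho> * pdy w (\<gamma> s)) * pdx k (\<gamma> s) +
      - (h * \<rho> * pdx w (\<gamma> s)) * pdy k (\<gamma> s))) (at s)"
    using has_derivative_compose[OF \<gamma> has_derivative_pd[OF k]] by simp
  also have "(\<lambda>h. (h * \<rho> * pdy w (\<gamma> s)) * pdx k (\<gamma> s) + - (h * \<rho> * pdx w (\<gamma> s)) * pdy k (\<gamma> s)) =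
      (*) (- \<rho> * jac w k (\<gamma> s))"
    by (auto simp: jac_def algebra_simps)
  finally show ?thesis
    by (simp only: has_field_derivative_def)
qed

text \<open>Near each of its points \<open>L\<close> lies on a level curve, along which the
  derivative of \<open>k\<close> is a multiple of \<open>jac w k\<close>, hence zero. So
  \<open>k\<close> is locally constant on \<open>L\<close>, and connectedness finishes.\<close>

lemma constant_on_connected_level_set:
  assumes U: "open U" and w: "smooth_on U w" and k: "smooth_on U k"
    and dw: "\<And>p. p \<in> U \<Longrightarrow> pdx w p \<noteq> 0 \<or> pdy w p \<noteq> 0"
    and wk: "\<And>p. p \<in> U \<Longrightarrow> jac w k p = 0"
    and L: "connected L" "L \<subseteq> {p \<in> U. w p = c}" "p \<in> L" "q \<in> L"
  shows "k p = k q"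
  using L(1,3,4)
proof (rule connected_local_const, intro ballI)
  fix a assume "a \<in> L"
  then have a: "a \<in> U" "w a = c" using L by auto
  obtain \<gamma> \<rho> s0 e where \<gamma>: "e > 0" "\<gamma> s0 = a" "\<forall>s\<in>ball s0 e. \<gamma> s \<in> U \<and> w (\<gamma> s) = w a \<and> \<rho> s \<noteq> 0 \<and>
      (\<gamma> has_derivative (\<lambda>h. (h * \<rho> s * pdy w (\<gamma> s), - (h * \<rho> s * pdx w (\<gamma> s))))) (at s)"
    "eventually (\<lambda>q. w q = w a \<longrightarrow> q \<in> \<gamma> ` ball s0 e) (nhds a)"
    by (rule level_curve[OF U w a(1) dw[OF a(1)]])
  have "((\<lambda>s. k (\<gamma> s)) has_real_derivative 0) (at s within ball s0 e)" if "s \<in> ball s0 e" for s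
  proof -
    have "\<gamma> s \<in> U" "(\<gamma> has_derivative (\<lambda>h. (h * \<rho> s * pdy w (\<gamma> s), - (h * \<rho> s * pdx w (\<gamma> s))))) (at s)"
      using \<gamma>(3)[rule_format, OF that] by auto
    then show ?thesis
      using level_curve_derivative[of k \<gamma> s "\<rho> s" w] smooth_on_imp_differentiable[OF k] wk
      by (auto intro: has_field_derivative_at_within)
  qed
  then obtain K where K: "\<And>s. s \<in> ball s0 e \<Longrightarrow> k (\<gamma> s) = K"
    using has_field_derivative_zero_constant[OF convex_ball] by metis
  have "s0 \<in> ball s0 e"
    using \<gamma>(1) by simp
  then have "k a = K"
    using K[of s0] \<gamma>(2) by blast
  then have kb: "k a = k b" if "w b = w a \<longrightarrow> b \<in> \<gamma> ` ball s0 e" "w b = w a" for b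
  proof -
    from that have "b \<in> \<gamma> ` ball s0 e" by (rule mp)
    then obtain s where "b = \<gamma> s" "s \<in> ball s0 e" by (rule imageE)
    then show ?thesis using K \<open>k a = K\<close> by simp
  qed
  have "eventually (\<lambda>b. w b = w a \<longrightarrow> k a = k b) (nhds a)"
    using \<gamma>(4) by (rule eventually_mono) (use kb in blast)
  then show "eventually (\<lambda>b. k a = k b) (at a within L)"
    using L(2) a unfolding eventually_at_filter by (auto elim!: eventually_mono)
qed

text \<open>The derivative of \<open>k\<close> along the curve is \<open>- \<rho> * jac w k\<close>
  with \<open>\<rho>\<close> nonzero. The conclusion holds at all points of \<open>L\<close>, so it
  can be applied a second time, to \<open>jac w k\<close> itself; this gives access to second
  derivatives along the leaf.\<close>

lemma level_curve_test_set:
  assumes U: "open U" and w: "smooth_on U w" and p: "p \<in> U" "pdx w p \<noteq> 0 \<or> pdy w p \<noteq> 0"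
  obtains L where "p \<in> L" "connected L" "L \<subseteq> {q \<in> U. w q = w p}"
    "\<And>k q. smooth_on U k \<Longrightarrow> (\<And>q. q \<in> L \<Longrightarrow> k q = 0) \<Longrightarrow> q \<in> L \<Longrightarrow> jac w k q = 0"
proof -
  obtain \<gamma> \<rho> s0 e where \<gamma>: "e > 0" "\<gamma> s0 = p" "\<forall>s\<in>ball s0 e. \<gamma> s \<in> U \<and> w (\<gamma> s) = w p \<and> \<rho> s \<noteq> 0 \<and>
      (\<gamma> has_derivative (\<lambda>h. (h * \<rho> s * pdy w (\<gamma> s), - (h * \<rho> s * pdx w (\<gamma> s))))) (at s)"
    "eventually (\<lambda>q. w q = w p \<longrightarrow> q \<in> \<gamma> ` ball s0 e) (nhds p)"
    by (rule level_curve[OF U w p])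
  have cont: "continuous_on (ball s0 e) \<gamma>"
    using \<gamma>(3) by (auto intro!: continuous_at_imp_continuous_on intro: has_derivative_continuous)
  show ?thesis
  proof (rule that)
    show "p \<in> \<gamma> ` ball s0 e" using \<gamma>(1,2) by (auto intro: image_eqI[of _ _ s0])
    show "connected (\<gamma> ` ball s0 e)" by (rule connected_continuous_image[OF cont connected_ball])
    show "\<gamma> ` ball s0 e \<subseteq> {q \<in> U. w q = w p}" using \<gamma>(3) by auto
    fix k :: "plane \<Rightarrow> real" and q
    assume k: "smooth_on U k" and 0: "\<And>q. q \<in> \<gamma> ` ball s0 e \<Longrightarrow> k q = 0" and "q \<in> \<gamma> ` ball s0 e"
    then obtain s where s: "s \<in> ball s0 e" "q = \<gamma> s" by auto
    have "((\<lambda>s. k (\<gamma> s)) has_real_derivative - \<rho> s * jac w k (\<gamma> s)) (at s)"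
      using \<gamma>(3)[rule_format, OF s(1)] smooth_on_imp_differentiable[OF k] by (intro level_curve_derivative) auto
    moreover have "((\<lambda>s. k (\<gamma> s)) has_real_derivative 0) (at s)"
      by (rule has_field_derivative_transform_within_open[of "\<lambda>_. 0", OF _ open_ball s(1)])
        (use 0 in auto)
    ultimately show "jac w k q = 0"
      using \<gamma>(3)[rule_format, OF s(1)] s(2) DERIV_unique by fastforce
  qed
qed

section \<open>Solutions of the linear system\<close>

text \<open>Upgrades the derivatives along coordinate lines that \<open>linear_frobenius\<close>
  yields to a total derivative; continuity of the \<open>y\<close>-derivative bridges the
  gap.\<close>

lemma differentiable_partials:
  fixes F :: "plane \<Rightarrow> real"
  assumes T: "open T" "p \<in> T" and cont: "continuous_on T G2"
    and dx: "\<And>x y. (x, y) \<in> T \<Longrightarrow> ((\<lambda>x. F (x, y)) has_real_derivative G1 (x, y)) (at x)"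
    and dy: "\<And>x y. (x, y) \<in> T \<Longrightarrow> ((\<lambda>y. F (x, y)) has_real_derivative G2 (x, y)) (at y)"
  shows "(F has_derivative (\<lambda>v. fst v * G1 p + snd v * G2 p)) (at p)"
proof -
  obtain x y where p: "p = (x, y)" by (cases p)
  obtain X Y where XY: "open X" "x \<in> X" "open Y" "y \<in> Y" "X \<times> Y \<subseteq> T"
    using open_prod_elim[OF T] p by (metis mem_Sigma_iff)
  obtain e where e: "e > 0" "ball y e \<subseteq> Y"
    using XY open_contains_ball by blast
  have "((\<lambda>(x, y). F (x, y)) has_derivative (\<lambda>(tx, ty). G1 (x, y) * tx + blinfun_scaleR_left (G2 (x, y)) ty))
    (at (x, y) within X \<times> ball y e)"
  proof (rule has_derivative_partialsI)
    show "((\<lambda>x. F (x, y)) has_derivative (\<lambda>tx. G1 (x, y) * tx)) (at x within X)"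
      using dx[of x y] XY by (auto simp: has_field_derivative_def intro: has_derivative_at_withinI)
    show "((\<lambda>y. F (x', y)) has_derivative blinfun_apply (blinfun_scaleR_left (G2 (x', y'))))
        (at y' within ball y e)" if "x' \<in> X" "y' \<in> ball y e" for x' y'
    proof -
      have "(x', y') \<in> T"
        using that XY(5) e(2) by blast
      from dy[OF this] show ?thesis
        by (simp add: has_real_derivative_iff_has_vector_derivative has_vector_derivative_def
            has_derivative_at_withinI)
    qed
    have "continuous_on T (\<lambda>q. blinfun_scaleR_left (G2 q))"
      by (intro continuous_intros cont)
    then have "continuous (at (x, y)) (\<lambda>q. blinfun_scaleR_left (G2 q))"
      using T p by (simp add: continuous_on_eq_continuous_at)
    then show "continuous (at (x, y) within X \<times> ball y e) (\<lambda>(x, y). blinfun_scaleR_left (G2 (x, y)))"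
      by (simp add: case_prod_unfold continuous_at_imp_continuous_at_within)
  qed (use e in auto)
  moreover have "at (x, y) within X \<times> ball y e = at (x, y)"
    using XY e by (intro at_within_open) (auto intro: open_Times)
  ultimately show ?thesis
    by (simp add: p case_prod_unfold algebra_simps)
qed

lemmas pd_simps = pd_add pd_diff pd_mult pd_minus pd_cdivide pd_cmult
lemmas differentiable_simps = differentiable_add differentiable_diff differentiable_mult
  differentiable_minus differentiable_cdivide differentiable_const

lemma has_vector_derivative_Pair:
  "(u has_vector_derivative u') (at x within S) \<Longrightarrow> (v has_vector_derivative v') (at x within S) \<Longrightarrow>
    ((\<lambda>x. (u x, v x)) has_vector_derivative (u', v')) (at x within S)"
  unfolding has_vector_derivative_def scaleR_Pair by (rule has_derivative_Pair)

lemma has_vector_derivative_slices: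
  fixes u :: "plane \<Rightarrow> real"
  assumes "u differentiable (at (x, y))"
  shows "((\<lambda>t. u (t, y)) has_vector_derivative pdx u (x, y)) (at x)"
    "((\<lambda>t. u (x, t)) has_vector_derivative pdy u (x, y)) (at y)"
  using has_real_derivative_slices[OF assms]
  by (simp_all add: has_real_derivative_iff_has_vector_derivative)

text \<open>A 3 by 3 matrix is stored as the triple of its rows, so that matrices form a Euclidean
  space, as \<open>linear_frobenius\<close> demands.\<close>

definition mat_vec :: "space3 \<times> space3 \<times> space3 \<Rightarrow> space3 \<Rightarrow> space3" where
  "mat_vec A v = (fst A \<bullet> v, fst (snd A) \<bullet> v, snd (snd A) \<bullet> v)"

lemma bounded_bilinear_mat_vec: "bounded_bilinear mat_vec"
  unfolding bilinear_conv_bounded_bilinear[symmetric] bilinear_def linear_iff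
  by (auto simp: mat_vec_def inner_add_left inner_add_right)

text \<open>Bootstrapping: the derivatives of the three unknowns are combinations of the unknowns
  with smooth coefficients, so order \<open>i\<close> for all three together gives order
  \<open>i + 1\<close>.\<close>

lemma smooth_on_first_order_system:
  fixes U V W :: "plane \<Rightarrow> real"
  assumes T: "open T"
    and dU: "\<And>p. p \<in> T \<Longrightarrow> (U has_derivative (\<lambda>v. fst v * V p + snd v * W p)) (at p)"
    and dV: "\<And>p. p \<in> T \<Longrightarrow> (V has_derivative (\<lambda>v. fst v * (a p * U p + k p * V p) +
      snd v * (r p * U p + s p * V p + t p * W p))) (at p)"
    and dW: "\<And>p. p \<in> T \<Longrightarrow> (W has_derivative (\<lambda>v. fst v * (r p * U p + s p * V p + t p * W p) +
      snd v * (b p * U p + l p * W p))) (at p)"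
    and smooth: "smooth_on T a" "smooth_on T b" "smooth_on T r" "smooth_on T s" "smooth_on T t"
      "smooth_on T k" "smooth_on T l"
  shows "smooth_on T U" "smooth_on T V" "smooth_on T W"
proof -
  have "Ck_on i T U \<and> Ck_on i T V \<and> Ck_on i T W" for i
  proof (induction i)
    case 0
    show ?case
      by (auto intro!: continuous_at_imp_continuous_on has_derivative_continuous[OF dU]
          has_derivative_continuous[OF dV] has_derivative_continuous[OF dW])
  next
    case (Suc i)
    have C: "Ck_on i T a" "Ck_on i T b" "Ck_on i T r" "Ck_on i T s" "Ck_on i T t" "Ck_on i T k" "Ck_on i T l"
      using smooth by (auto simp: smooth_on_def)
    note rules = Ck_on_add[OF T] Ck_on_bilinear[OF bounded_bilinear_mult T] Ck_on_const
    show ?case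
      using Suc C
      by (intro conjI Ck_on_SucI[OF T dU] Ck_on_SucI[OF T dV] Ck_on_SucI[OF T dW] rules) auto
  qed
  then show "smooth_on T U" "smooth_on T V" "smooth_on T W"
    by (auto simp: smooth_on_def)
qed

text \<open>The coefficients of the linear system are forced by \<open>m\<close>, \<open>n\<close> and the normalization of its
  trace to zero; integrability then reduces to Liouville's two conditions.\<close>

definition coeff_xx :: "(plane \<Rightarrow> real) \<Rightarrow> plane \<Rightarrow> real" where
  "coeff_xx m p = 2 * (m p)\<^sup>2 / 9 - pdx m p / 3"

definition coeff_yy :: "(plane \<Rightarrow> real) \<Rightarrow> plane \<Rightarrow> real" where
  "coeff_yy n p = 2 * (n p)\<^sup>2 / 9 - pdy n p / 3"

definition coeff_xy :: "(plane \<Rightarrow> real) \<Rightarrow> (plane \<Rightarrow> real) \<Rightarrow> plane \<Rightarrow> real" where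
  "coeff_xy m n p = (pdy m p + pdx n p) / 3 - m p * n p / 9"

text \<open>The vanishing of Liouville's relative invariants for
  \<open>y'' = m y' - n (y')^2\<close>, the criterion for transforming this equation locally into
  that of straight lines.\<close>

definition liouville :: "(plane \<Rightarrow> real) \<Rightarrow> (plane \<Rightarrow> real) \<Rightarrow> plane \<Rightarrow> bool" where
  "liouville m n p \<longleftrightarrow>
    2 * pdx (pdy m) p + pdx (pdx n) p = m p * (2 * pdy m p + pdx n p) \<and>
    2 * pdy (pdx n) p + pdy (pdy m) p = n p * (2 * pdx n p + pdy m p)"

context
  fixes S :: "plane set" and m n :: "plane \<Rightarrow> real"
  assumes S: "open S" and m: "smooth_on S m" and n: "smooth_on S n"
begin

lemma smooth_on_coeff:
  "smooth_on S (coeff_xx m)" "smooth_on S (coeff_yy n)" "smooth_on S (coeff_xy m n)"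
  unfolding coeff_xx_def[abs_def] coeff_yy_def[abs_def] coeff_xy_def[abs_def]
  using S m n by (intro smooth; simp)+

text \<open>After inserting the coefficients all terms cubic in \<open>m\<close>, \<open>n\<close>
  cancel, as do those with the product of \<open>pdx m\<close> and \<open>n\<close> or of
  \<open>pdy n\<close> and \<open>m\<close>; what remains is one third of each Liouville
  condition.\<close>

lemma coeff_integrability:
  assumes p: "p \<in> S" and L: "liouville m n p"
  shows "pdy (coeff_xx m) p + m p / 3 * coeff_xy m n p = pdx (coeff_xy m n) p - n p / 3 * coeff_xx m p - m p / 3 * coeff_xy m n p"
    "pdx (coeff_yy n) p + n p / 3 * coeff_xy m n p = pdy (coeff_xy m n) p - m p / 3 * coeff_yy n p - n p / 3 * coeff_xy m n p"
proof -
  have diff: "m differentiable (at p)" "n differentiable (at p)" "pdx m differentiable (at p)"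
    "pdy m differentiable (at p)" "pdx n differentiable (at p)" "pdy n differentiable (at p)"
    using m n p by (auto intro: smooth_on_imp_differentiable smooth)
  have comm: "pdy (pdx m) p = pdx (pdy m) p" "pdy (pdx n) p = pdx (pdy n) p"
    using S m n p by (auto intro: pd_commute)
  have "coeff_xx m = (\<lambda>p. 2 / 9 * (m p * m p) - 1 / 3 * pdx m p)"
    "coeff_yy n = (\<lambda>p. 2 / 9 * (n p * n p) - 1 / 3 * pdy n p)"
    "coeff_xy m n = (\<lambda>p. 1 / 3 * (pdy m p + pdx n p) - 1 / 9 * (m p * n p))"
    by (auto simp: coeff_xx_def coeff_yy_def coeff_xy_def power2_eq_square fun_eq_iff)
  then have "pdy (coeff_xx m) p = 4 / 9 * m p * pdy m p - pdx (pdy m) p / 3"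
    "pdx (coeff_yy n) p = 4 / 9 * n p * pdx n p - pdy (pdx n) p / 3"
    "pdx (coeff_xy m n) p = (pdx (pdy m) p + pdx (pdx n) p) / 3 - (pdx m p * n p + m p * pdx n p) / 9"
    "pdy (coeff_xy m n) p = (pdy (pdy m) p + pdy (pdx n) p) / 3 - (pdy m p * n p + m p * pdy n p) / 9"
    using diff by (simp_all add: pd_simps differentiable_simps comm)
  then show "pdy (coeff_xx m) p + m p / 3 * coeff_xy m n p = pdx (coeff_xy m n) p - n p / 3 * coeff_xx m p - m p / 3 * coeff_xy m n p"
    "pdx (coeff_yy n) p + n p / 3 * coeff_xy m n p = pdy (coeff_xy m n) p - m p / 3 * coeff_yy n p - n p / 3 * coeff_xy m n p"
    using L unfolding coeff_xx_def coeff_yy_def coeff_xy_def liouville_def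
    by (auto simp: field_simps power2_eq_square)
qed

text \<open>The second-order system is a first-order one for the vector
  \<open>(U, U_x, U_y)\<close>, with matrices \<open>M\<close> and \<open>N\<close>. Its initial
  value is free, so the solutions form a three-dimensional space: the homogeneous
  coordinates.\<close>

lemma linear_system_solution:
  assumes p0: "p0 \<in> S" and L: "\<And>p. p \<in> S \<Longrightarrow> liouville m n p"
  obtains T U where "open T" "p0 \<in> T" "T \<subseteq> S" "smooth_on T U"
    "U p0 = c0" "pdx U p0 = c1" "pdy U p0 = c2"
    "\<forall>p\<in>T. pdx (pdx U) p = m p / 3 * pdx U p + coeff_xx m p * U p \<and>
      pdx (pdy U) p = - n p / 3 * pdx U p - m p / 3 * pdy U p + coeff_xy m n p * U p \<and>
      pdy (pdy U) p = n p / 3 * pdy U p + coeff_yy n p * U p"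
proof -
  define a b r where "a = coeff_xx m" and "b = coeff_yy n" and "r = coeff_xy m n"
  \<comment> \<open>The traces of \<open>M\<close> and \<open>N\<close> are \<open>k + t\<close> and
    \<open>s + l\<close>. Together with \<open>k - 2 t = m\<close> and \<open>l - 2 s = n\<close>,
    trace zero forces these four values.\<close>
  define k l s t where "k p = 1 / 3 * m p" and "l p = 1 / 3 * n p" and "s p = - 1 / 3 * n p" and "t p = - 1 / 3 * m p" for p
  define M :: "plane \<Rightarrow> space3 \<times> space3 \<times> space3" where "M p = ((0, 1, 0), (a p, k p, 0), (r p, s p, t p))" for p
  define N :: "plane \<Rightarrow> space3 \<times> space3 \<times> space3" where "N p = ((0, 0, 1), (r p, s p, t p), (b p, 0, l p))" for p
  define My :: "plane \<Rightarrow> space3 \<times> space3 \<times> space3" where "My p = ((0, 0, 0), (pdy a p, pdy k p, 0), (pdy r p, pdy s p, pdy t p))" for p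
  define Nx :: "plane \<Rightarrow> space3 \<times> space3 \<times> space3" where "Nx p = ((0, 0, 0), (pdx r p, pdx s p, pdx t p), (pdx b p, 0, pdx l p))" for p
  have sm: "smooth_on S a" "smooth_on S b" "smooth_on S r" "smooth_on S k" "smooth_on S l" "smooth_on S s" "smooth_on S t"
    unfolding a_def b_def r_def k_def[abs_def] l_def[abs_def] s_def[abs_def] t_def[abs_def]
    by (intro smooth_on_coeff smooth S m n)+
  note sms = sm sm[THEN smooth_on_pdx] sm[THEN smooth_on_pdy] smooth_on_const
  have cont: "continuous_on S M" "continuous_on S N" "continuous_on S My" "continuous_on S Nx"
    unfolding M_def[abs_def] N_def[abs_def] My_def[abs_def] Nx_def[abs_def]
    by (intro continuous_on_Pair sms[THEN smooth_on_imp_continuous_on])+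
  have My: "((\<lambda>y. M (x, y)) has_vector_derivative My (x, y)) (at y)"
    and Nx: "((\<lambda>x. N (x, y)) has_vector_derivative Nx (x, y)) (at x)" if "(x, y) \<in> S" for x y
    unfolding M_def N_def My_def Nx_def
    by (intro has_vector_derivative_Pair has_vector_derivative_const
        has_vector_derivative_slices sm[THEN smooth_on_imp_differentiable] that)+
  have compat: "mat_vec (My p) v + mat_vec (M p) (mat_vec (N p) v) = mat_vec (Nx p) v + mat_vec (N p) (mat_vec (M p) v)"
    if p: "p \<in> S" for p v
  proof -
    have diff: "m differentiable (at p)" "n differentiable (at p)"
      using m n p by (auto intro: smooth_on_imp_differentiable)
    have pd: "pdx l p = pdx n p / 3" "pdx s p = - pdx n p / 3" "pdx t p = - pdx m p / 3"
      "pdy k p = pdy m p / 3" "pdy s p = - pdy n p / 3" "pdy t p = - pdy m p / 3"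
      unfolding k_def[abs_def] l_def[abs_def] s_def[abs_def] t_def[abs_def]
      by (simp_all add: pd_simps differentiable_simps diff)
    have 0: "pdy a p + k p * r p = pdx r p + s p * a p + t p * r p"
      "pdx b p + l p * r p = pdy r p + t p * b p + s p * r p"
      using coeff_integrability[OF p L[OF p]]
      by (simp_all add: a_def b_def r_def k_def l_def s_def t_def algebra_simps)
    \<comment> \<open>These equations and those in \<open>2\<close> hold identically: solving them
      for \<open>r\<close>, \<open>a\<close> and \<open>b\<close> is how the formulas for the
      coefficients arise. Liouville's conditions enter through \<open>0\<close> alone.\<close>
    have 1: "pdy k p + k p * s p = pdx s p + r p + s p * k p + t p * s p"
      "pdy t p + s p * t p + r p = pdx l p"
      unfolding pd by (simp_all add: r_def coeff_xy_def k_def s_def t_def field_simps)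
    have 2: "a p + k p * t p = pdx t p + t p * t p" "pdy s p + s p * s p = b p + l p * s p"
      unfolding pd by (simp_all add: a_def b_def coeff_xx_def coeff_yy_def k_def l_def s_def t_def field_simps power2_eq_square)
    obtain v0 v1 v2 where v: "v = (v0, v1, v2)" by (cases v)
    have "(pdy a p * v0 + pdy k p * v1) + (a p * v2 + k p * (r p * v0 + s p * v1 + t p * v2)) -
      ((pdx r p * v0 + pdx s p * v1 + pdx t p * v2) + (r p * v1 + s p * (a p * v0 + k p * v1) + t p * (r p * v0 + s p * v1 + t p * v2)))
      = ((pdy a p + k p * r p) - (pdx r p + s p * a p + t p * r p)) * v0 +
        ((pdy k p + k p * s p) - (pdx s p + r p + s p * k p + t p * s p)) * v1 +
        ((a p + k p * t p) - (pdx t p + t p * t p)) * v2"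
      by (simp add: algebra_simps)
    then have row2: "(pdy a p * v0 + pdy k p * v1) + (a p * v2 + k p * (r p * v0 + s p * v1 + t p * v2)) =
      (pdx r p * v0 + pdx s p * v1 + pdx t p * v2) + (r p * v1 + s p * (a p * v0 + k p * v1) + t p * (r p * v0 + s p * v1 + t p * v2))"
      using 0(1) 1(1) 2(1) by simp
    have "(pdy r p * v0 + pdy s p * v1 + pdy t p * v2) + (r p * v2 + s p * (r p * v0 + s p * v1 + t p * v2) + t p * (b p * v0 + l p * v2)) -
      ((pdx b p * v0 + pdx l p * v2) + (b p * v1 + l p * (r p * v0 + s p * v1 + t p * v2)))
      = - ((pdx b p + l p * r p) - (pdy r p + t p * b p + s p * r p)) * v0 +
        ((pdy s p + s p * s p) - (b p + l p * s p)) * v1 +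
        ((pdy t p + s p * t p + r p) - pdx l p) * v2"
      by (simp add: algebra_simps)
    then have row3: "(pdy r p * v0 + pdy s p * v1 + pdy t p * v2) + (r p * v2 + s p * (r p * v0 + s p * v1 + t p * v2) + t p * (b p * v0 + l p * v2)) =
      (pdx b p * v0 + pdx l p * v2) + (b p * v1 + l p * (r p * v0 + s p * v1 + t p * v2))"
      using 0(2) 1(2) 2(2) by simp
    show ?thesis
      using row2 row3 by (simp add: mat_vec_def M_def N_def My_def Nx_def v add.assoc)
  qed
  obtain T F where T: "open T" "p0 \<in> T" "T \<subseteq> S" and F: "continuous_on T F" "F p0 = (c0, c1, c2)"
    and Fx: "\<forall>x y. (x, y) \<in> T \<longrightarrow> ((\<lambda>x. F (x, y)) has_vector_derivative mat_vec (M (x, y)) (F (x, y))) (at x)"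
    and Fy: "\<forall>x y. (x, y) \<in> T \<longrightarrow> ((\<lambda>y. F (x, y)) has_vector_derivative mat_vec (N (x, y)) (F (x, y))) (at y)"
    by (rule linear_frobenius[OF bounded_bilinear_mat_vec S p0 cont My Nx compat, where v = "(c0, c1, c2)"])
  define U V W where "U p = fst (F p)" and "V p = fst (snd (F p))" and "W p = snd (snd (F p))" for p
  have FUVW: "F p = (U p, V p, W p)" for p
    by (simp add: U_def V_def W_def)
  note proj = bounded_linear_fst bounded_linear_compose[OF bounded_linear_fst bounded_linear_snd]
    bounded_linear_compose[OF bounded_linear_snd bounded_linear_snd]
  have contUVW: "continuous_on T U" "continuous_on T V" "continuous_on T W"
    unfolding U_def[abs_def] V_def[abs_def] W_def[abs_def] using F(1) by (auto intro: continuous_intros)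
  have smT: "continuous_on T a" "continuous_on T b" "continuous_on T r" "continuous_on T k" "continuous_on T l"
    "continuous_on T s" "continuous_on T t"
    using sm[THEN smooth_on_imp_continuous_on] T(3) by (auto intro: continuous_on_subset)
  have x: "((\<lambda>x. U (x, y)) has_real_derivative V (x, y)) (at x)"
    "((\<lambda>x. V (x, y)) has_real_derivative a (x, y) * U (x, y) + k (x, y) * V (x, y)) (at x)"
    "((\<lambda>x. W (x, y)) has_real_derivative r (x, y) * U (x, y) + s (x, y) * V (x, y) + t (x, y) * W (x, y)) (at x)"
    if "(x, y) \<in> T" for x y
    using proj[THEN bounded_linear.has_vector_derivative, OF Fx[rule_format, OF that]]
    by (simp_all add: has_real_derivative_iff_has_vector_derivative mat_vec_def M_def FUVW algebra_simps)
  have y: "((\<lambda>y. U (x, y)) has_real_derivative W (x, y)) (at y)"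
    "((\<lambda>y. V (x, y)) has_real_derivative r (x, y) * U (x, y) + s (x, y) * V (x, y) + t (x, y) * W (x, y)) (at y)"
    "((\<lambda>y. W (x, y)) has_real_derivative b (x, y) * U (x, y) + l (x, y) * W (x, y)) (at y)"
    if "(x, y) \<in> T" for x y
    using proj[THEN bounded_linear.has_vector_derivative, OF Fy[rule_format, OF that]]
    by (simp_all add: has_real_derivative_iff_has_vector_derivative mat_vec_def N_def FUVW algebra_simps)
  have dU: "(U has_derivative (\<lambda>v. fst v * V p + snd v * W p)) (at p)" if "p \<in> T" for p
    by (rule differentiable_partials[OF T(1) that contUVW(3) x(1) y(1)])
  have dV: "(V has_derivative (\<lambda>v. fst v * (a p * U p + k p * V p) +
      snd v * (r p * U p + s p * V p + t p * W p))) (at p)" if "p \<in> T" for p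
    by (rule differentiable_partials[OF T(1) that _ x(2) y(2)]) (intro continuous_intros smT contUVW)
  have dW: "(W has_derivative (\<lambda>v. fst v * (r p * U p + s p * V p + t p * W p) +
      snd v * (b p * U p + l p * W p))) (at p)" if "p \<in> T" for p
    by (rule differentiable_partials[OF T(1) that _ x(3) y(3)]) (intro continuous_intros smT contUVW)
  have smT': "smooth_on T a" "smooth_on T b" "smooth_on T r" "smooth_on T s" "smooth_on T t" "smooth_on T k" "smooth_on T l"
    using sm T(3) by (auto intro: smooth_on_subset)
  note smUVW = smooth_on_first_order_system[OF T(1) dU dV dW smT']
  have pdU: "pdx U p = V p" "pdy U p = W p" if "p \<in> T" for p
    using pd_eqI[OF dU[OF that]] by simp_all
  have pdpdU: "pdx (pdx U) p = pdx V p" "pdx (pdy U) p = pdx W p" "pdy (pdy U) p = pdy W p" if "p \<in> T" for p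
    using smUVW(1) pdU that
    by (auto intro!: pd_cong[OF T(1) that] intro: smooth_on_imp_differentiable smooth)
  show ?thesis
  proof (rule that[OF T smUVW(1)])
    show "U p0 = c0" "pdx U p0 = c1" "pdy U p0 = c2"
      using F(2) T(2) by (simp_all add: pdU U_def V_def W_def)
    have "pdx (pdx U) p = m p / 3 * pdx U p + coeff_xx m p * U p \<and>
      pdx (pdy U) p = - n p / 3 * pdx U p - m p / 3 * pdy U p + coeff_xy m n p * U p \<and>
      pdy (pdy U) p = n p / 3 * pdy U p + coeff_yy n p * U p" if "p \<in> T" for p
      using pd_eqI[OF dV[OF that]] pd_eqI[OF dW[OF that]] pdU[OF that] pdpdU[OF that]
      by (simp add: a_def b_def r_def k_def l_def s_def t_def)
    then show "\<forall>p\<in>T. pdx (pdx U) p = m p / 3 * pdx U p + coeff_xx m p * U p \<and>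
      pdx (pdy U) p = - n p / 3 * pdx U p - m p / 3 * pdy U p + coeff_xy m n p * U p \<and>
      pdy (pdy U) p = n p / 3 * pdy U p + coeff_yy n p * U p"
      by blast
  qed
qed

end

section \<open>Invariants of the web\<close>

text \<open>Straightness of \<open>f\<close> is an equation \<open>f_y m + f_x n = ...\<close>,
  whose solutions are a particular one plus multiples of \<open>(- f_x, f_y)\<close>; the multiple
  is \<open>\<nu>\<close>. The term with \<open>HH f\<close> is shared equally between
  \<open>m\<close> and \<open>n\<close>, so that \<open>\<nu>\<close> becomes exactly
  \<open>mu\<close>.\<close>

definition web_m :: "(plane \<Rightarrow> real) \<Rightarrow> (plane \<Rightarrow> real) \<Rightarrow> plane \<Rightarrow> real" where
  "web_m f \<nu> p = pdx (pdx f) p / pdx f p - HH f p * pdx f p - pdx f p * \<nu> p"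

definition web_n :: "(plane \<Rightarrow> real) \<Rightarrow> (plane \<Rightarrow> real) \<Rightarrow> plane \<Rightarrow> real" where
  "web_n f \<nu> p = pdy (pdy f) p / pdy f p - HH f p * pdy f p + pdy f p * \<nu> p"

text \<open>Where \<open>w_y\<close> is nonzero, this says that the leaves of \<open>w\<close>, as
  graphs over \<open>x\<close>, solve \<open>y'' = m y' - n (y')^2\<close>; without denominators it
  covers vertical leaves too. That the coordinate lines are always solutions reflects the absence of
  terms of degree 0 and 3 in \<open>y'\<close>.\<close>

definition straight :: "(plane \<Rightarrow> real) \<Rightarrow> (plane \<Rightarrow> real) \<Rightarrow> (plane \<Rightarrow> real) \<Rightarrow> plane \<Rightarrow> bool" where
  "straight m n w p \<longleftrightarrow> pdx w p * pdy w p * (pdy w p * m p + pdx w p * n p) =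
    (pdy w p)\<^sup>2 * pdx (pdx w) p - 2 * pdx w p * pdy w p * pdx (pdy w) p + (pdx w p)\<^sup>2 * pdy (pdy w) p"

section \<open>The frame derivatives \<open>D1\<close>, \<open>D2\<close> and their
  commutator\<close>

context
  fixes M :: "plane set" and f :: "plane \<Rightarrow> real"
  assumes M: "open M" and f: "smooth_on M f"
    and fx: "\<And>p. p \<in> M \<Longrightarrow> pdx f p \<noteq> 0" and fy: "\<And>p. p \<in> M \<Longrightarrow> pdy f p \<noteq> 0"
begin

lemma smooth_on_D:
  assumes "smooth_on M u"
  shows "smooth_on M (D1 f u)" "smooth_on M (D2 f u)"
  unfolding D1_def[abs_def] D2_def[abs_def]
  using M f fx fy assms by (intro smooth; simp)+

lemma smooth_on_HH: "smooth_on M (HH f)"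
  unfolding HH_def[abs_def] using M f fx fy by (intro smooth) auto

lemma smooth_on_KK: "smooth_on M (KK f)"
  unfolding KK_def[abs_def] using M by (intro smooth smooth_on_D smooth_on_HH)

lemma smooth_on_web_m: "smooth_on M \<nu> \<Longrightarrow> smooth_on M (web_m f \<nu>)"
  unfolding web_m_def[abs_def] using M f fx smooth_on_HH by (intro smooth) auto

lemma smooth_on_web_n: "smooth_on M \<nu> \<Longrightarrow> smooth_on M (web_n f \<nu>)"
  unfolding web_n_def[abs_def] using M f fy smooth_on_HH by (intro smooth) auto

lemma mixed_HH:
  assumes "p \<in> M"
  shows "pdy (pdx f) p = HH f p * pdx f p * pdy f p" "pdx (pdy f) p = HH f p * pdx f p * pdy f p"
proof -
  show "pdy (pdx f) p = HH f p * pdx f p * pdy f p"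
    using fx[OF assms] fy[OF assms] by (simp add: HH_def)
  then show "pdx (pdy f) p = HH f p * pdx f p * pdy f p"
    using pd_commute[OF M f assms] by simp
qed

lemma pd_D:
  assumes "p \<in> M"
  shows "pdx u p = - pdx f p * D1 f u p" "pdy u p = - pdy f p * D2 f u p"
  using fx[OF assms] fy[OF assms] by (simp_all add: D1_def D2_def)

lemma D_second_order:
  assumes u: "smooth_on M u" and p: "p \<in> M"
  shows "D1 f (D1 f u) p = pdx (pdx u) p / (pdx f p)\<^sup>2 - pdx u p * pdx (pdx f) p / (pdx f p) ^ 3"
    "D1 f (D2 f u) p = pdx (pdy u) p / (pdx f p * pdy f p) - HH f p * pdy u p / pdy f p"
    "D2 f (D1 f u) p = pdx (pdy u) p / (pdx f p * pdy f p) - HH f p * pdx u p / pdx f p"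
    "D2 f (D2 f u) p = pdy (pdy u) p / (pdy f p)\<^sup>2 - pdy u p * pdy (pdy f) p / (pdy f p) ^ 3"
proof -
  have D: "D1 f u = (\<lambda>q. - (pdx u q / pdx f q))" "D2 f u = (\<lambda>q. - (pdy u q / pdy f q))"
    by (auto simp: D1_def D2_def)
  have diff: "pdx u differentiable (at p)" "pdy u differentiable (at p)"
    "pdx f differentiable (at p)" "pdy f differentiable (at p)"
    using u f p by (auto intro: smooth_on_imp_differentiable smooth)
  have diff': "(\<lambda>q. pdx u q / pdx f q) differentiable (at p)" "(\<lambda>q. pdy u q / pdy f q) differentiable (at p)"
    using diff fx[OF p] fy[OF p] by (auto intro: differentiable_divide)
  have pd: "pdx (D1 f u) p = - ((pdx (pdx u) p * pdx f p - pdx u p * pdx (pdx f) p) / (pdx f p)\<^sup>2)"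
    "pdx (D2 f u) p = - ((pdx (pdy u) p * pdy f p - pdy u p * pdx (pdy f) p) / (pdy f p)\<^sup>2)"
    "pdy (D1 f u) p = - ((pdy (pdx u) p * pdx f p - pdx u p * pdy (pdx f) p) / (pdx f p)\<^sup>2)"
    "pdy (D2 f u) p = - ((pdy (pdy u) p * pdy f p - pdy u p * pdy (pdy f) p) / (pdy f p)\<^sup>2)"
    unfolding D using diff diff' fx[OF p] fy[OF p] by (simp_all add: pd_minus pd_divide)
  show "D1 f (D1 f u) p = pdx (pdx u) p / (pdx f p)\<^sup>2 - pdx u p * pdx (pdx f) p / (pdx f p) ^ 3"
    using fx[OF p] by (simp add: D1_def[of f "D1 f u"] pd field_simps power2_eq_square power3_eq_cube)
  show "D2 f (D2 f u) p = pdy (pdy u) p / (pdy f p)\<^sup>2 - pdy u p * pdy (pdy f) p / (pdy f p) ^ 3"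
    using fy[OF p] by (simp add: D2_def[of f "D2 f u"] pd field_simps power2_eq_square power3_eq_cube)
  show "D1 f (D2 f u) p = pdx (pdy u) p / (pdx f p * pdy f p) - HH f p * pdy u p / pdy f p"
    using fx[OF p] fy[OF p]
    by (simp add: D1_def[of f "D2 f u"] pd mixed_HH[OF p] field_simps power2_eq_square)
  show "D2 f (D1 f u) p = pdx (pdy u) p / (pdx f p * pdy f p) - HH f p * pdx u p / pdx f p"
    using fx[OF p] fy[OF p]
    by (simp add: D2_def[of f "D1 f u"] pd mixed_HH[OF p] pd_commute[OF M u p] field_simps power2_eq_square)
qed

text \<open>\<open>HH f\<close> is the structure function of the frame. The formula brings mixed
  derivatives into the order \<open>D1 f (D2 f u)\<close>, the only one occurring in the
  invariants.\<close>

lemma D_commutator: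
  assumes "smooth_on M u" "p \<in> M"
  shows "D2 f (D1 f u) p = D1 f (D2 f u) p - HH f p * (D2 f u p - D1 f u p)"
  using D_second_order[OF assms] by (simp add: D1_def[of f u] D2_def[of f u] algebra_simps)

section \<open>Liouville's conditions and the operators \<open>I1_op\<close>,
  \<open>I2_op\<close>\<close>

context
  fixes \<nu> :: "plane \<Rightarrow> real"
  assumes \<nu>: "smooth_on M \<nu>"
begin

text \<open>From \<open>f_xy = H f_x f_y\<close> one gets \<open>(f_xx / f_x)_y = (H f_y)_x\<close>,
  and likewise with \<open>x\<close> and \<open>y\<close> exchanged. So the third derivatives of
  \<open>f\<close> disappear into first derivatives of \<open>H\<close>, which combine to
  \<open>KK f\<close>.\<close>

lemma pd_web:
  assumes p: "p \<in> M"
  shows "pdy (web_m f \<nu>) p = pdx f p * pdy f p * (- KK f p + D2 f \<nu> p - \<nu> p * HH f p)"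
    "pdx (web_n f \<nu>) p = pdx f p * pdy f p * (KK f p - D1 f \<nu> p + \<nu> p * HH f p)"
proof -
  have sm: "smooth_on M (pdx f)" "smooth_on M (pdy f)" "smooth_on M (pdy (pdx f))" "smooth_on M (pdx (pdy f))"
    "smooth_on M (pdx (pdx f))" "smooth_on M (pdy (pdy f))"
    using f by (auto intro: smooth)
  note diff = sm[THEN smooth_on_imp_differentiable, OF p] smooth_on_imp_differentiable[OF smooth_on_HH p]
    smooth_on_imp_differentiable[OF \<nu> p]
  have diff': "(\<lambda>q. pdx (pdx f) q / pdx f q) differentiable (at p)"
    "(\<lambda>q. pdy (pdy f) q / pdy f q) differentiable (at p)"
    using diff fx[OF p] fy[OF p] by (auto intro: differentiable_divide)
  have "pdy (pdx (pdx f)) p = pdx (pdy (pdx f)) p"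
    by (rule pd_commute[OF M sm(1) p])
  also have "\<dots> = pdx (\<lambda>q. HH f q * pdx f q * pdy f q) p"
    by (rule pd_cong(1)[OF M p mixed_HH(1) diff(3)])
  also have "\<dots> = (pdx (HH f) p * pdx f p + HH f p * pdx (pdx f) p) * pdy f p +
      HH f p * pdx f p * (HH f p * pdx f p * pdy f p)"
    using diff by (simp add: pd_mult differentiable_mult mixed_HH[OF p])
  finally have fxxy: "pdy (pdx (pdx f)) p = (pdx (HH f) p * pdx f p + HH f p * pdx (pdx f) p) * pdy f p +
      HH f p * pdx f p * (HH f p * pdx f p * pdy f p)" .
  have "pdx (pdy (pdy f)) p = pdy (pdx (pdy f)) p"
    by (rule pd_commute[OF M sm(2) p, symmetric])
  also have "\<dots> = pdy (\<lambda>q. HH f q * pdx f q * pdy f q) p"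
    by (rule pd_cong(2)[OF M p mixed_HH(2) diff(4)])
  also have "\<dots> = (pdy (HH f) p * pdx f p + HH f p * (HH f p * pdx f p * pdy f p)) * pdy f p +
      HH f p * pdx f p * pdy (pdy f) p"
    using diff by (simp add: pd_mult differentiable_mult mixed_HH[OF p])
  finally have fyyx: "pdx (pdy (pdy f)) p = (pdy (HH f) p * pdx f p + HH f p * (HH f p * pdx f p * pdy f p)) * pdy f p +
      HH f p * pdx f p * pdy (pdy f) p" .
  have "pdy (\<lambda>q. pdx (pdx f) q / pdx f q) p = pdx (HH f) p * pdy f p + (HH f p)\<^sup>2 * pdx f p * pdy f p"
    "pdx (\<lambda>q. pdy (pdy f) q / pdy f q) p = pdy (HH f) p * pdx f p + (HH f p)\<^sup>2 * pdx f p * pdy f p"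
    using diff fx[OF p] fy[OF p]
    by (simp_all add: pd_divide fxxy fyyx mixed_HH[OF p] field_simps power2_eq_square)
  moreover have "pdy (web_m f \<nu>) p = pdy (\<lambda>q. pdx (pdx f) q / pdx f q) p -
      (pdy (HH f) p * pdx f p + HH f p * (HH f p * pdx f p * pdy f p)) -
      (HH f p * pdx f p * pdy f p * \<nu> p + pdx f p * pdy \<nu> p)"
    "pdx (web_n f \<nu>) p = pdx (\<lambda>q. pdy (pdy f) q / pdy f q) p -
      (pdx (HH f) p * pdy f p + HH f p * (HH f p * pdx f p * pdy f p)) +
      (HH f p * pdx f p * pdy f p * \<nu> p + pdy f p * pdx \<nu> p)"
    unfolding web_m_def[abs_def] web_n_def[abs_def]
    using diff diff' by (simp_all add: pd_simps differentiable_simps mixed_HH[OF p])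
  ultimately show "pdy (web_m f \<nu>) p = pdx f p * pdy f p * (- KK f p + D2 f \<nu> p - \<nu> p * HH f p)"
    "pdx (web_n f \<nu>) p = pdx f p * pdy f p * (KK f p - D1 f \<nu> p + \<nu> p * HH f p)"
    unfolding KK_def pd_D[OF p, of "HH f"] pd_D[OF p, of \<nu>]
    by (simp_all add: algebra_simps power2_eq_square)
qed

text \<open>The second derivatives \<open>f_xx\<close> and \<open>f_yy\<close> enter twice: from
  differentiating the factor \<open>f_x f_y\<close> found in \<open>pd_web\<close>, and from
  \<open>m\<close> and \<open>n\<close> themselves. They cancel, and only frame derivatives of
  \<open>\<nu>\<close>, \<open>H\<close> and \<open>K\<close> survive.\<close>

lemma liouville_web:
  assumes p: "p \<in> M"
  shows "2 * pdx (pdy (web_m f \<nu>)) p + pdx (pdx (web_n f \<nu>)) p -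
      web_m f \<nu> p * (2 * pdy (web_m f \<nu>) p + pdx (web_n f \<nu>) p) = - (pdx f p)\<^sup>2 * pdy f p * I1_op f \<nu> p"
    "2 * pdy (pdx (web_n f \<nu>)) p + pdy (pdy (web_m f \<nu>)) p -
      web_n f \<nu> p * (2 * pdx (web_n f \<nu>) p + pdy (web_m f \<nu>) p) = pdx f p * (pdy f p)\<^sup>2 * I2_op f \<nu> p"
proof -
  define X where "X q = - KK f q + D2 f \<nu> q - \<nu> q * HH f q" for q
  define Y where "Y q = KK f q - D1 f \<nu> q + \<nu> q * HH f q" for q
  have sm: "smooth_on M (pdx f)" "smooth_on M (pdy f)" "smooth_on M (pdx f)" "smooth_on M (KK f)"
    "smooth_on M (D1 f \<nu>)" "smooth_on M (D2 f \<nu>)" "smooth_on M (HH f)" "smooth_on M \<nu>"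
    using f \<nu> by (auto intro: smooth smooth_on_KK smooth_on_HH smooth_on_D)
  then have "smooth_on M X" "smooth_on M Y"
    unfolding X_def[abs_def] Y_def[abs_def] using M by (auto intro: smooth)
  note diff = sm[THEN smooth_on_imp_differentiable, OF p] this[THEN smooth_on_imp_differentiable, OF p]
  have pdX: "pdx X p = - pdx f p * (- D1 f (KK f) p + D1 f (D2 f \<nu>) p - D1 f \<nu> p * HH f p - \<nu> p * D1 f (HH f) p)"
    "pdy X p = - pdy f p * (- D2 f (KK f) p + D2 f (D2 f \<nu>) p - D2 f \<nu> p * HH f p - \<nu> p * D2 f (HH f) p)"
    "pdx Y p = - pdx f p * (D1 f (KK f) p - D1 f (D1 f \<nu>) p + D1 f \<nu> p * HH f p + \<nu> p * D1 f (HH f) p)"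
    "pdy Y p = - pdy f p * (D2 f (KK f) p - (D1 f (D2 f \<nu>) p - HH f p * (D2 f \<nu> p - D1 f \<nu> p))
      + D2 f \<nu> p * HH f p + \<nu> p * D2 f (HH f) p)"
    unfolding X_def[abs_def] Y_def[abs_def] D_commutator[OF \<nu> p, symmetric]
    using diff(1-8) by (simp_all add: pd_simps differentiable_simps pd_D[OF p, of "KK f"] pd_D[OF p, of "HH f"]
        pd_D[OF p, of \<nu>] pd_D[OF p, of "D1 f \<nu>"] pd_D[OF p, of "D2 f \<nu>"] algebra_simps)
  have XY: "\<And>q. q \<in> M \<Longrightarrow> pdy (web_m f \<nu>) q = pdx f q * pdy f q * X q"
    "\<And>q. q \<in> M \<Longrightarrow> pdx (web_n f \<nu>) q = pdx f q * pdy f q * Y q"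
    by (simp_all add: pd_web X_def Y_def)
  have diff': "pdy (web_m f \<nu>) differentiable (at p)" "pdx (web_n f \<nu>) differentiable (at p)"
    using p \<nu> by (auto intro!: smooth_on_imp_differentiable smooth smooth_on_web_m smooth_on_web_n)
  have "pdx (pdy (web_m f \<nu>)) p = pdx (\<lambda>q. pdx f q * pdy f q * X q) p"
    "pdy (pdy (web_m f \<nu>)) p = pdy (\<lambda>q. pdx f q * pdy f q * X q) p"
    "pdx (pdx (web_n f \<nu>)) p = pdx (\<lambda>q. pdx f q * pdy f q * Y q) p"
    "pdy (pdx (web_n f \<nu>)) p = pdy (\<lambda>q. pdx f q * pdy f q * Y q) p"
    by (rule pd_cong[OF M p XY(1) diff'(1)] pd_cong[OF M p XY(2) diff'(2)]; assumption)+
  then have pd2: "pdx (pdy (web_m f \<nu>)) p = (pdx (pdx f) p + HH f p * (pdx f p)\<^sup>2) * pdy f p * X p + pdx f p * pdy f p * pdx X p"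
    "pdy (pdy (web_m f \<nu>)) p = (pdy (pdy f) p + HH f p * (pdy f p)\<^sup>2) * pdx f p * X p + pdx f p * pdy f p * pdy X p"
    "pdx (pdx (web_n f \<nu>)) p = (pdx (pdx f) p + HH f p * (pdx f p)\<^sup>2) * pdy f p * Y p + pdx f p * pdy f p * pdx Y p"
    "pdy (pdx (web_n f \<nu>)) p = (pdy (pdy f) p + HH f p * (pdy f p)\<^sup>2) * pdx f p * Y p + pdx f p * pdy f p * pdy Y p"
    using diff by (simp_all add: pd_simps differentiable_simps mixed_HH[OF p] algebra_simps power2_eq_square)
  have m: "web_m f \<nu> p * pdx f p = pdx (pdx f) p - (HH f p + \<nu> p) * (pdx f p)\<^sup>2"
    and n: "web_n f \<nu> p * pdy f p = pdy (pdy f) p - (HH f p - \<nu> p) * (pdy f p)\<^sup>2"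
    using fx[OF p] fy[OF p] by (simp_all add: web_m_def web_n_def field_simps power2_eq_square)
  \<comment> \<open>By definition \<open>KK f\<close> is a combination of the two frame derivatives
    of \<open>HH f\<close>; one of the three is eliminated before the polynomial comparison.\<close>
  have K: "D2 f (HH f) p = D1 f (HH f) p - KK f p" by (simp add: KK_def)
  have "web_m f \<nu> p * (2 * pdy (web_m f \<nu>) p + pdx (web_n f \<nu>) p) =
      (web_m f \<nu> p * pdx f p) * pdy f p * (2 * X p + Y p)"
    "web_n f \<nu> p * (2 * pdx (web_n f \<nu>) p + pdy (web_m f \<nu>) p) =
      (web_n f \<nu> p * pdy f p) * pdx f p * (2 * Y p + X p)"
    using p by (simp_all add: XY algebra_simps)
  then show "2 * pdx (pdy (web_m f \<nu>)) p + pdx (pdx (web_n f \<nu>)) p -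
      web_m f \<nu> p * (2 * pdy (web_m f \<nu>) p + pdx (web_n f \<nu>) p) = - (pdx f p)\<^sup>2 * pdy f p * I1_op f \<nu> p"
    "2 * pdy (pdx (web_n f \<nu>)) p + pdy (pdy (web_m f \<nu>)) p -
      web_n f \<nu> p * (2 * pdx (web_n f \<nu>) p + pdy (web_m f \<nu>) p) = pdx f p * (pdy f p)\<^sup>2 * I2_op f \<nu> p"
    unfolding m n pd2 pdX I1_op_def I2_op_def X_def Y_def K
    by (simp_all add: algebra_simps power2_eq_square)
qed

lemma liouville_web_iff:
  assumes p: "p \<in> M"
  shows "liouville (web_m f \<nu>) (web_n f \<nu>) p \<longleftrightarrow> I1_op f \<nu> p = 0 \<and> I2_op f \<nu> p = 0"
proof -
  have "liouville (web_m f \<nu>) (web_n f \<nu>) p \<longleftrightarrow>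
      - (pdx f p)\<^sup>2 * pdy f p * I1_op f \<nu> p = 0 \<and> pdx f p * (pdy f p)\<^sup>2 * I2_op f \<nu> p = 0"
    unfolding liouville_def liouville_web[OF p, symmetric] by simp
  then show ?thesis
    using fx[OF p] fy[OF p] by simp
qed

end

lemma straight_f: "p \<in> M \<Longrightarrow> straight (web_m f \<nu>) (web_n f \<nu>) f p"
  using fx fy by (simp add: straight_def web_m_def web_n_def mixed_HH field_simps power2_eq_square)

text \<open>The value of \<open>\<nu>\<close> is chosen to fit \<open>m\<close>; the linear equation
  of \<open>f\<close>, in which \<open>n\<close> has a nonzero coefficient, then fixes
  \<open>n\<close>.\<close>

lemma straight_f_imp:
  assumes p: "p \<in> M" and "straight m n f p"
    and \<nu>: "\<nu> p = (pdx (pdx f) p / pdx f p - HH f p * pdx f p - m p) / pdx f p"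
  shows "m p = web_m f \<nu> p" "n p = web_n f \<nu> p"
proof -
  show m: "m p = web_m f \<nu> p"
    using fx[OF p] by (simp add: web_m_def \<nu>)
  have "pdx f p * pdy f p * (pdy f p * m p + pdx f p * n p) =
      pdx f p * pdy f p * (pdy f p * web_m f \<nu> p + pdx f p * web_n f \<nu> p)"
    using assms(2) straight_f[OF p, of \<nu>] by (simp add: straight_def)
  then show "n p = web_n f \<nu> p"
    using fx[OF p] fy[OF p] m by simp
qed

section \<open>Straightness of one further foliation\<close>

context
  fixes w :: "plane \<Rightarrow> real"
  assumes w: "smooth_on M w" and wx: "\<And>p. p \<in> M \<Longrightarrow> pdx w p \<noteq> 0" and wy: "\<And>p. p \<in> M \<Longrightarrow> pdy w p \<noteq> 0"
    and fw: "\<And>p. p \<in> M \<Longrightarrow> jac f w p \<noteq> 0"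
begin

lemma D_nonzero:
  assumes "p \<in> M"
  shows "D1 f w p \<noteq> 0" "D2 f w p \<noteq> 0" "D2 f w p - D1 f w p \<noteq> 0"
  using fx[OF assms] fy[OF assms] wx[OF assms] wy[OF assms] fw[OF assms]
  by (auto simp: D1_def D2_def jac_def field_simps)

lemma smooth_on_basic_inv: "smooth_on M (basic_inv f w)"
  unfolding basic_inv_def[abs_def] using M D_nonzero(2) by (intro smooth smooth_on_D w)

lemma basic_inv_nonzero:
  assumes "p \<in> M"
  shows "basic_inv f w p - (basic_inv f w p)\<^sup>2 \<noteq> 0"
proof -
  have "basic_inv f w p - (basic_inv f w p)\<^sup>2 = D1 f w p * (D2 f w p - D1 f w p) / (D2 f w p)\<^sup>2"
    using D_nonzero[OF assms] by (simp add: basic_inv_def field_simps power2_eq_square)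
  then show ?thesis
    using D_nonzero[OF assms] by simp
qed

lemma smooth_on_mu: "smooth_on M (mu f w)"
  unfolding mu_def[abs_def] using M basic_inv_nonzero
  by (intro smooth smooth_on_D smooth_on_basic_inv)

text \<open>Both orders of the mixed derivative occur in \<open>mu\<close>. Rewriting
  \<open>D2 f (D1 f w)\<close> by the commutator yields the numerator of \<open>I_pair\<close> plus
  \<open>HH f\<close> times its denominator. Hence \<open>I_triple\<close> is a difference of two
  values of \<open>mu\<close>.\<close>

lemma mu_eq_I_pair:
  assumes p: "p \<in> M"
  shows "mu f w p = I_pair f w p + HH f p"
proof -
  have diff: "D1 f w differentiable (at p)" "D2 f w differentiable (at p)"
    using p by (auto intro!: smooth_on_imp_differentiable smooth_on_D w)
  define a1 a2 a11 a12 a21 a22 h where "a1 = D1 f w p" and "a2 = D2 f w p" and "a11 = D1 f (D1 f w) p"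
    and "a12 = D1 f (D2 f w) p" and "a21 = D2 f (D1 f w) p" and "a22 = D2 f (D2 f w) p" and "h = HH f p"
  have a21: "a21 = a12 - h * (a2 - a1)"
    unfolding a1_def a2_def a12_def a21_def h_def by (rule D_commutator[OF w p])
  have nz: "a1 \<noteq> 0" "a2 \<noteq> 0" "a2 - a1 \<noteq> 0"
    using D_nonzero[OF p] by (simp_all add: a1_def a2_def)
  have "D1 f (basic_inv f w) p = (a11 * a2 - a1 * a12) / a2\<^sup>2"
    "D2 f (basic_inv f w) p = (a21 * a2 - a1 * a22) / a2\<^sup>2"
    unfolding basic_inv_def[abs_def] D1_def[of f "\<lambda>p. D1 f w p / D2 f w p"] D2_def[of f "\<lambda>p. D1 f w p / D2 f w p"]
      a1_def a2_def a11_def a12_def a21_def a22_def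
      D1_def[of f "D1 f w"] D1_def[of f "D2 f w"] D2_def[of f "D1 f w"] D2_def[of f "D2 f w"]
    using diff D_nonzero(2)[OF p] by (simp_all add: pd_divide divide_simps)
  moreover have "basic_inv f w p = a1 / a2"
    by (simp add: basic_inv_def a1_def a2_def)
  ultimately have "mu f w p = ((a11 * a2 - a1 * a12) / a2\<^sup>2 - a1 / a2 * (((a12 - h * (a2 - a1)) * a2 - a1 * a22) / a2\<^sup>2))
      / (a1 / a2 - (a1 / a2)\<^sup>2)"
    by (simp add: mu_def a21)
  also have "(a11 * a2 - a1 * a12) / a2\<^sup>2 - a1 / a2 * (((a12 - h * (a2 - a1)) * a2 - a1 * a22) / a2\<^sup>2) =
      (a1\<^sup>2 * a22 - 2 * a1 * a2 * a12 + a2\<^sup>2 * a11 + h * (a1 * a2 * (a2 - a1))) / a2 ^ 3"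
    using nz by (simp add: divide_simps power2_eq_square power3_eq_cube) (simp add: algebra_simps)
  also have "a1 / a2 - (a1 / a2)\<^sup>2 = (a1 * a2 * (a2 - a1)) / a2 ^ 3"
    using nz by (simp add: divide_simps power2_eq_square power3_eq_cube) (simp add: algebra_simps)
  also have "(a1\<^sup>2 * a22 - 2 * a1 * a2 * a12 + a2\<^sup>2 * a11 + h * (a1 * a2 * (a2 - a1))) / a2 ^ 3 / ((a1 * a2 * (a2 - a1)) / a2 ^ 3) =
      (a1\<^sup>2 * a22 - 2 * a1 * a2 * a12 + a2\<^sup>2 * a11) / (a1 * a2 * (a2 - a1)) + h"
  proof -
    have "(x + h * y) / z / (y / z) = x / y + h" if "y \<noteq> 0" "z \<noteq> 0" for x y z :: real
      using that by (simp add: field_simps)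
    then show ?thesis
      using nz by simp
  qed
  finally show ?thesis
    by (simp add: I_pair_def a1_def a2_def a11_def a12_def a22_def h_def)
qed

text \<open>In partial derivatives, the two sides of the equation differ by
  \<open>(\<nu> - H - I_pair f w) * D\<close>, where \<open>D\<close> is a product of
  \<open>w_x\<close>, \<open>w_y\<close> and the Jacobian of \<open>w\<close> and \<open>f\<close>,
  nonzero by transversality to the first three foliations.\<close>

lemma straight_iff:
  assumes p: "p \<in> M"
  shows "straight (web_m f \<nu>) (web_n f \<nu>) w p \<longleftrightarrow> \<nu> p = mu f w p"
proof -
  define P Q P' Q' h u v where "P = pdx f p" and "Q = pdy f p" and "P' = pdx (pdx f) p" and "Q' = pdy (pdy f) p"
    and "h = HH f p" and "u = pdx w p" and "v = pdy w p"
  define J where "J = v\<^sup>2 * pdx (pdx w) p - 2 * u * v * pdx (pdy w) p + u\<^sup>2 * pdy (pdy w) p"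
  define D where "D = u * v * (u * Q - v * P)"
  have nz: "P \<noteq> 0" "Q \<noteq> 0" "u \<noteq> 0" "v \<noteq> 0" "u * Q - v * P \<noteq> 0"
    using fx[OF p] fy[OF p] wx[OF p] wy[OF p] fw[OF p]
    by (auto simp: P_def Q_def u_def v_def jac_def algebra_simps)
  have D0: "D \<noteq> 0" using nz by (simp add: D_def)
  have num: "(D1 f w p)\<^sup>2 * D2 f (D2 f w) p - 2 * D1 f w p * D2 f w p * D1 f (D2 f w) p
        + (D2 f w p)\<^sup>2 * D1 f (D1 f w) p = (J - u\<^sup>2 * v * Q' / Q - u * v\<^sup>2 * P' / P + 2 * h * P * u * v\<^sup>2) / (P\<^sup>2 * Q\<^sup>2)"
    unfolding D_second_order[OF w p] D1_def[of f w] D2_def[of f w] J_def P_def[symmetric] Q_def[symmetric]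
      P'_def[symmetric] Q'_def[symmetric] h_def[symmetric] u_def[symmetric] v_def[symmetric]
    using nz by (simp add: divide_simps power2_eq_square power3_eq_cube) (simp add: algebra_simps)
  have den: "D1 f w p * D2 f w p * (D2 f w p - D1 f w p) = D / (P\<^sup>2 * Q\<^sup>2)"
    unfolding D1_def[of f w] D2_def[of f w] D_def P_def[symmetric] Q_def[symmetric] u_def[symmetric] v_def[symmetric]
    using nz by (simp add: divide_simps power2_eq_square)
  have "I_pair f w p = (J - u\<^sup>2 * v * Q' / Q - u * v\<^sup>2 * P' / P + 2 * h * P * u * v\<^sup>2) / D"
    unfolding I_pair_def num den using nz by simp
  then have I: "I_pair f w p * D = J - u\<^sup>2 * v * Q' / Q - u * v\<^sup>2 * P' / P + 2 * h * P * u * v\<^sup>2"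
    using D0 by simp
  have "straight (web_m f \<nu>) (web_n f \<nu>) w p \<longleftrightarrow>
      u * v * (v * (P' / P - h * P - P * \<nu> p) + u * (Q' / Q - h * Q + Q * \<nu> p)) = J"
    unfolding straight_def web_m_def web_n_def J_def P_def Q_def P'_def Q'_def h_def u_def v_def by blast
  also have "u * v * (v * (P' / P - h * P - P * \<nu> p) + u * (Q' / Q - h * Q + Q * \<nu> p)) =
      J - I_pair f w p * D + (\<nu> p - h) * D"
    unfolding I by (simp add: D_def algebra_simps power2_eq_square)
  also have "J - I_pair f w p * D + (\<nu> p - h) * D = J \<longleftrightarrow> (\<nu> p - h - I_pair f w p) * D = 0"
    by (auto simp: algebra_simps)
  also have "\<dots> \<longleftrightarrow> \<nu> p = mu f w p"
    using D0 by (auto simp: mu_eq_I_pair[OF p] h_def)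
  finally show ?thesis .
qed

end

end

section \<open>Affine coordinates in which leaves are straight\<close>

text \<open>\<open>k \<mapsto> jac w k\<close> is the derivation along the leaves of \<open>w\<close>. The condition says that the plane
  curves traced out by \<open>(u, v)\<close> along the leaves have no curvature.\<close>

definition geodesic :: "(plane \<Rightarrow> real) \<Rightarrow> (plane \<Rightarrow> real) \<Rightarrow> (plane \<Rightarrow> real) \<Rightarrow> plane \<Rightarrow> bool" where
  "geodesic u v w p \<longleftrightarrow> jac w u p * jac w (jac w v) p = jac w v p * jac w (jac w u) p"

definition affine_system ::
    "(plane \<Rightarrow> real) \<Rightarrow> (plane \<Rightarrow> real) \<Rightarrow> (plane \<Rightarrow> real) \<Rightarrow> (plane \<Rightarrow> real) \<Rightarrow> plane set \<Rightarrow> (plane \<Rightarrow> real) \<Rightarrow> bool" where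
  "affine_system a b s t U k \<longleftrightarrow> (\<forall>p\<in>U. pdx (pdx k) p = a p * pdx k p \<and>
     pdy (pdy k) p = b p * pdy k p \<and> pdx (pdy k) p = s p * pdx k p + t p * pdy k p)"

lemma jac_fst: "jac fst k = pdy k"
  by (simp add: jac_def fun_eq_iff)

lemma jac_snd: "jac snd k = (\<lambda>p. - pdx k p)"
  by (simp add: jac_def fun_eq_iff)

lemma jac_eq_0_imp:
  assumes "c * pdx u p + d * pdy u p = 0" "c * pdx v p + d * pdy v p = 0" "jac u v p \<noteq> 0"
  shows "c = 0" "d = 0"
proof -
  have "c * jac u v p = (c * pdx u p + d * pdy u p) * pdy v p - (c * pdx v p + d * pdy v p) * pdy u p"
    "d * jac u v p = (c * pdx v p + d * pdy v p) * pdx u p - (c * pdx u p + d * pdy u p) * pdx v p"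
    by (simp_all add: jac_def algebra_simps)
  then show "c = 0" "d = 0"
    using assms by auto
qed

context
  fixes U :: "plane set" and u v :: "plane \<Rightarrow> real"
  assumes U: "open U" and u: "smooth_on U u" and v: "smooth_on U v"
    and J: "\<And>p. p \<in> U \<Longrightarrow> jac u v p \<noteq> 0"
begin

text \<open>The point is that the coefficients of \<open>pdx k p\<close> and \<open>pdy k p\<close>
  do not involve \<open>k\<close>: the second derivative along a leaf acts on all affine coordinates
  as one and the same vector field.\<close>

lemma jac_jac_affine:
  assumes w: "smooth_on U w" and k: "smooth_on U k" and p: "p \<in> U" and sys: "affine_system a b s t U k"
  shows "jac w (jac w k) p =
    (pdy w p * pdx (pdy w) p - pdx w p * pdy (pdy w) p + (pdy w p)\<^sup>2 * a p - 2 * pdx w p * pdy w p * s p) * pdx k p +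
    (pdx w p * pdx (pdy w) p - pdy w p * pdx (pdx w) p + (pdx w p)\<^sup>2 * b p - 2 * pdx w p * pdy w p * t p) * pdy k p"
proof -
  have diff: "pdx w differentiable (at p)" "pdy w differentiable (at p)"
    "pdx k differentiable (at p)" "pdy k differentiable (at p)"
    using w k p by (auto intro: smooth_on_imp_differentiable smooth)
  have "jac w (jac w k) p = pdx w p * pdy (\<lambda>q. pdx w q * pdy k q - pdy w q * pdx k q) p -
      pdy w p * pdx (\<lambda>q. pdx w q * pdy k q - pdy w q * pdx k q) p"
    by (simp add: jac_def[abs_def])
  then show ?thesis
    using diff sys p unfolding affine_system_def
    by (simp add: pd_simps differentiable_simps pd_commute[OF U w p] pd_commute[OF U k p])
      (simp add: algebra_simps power2_eq_square)
qed

text \<open>Along the leaf, \<open>u\<close> and \<open>v\<close> have first derivatives given by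
  the vector \<open>(- w_y, w_x)\<close> and second ones given by
  \<open>(\<alpha>, \<beta>)\<close>. The determinant in \<open>geodesic\<close> is therefore the
  determinant of these two vectors times the nonzero \<open>jac u v\<close>.\<close>

lemma geodesic_iff_straight:
  assumes w: "smooth_on U w" and p: "p \<in> U"
    and sys: "affine_system a b s t U u" "affine_system a b s t U v"
  shows "geodesic u v w p \<longleftrightarrow> straight (\<lambda>q. a q - 2 * t q) (\<lambda>q. b q - 2 * s q) w p"
proof -
  define \<alpha> \<beta> where "\<alpha> = pdy w p * pdx (pdy w) p - pdx w p * pdy (pdy w) p + (pdy w p)\<^sup>2 * a p - 2 * pdx w p * pdy w p * s p"
    and "\<beta> = pdx w p * pdx (pdy w) p - pdy w p * pdx (pdx w) p + (pdx w p)\<^sup>2 * b p - 2 * pdx w p * pdy w p * t p"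
  have "jac w u p * (\<alpha> * pdx v p + \<beta> * pdy v p) - jac w v p * (\<alpha> * pdx u p + \<beta> * pdy u p) =
      - (pdy w p * \<beta> + pdx w p * \<alpha>) * jac u v p"
    by (simp add: jac_def algebra_simps)
  then have "geodesic u v w p \<longleftrightarrow> pdy w p * \<beta> + pdx w p * \<alpha> = 0"
    using J[OF p] unfolding geodesic_def jac_jac_affine[OF w u p sys(1)] jac_jac_affine[OF w v p sys(2)]
      \<alpha>_def[symmetric] \<beta>_def[symmetric] by (simp add: eq_iff_diff_eq_0[of "jac w u p * _"]) (rule iffI; linarith)
  also have "pdy w p * \<beta> + pdx w p * \<alpha> = pdx w p * pdy w p * (pdy w p * (a p - 2 * t p) + pdx w p * (b p - 2 * s p)) -
      ((pdy w p)\<^sup>2 * pdx (pdx w) p - 2 * pdx w p * pdy w p * pdx (pdy w) p + (pdx w p)\<^sup>2 * pdy (pdy w) p)"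
    by (simp add: \<alpha>_def \<beta>_def algebra_simps power2_eq_square)
  finally show ?thesis
    unfolding straight_def by simp
qed

text \<open>Since the gradients of \<open>u\<close> and \<open>v\<close> are independent, Cramer's
  rule expresses second derivatives by first ones. Straightness of the coordinate lines removes the
  \<open>pdy k\<close> term from \<open>k_xx\<close> and the \<open>pdx k\<close> term from
  \<open>k_yy\<close>.\<close>

lemma affine_system_exists:
  assumes "\<And>p. p \<in> U \<Longrightarrow> geodesic u v fst p" "\<And>p. p \<in> U \<Longrightarrow> geodesic u v snd p"
  obtains a b s t where "smooth_on U a" "smooth_on U b" "smooth_on U s" "smooth_on U t"
    "affine_system a b s t U u" "affine_system a b s t U v"
proof -
  define a where "a p = (pdx (pdx u) p * pdy v p - pdy u p * pdx (pdx v) p) / jac u v p" for p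
  define b where "b p = (pdx u p * pdy (pdy v) p - pdy (pdy u) p * pdx v p) / jac u v p" for p
  define s where "s p = (pdx (pdy u) p * pdy v p - pdy u p * pdx (pdy v) p) / jac u v p" for p
  define t where "t p = (pdx u p * pdx (pdy v) p - pdx (pdy u) p * pdx v p) / jac u v p" for p
  have "smooth_on U a" "smooth_on U b" "smooth_on U s" "smooth_on U t"
    unfolding a_def[abs_def] b_def[abs_def] s_def[abs_def] t_def[abs_def]
    using U u v J by (intro smooth; simp)+
  moreover have "pdx (pdx k) p = a p * pdx k p \<and> pdy (pdy k) p = b p * pdy k p \<and>
      pdx (pdy k) p = s p * pdx k p + t p * pdy k p" if p: "p \<in> U" and k: "k = u \<or> k = v" for p k
  proof -
    have "pdx (\<lambda>p. - pdx u p) p = - pdx (pdx u) p" "pdx (\<lambda>p. - pdx v p) p = - pdx (pdx v) p"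
      using u v p by (auto intro!: pd_minus smooth_on_imp_differentiable smooth)
    then have x: "pdx u p * pdx (pdx v) p = pdx v p * pdx (pdx u) p"
      and y: "pdy u p * pdy (pdy v) p = pdy v p * pdy (pdy u) p"
      using assms[OF p] by (simp_all add: geodesic_def jac_fst jac_snd)
    have ab: "a p * jac u v p = pdx (pdx u) p * pdy v p - pdy u p * pdx (pdx v) p"
      "b p * jac u v p = pdx u p * pdy (pdy v) p - pdy (pdy u) p * pdx v p"
      using J[OF p] by (simp_all add: a_def b_def)
    have e: "(c * k1 - k2) * j = k1 * (c * j) - k2 * j" for c k1 k2 j :: real
      by (simp add: algebra_simps)
    have "(a p * pdx u p - pdx (pdx u) p) * jac u v p = 0" "(a p * pdx v p - pdx (pdx v) p) * jac u v p = 0"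
      "(b p * pdy u p - pdy (pdy u) p) * jac u v p = 0" "(b p * pdy v p - pdy (pdy v) p) * jac u v p = 0"
      unfolding e ab unfolding jac_def using x y by algebra+
    then have 1: "pdx (pdx k) p = a p * pdx k p" "pdy (pdy k) p = b p * pdy k p"
      using J[OF p] k by auto
    have "(s p * pdx k p + t p * pdy k p) * jac u v p = pdx (pdy k) p * jac u v p"
    proof -
      have "(s p * pdx k p + t p * pdy k p) * jac u v p = (s p * jac u v p) * pdx k p + (t p * jac u v p) * pdy k p"
        by (simp add: algebra_simps)
      also have "\<dots> = pdx (pdy k) p * jac u v p"
        using J[OF p] k by (auto simp: s_def t_def) (auto simp: jac_def algebra_simps)
      finally show ?thesis .
    qed
    then show ?thesis
      using 1 J[OF p] by simp
  qed
  ultimately show ?thesis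
    by (intro that[of a b s t]) (auto simp: affine_system_def)
qed

text \<open>Computing \<open>k_xxy\<close> and \<open>k_xyy\<close> in two ways gives linear
  relations between \<open>k_x\<close> and \<open>k_y\<close>. They hold for \<open>u\<close> and
  for \<open>v\<close>, whose gradients are independent, so every coefficient vanishes.\<close>

lemma affine_system_compatibility:
  assumes sm: "smooth_on U a" "smooth_on U b" "smooth_on U s" "smooth_on U t"
    and sys: "affine_system a b s t U u" "affine_system a b s t U v" and p: "p \<in> U"
  shows "pdy a p = pdx s p + t p * s p" "pdx t p = a p * t p - t p * t p"
    "pdx b p = pdy t p + s p * t p" "pdy s p = b p * s p - s p * s p"
proof -
  have eq: "(pdy a p - pdx s p - t p * s p) * pdx k p + (a p * t p - pdx t p - t p * t p) * pdy k p = 0"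
    "(b p * s p - pdy s p - s p * s p) * pdx k p + (pdx b p - pdy t p - s p * t p) * pdy k p = 0"
    if k: "smooth_on U k" and sys: "affine_system a b s t U k" for k
  proof -
    have "smooth_on U (pdx k)" "smooth_on U (pdy k)" "smooth_on U (pdx (pdx k))" "smooth_on U (pdy (pdy k))"
      "smooth_on U (pdx (pdy k))"
      using k by (auto intro: smooth)
    note diff = sm[THEN smooth_on_imp_differentiable, OF p] this[THEN smooth_on_imp_differentiable, OF p]
    have k2: "\<And>q. q \<in> U \<Longrightarrow> pdx (pdx k) q = a q * pdx k q" "\<And>q. q \<in> U \<Longrightarrow> pdy (pdy k) q = b q * pdy k q"
      "\<And>q. q \<in> U \<Longrightarrow> pdx (pdy k) q = s q * pdx k q + t q * pdy k q"
      using sys by (auto simp: affine_system_def)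
    have kyx: "pdy (pdx k) q = pdx (pdy k) q" if "q \<in> U" for q
      by (rule pd_commute[OF U k that])
    have "pdy (pdx (pdx k)) p = pdy (\<lambda>q. a q * pdx k q) p"
      by (rule pd_cong(2)[OF U p k2(1) diff(7)])
    moreover have "pdx (pdy (pdx k)) p = pdx (\<lambda>q. s q * pdx k q + t q * pdy k q) p"
    proof -
      have "pdx (pdx (pdy k)) p = pdx (\<lambda>q. s q * pdx k q + t q * pdy k q) p"
        by (rule pd_cong(1)[OF U p k2(3) diff(9)])
      moreover have "pdx (pdx (pdy k)) p = pdx (pdy (pdx k)) p"
        by (rule pd_cong(1)[OF U p kyx[symmetric] diff(9)])
      ultimately show ?thesis by simp
    qed
    moreover have "pdy (pdx (pdx k)) p = pdx (pdy (pdx k)) p"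
      using U k p by (intro pd_commute[of U]) (auto intro: smooth)
    ultimately show "(pdy a p - pdx s p - t p * s p) * pdx k p + (a p * t p - pdx t p - t p * t p) * pdy k p = 0"
      using diff p by (simp add: pd_simps differentiable_simps kyx k2 algebra_simps)
    have "pdx (pdy (pdy k)) p = pdx (\<lambda>q. b q * pdy k q) p"
      by (rule pd_cong(1)[OF U p k2(2) diff(8)])
    moreover have "pdy (pdx (pdy k)) p = pdy (\<lambda>q. s q * pdx k q + t q * pdy k q) p"
      by (rule pd_cong(2)[OF U p k2(3) diff(9)])
    moreover have "pdy (pdx (pdy k)) p = pdx (pdy (pdy k)) p"
      using U k p by (intro pd_commute[of U]) (auto intro: smooth)
    ultimately show "(b p * s p - pdy s p - s p * s p) * pdx k p + (pdx b p - pdy t p - s p * t p) * pdy k p = 0"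
      using diff p by (simp add: pd_simps differentiable_simps kyx k2 algebra_simps)
  qed
  show "pdy a p = pdx s p + t p * s p" "pdx t p = a p * t p - t p * t p"
    "pdx b p = pdy t p + s p * t p" "pdy s p = b p * s p - s p * s p"
    using jac_eq_0_imp[OF eq(1)[OF u sys(1)] eq(1)[OF v sys(2)] J[OF p]]
      jac_eq_0_imp[OF eq(2)[OF u sys(1)] eq(2)[OF v sys(2)] J[OF p]] by simp_all
qed

text \<open>The compatibility relations express \<open>a_y\<close>, \<open>b_x\<close>,
  \<open>t_x\<close>, \<open>s_y\<close> and, differentiated once more, \<open>t_xy\<close> and
  \<open>s_xy\<close>. The undetermined second derivatives \<open>s_xx\<close> and
  \<open>t_yy\<close> cancel in Liouville's combinations.\<close>

lemma affine_system_liouville: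
  assumes sm: "smooth_on U a" "smooth_on U b" "smooth_on U s" "smooth_on U t"
    and sys: "affine_system a b s t U u" "affine_system a b s t U v" and p: "p \<in> U"
  shows "liouville (\<lambda>q. a q - 2 * t q) (\<lambda>q. b q - 2 * s q) p"
proof -
  let ?m = "\<lambda>q. a q - 2 * t q" and ?n = "\<lambda>q. b q - 2 * s q"
  note compat = affine_system_compatibility[OF sm sys]
  have sm': "smooth_on U ?m" "smooth_on U ?n"
    by (intro smooth U sm)+
  have pd: "pdy ?m q = pdx s q + t q * s q - 2 * pdy t q" "pdx ?n q = pdy t q + s q * t q - 2 * pdx s q" if "q \<in> U" for q
    using sm[THEN smooth_on_imp_differentiable, OF that]
    by (simp_all add: pd_simps differentiable_simps compat[OF that])
  have "smooth_on U (pdx s)" "smooth_on U (pdy s)" "smooth_on U (pdx t)" "smooth_on U (pdy t)"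
    "smooth_on U (pdy ?m)" "smooth_on U (pdx ?n)"
    using sm sm' by (auto intro: smooth)
  note diff = sm[THEN smooth_on_imp_differentiable, OF p] this[THEN smooth_on_imp_differentiable, OF p]
  have "pdx (pdy ?m) p = pdx (\<lambda>q. pdx s q + t q * s q - 2 * pdy t q) p"
    "pdy (pdy ?m) p = pdy (\<lambda>q. pdx s q + t q * s q - 2 * pdy t q) p"
    "pdx (pdx ?n) p = pdx (\<lambda>q. pdy t q + s q * t q - 2 * pdx s q) p"
    "pdy (pdx ?n) p = pdy (\<lambda>q. pdy t q + s q * t q - 2 * pdx s q) p"
    by (rule pd_cong[OF U p pd(1) diff(9)] pd_cong[OF U p pd(2) diff(10)]; assumption)+
  then have pd2: "pdx (pdy ?m) p = pdx (pdx s) p + (pdx t p * s p + t p * pdx s p) - 2 * pdx (pdy t) p"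
    "pdy (pdy ?m) p = pdy (pdx s) p + (pdy t p * s p + t p * pdy s p) - 2 * pdy (pdy t) p"
    "pdx (pdx ?n) p = pdx (pdy t) p + (pdx s p * t p + s p * pdx t p) - 2 * pdx (pdx s) p"
    "pdy (pdx ?n) p = pdy (pdy t) p + (pdy s p * t p + s p * pdy t p) - 2 * pdy (pdx s) p"
    using diff by (simp_all add: pd_simps differentiable_simps)
  have "pdx (pdy t) p = pdy (pdx t) p"
    by (rule pd_commute[OF U sm(4) p, symmetric])
  also have "\<dots> = pdy (\<lambda>q. a q * t q - t q * t q) p"
    by (rule pd_cong(2)[OF U p compat(2) diff(7)])
  also have "\<dots> = pdy a p * t p + a p * pdy t p - 2 * t p * pdy t p"
    using diff by (simp add: pd_simps differentiable_simps)
  finally have txy: "pdx (pdy t) p = (pdx s p + t p * s p) * t p + a p * pdy t p - 2 * t p * pdy t p"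
    by (simp add: compat(1)[OF p])
  have "pdy (pdx s) p = pdx (pdy s) p"
    by (rule pd_commute[OF U sm(3) p])
  also have "\<dots> = pdx (\<lambda>q. b q * s q - s q * s q) p"
    by (rule pd_cong(1)[OF U p compat(4) diff(6)])
  also have "\<dots> = pdx b p * s p + b p * pdx s p - 2 * s p * pdx s p"
    using diff by (simp add: pd_simps differentiable_simps)
  finally have sxy: "pdy (pdx s) p = (pdy t p + s p * t p) * s p + b p * pdx s p - 2 * s p * pdx s p"
    by (simp add: compat(3)[OF p])
  show ?thesis
    unfolding liouville_def pd[OF p] pd2 txy sxy compat(2,4)[OF p]
    by (simp add: algebra_simps)
qed

text \<open>Along a leaf, both the slope of the image curve and its intercept are constant.\<close>

lemma geodesic_leaf_affine:
  assumes w: "smooth_on U w" and dw: "\<And>p. p \<in> U \<Longrightarrow> pdx w p \<noteq> 0 \<or> pdy w p \<noteq> 0"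
    and geo: "\<And>p. p \<in> U \<Longrightarrow> geodesic u v w p" and nz: "\<And>p. p \<in> U \<Longrightarrow> jac w u p \<noteq> 0"
    and L: "connected L" "L \<subseteq> {p \<in> U. w p = c}"
  obtains \<kappa> e where "\<And>p. p \<in> L \<Longrightarrow> v p = \<kappa> * u p + e"
proof (cases "L = {}")
  case False
  then obtain q where q: "q \<in> L" by blast
  define \<kappa> e where "\<kappa> p = jac w v p / jac w u p" and "e p = v p - \<kappa> p * u p" for p
  have \<kappa>: "smooth_on U \<kappa>"
    unfolding \<kappa>_def[abs_def] using U u v w nz by (intro smooth)
  then have e: "smooth_on U e"
    unfolding e_def[abs_def] using U u v by (intro smooth)
  \<comment> \<open>The quotient rule has the determinant of \<open>geodesic\<close> as its
    numerator.\<close>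
  have 1: "jac w \<kappa> p = 0" if "p \<in> U" for p
  proof -
    have "jac w u differentiable (at p)" "jac w v differentiable (at p)"
      using U u v w that by (auto intro: smooth_on_imp_differentiable smooth)
    then have "jac w \<kappa> p = (jac w u p * jac w (jac w v) p - jac w v p * jac w (jac w u) p) / (jac w u p)\<^sup>2"
      unfolding \<kappa>_def[abs_def] jac_def[of w "\<lambda>p. jac w v p / jac w u p"]
      by (simp add: pd_divide nz[OF that] jac_def[of w "jac w u"] jac_def[of w "jac w v"] diff_divide_distrib)
        (simp add: algebra_simps diff_divide_distrib add_divide_distrib)
    then show ?thesis
      using geo[OF that] by (simp add: geodesic_def)
  qed
  have 2: "jac w e p = 0" if "p \<in> U" for p
  proof -
    have "jac w e p = jac w v p - \<kappa> p * jac w u p - u p * jac w \<kappa> p"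
      using smooth_on_imp_differentiable[OF \<kappa> that] smooth_on_imp_differentiable[OF u that]
        smooth_on_imp_differentiable[OF v that]
      unfolding e_def[abs_def] jac_def
      by (simp add: pd_simps differentiable_simps) (simp add: algebra_simps)
    then show ?thesis
      using 1[OF that] nz[OF that] by (simp add: \<kappa>_def)
  qed
  have "\<kappa> p = \<kappa> q" "e p = e q" if "p \<in> L" for p
    using constant_on_connected_level_set[OF U w \<kappa> dw 1 L that q]
      constant_on_connected_level_set[OF U w e dw 2 L that q] by simp_all
  then show ?thesis
    by (intro that[of "\<kappa> q" "e q"]) (metis e_def diff_add_cancel add.commute)
qed (auto intro: that)

end

section \<open>Charts of the projective plane\<close>

lemma span_singleton_eq_iff:
  fixes x y :: "'a::real_vector"
  assumes "x \<noteq> 0"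
  shows "span {x} = span {y} \<longleftrightarrow> (\<exists>k. x = k *\<^sub>R y)"
proof
  assume "span {x} = span {y}"
  then have "x \<in> span {y}"
    using span_base by blast
  then show "\<exists>k. x = k *\<^sub>R y"
    by (auto simp: real_vector.span_singleton)
next
  assume "\<exists>k. x = k *\<^sub>R y"
  then obtain k where k: "x = k *\<^sub>R y" "k \<noteq> 0"
    using assms by auto
  then have "y = inverse k *\<^sub>R x" by simp
  then have "x \<in> span {y}" "y \<in> span {x}"
    using k(1) by (metis span_base span_scale singletonI)+
  then show "span {x} = span {y}"
    by (intro equalityI span_minimal subspace_span) auto
qed

definition affine_chart :: "plane \<Rightarrow> space3 set" where
  "affine_chart = (\<lambda>(s, t). span {(1, s, t)})"

lemma affine_chart_in_params: "affine_chart \<in> affine_params"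
  by (simp add: affine_params_def affine_chart_def)

text \<open>One description of the three charts: \<open>e q\<close> is the homogeneous vector of
  \<open>q\<close>, and \<open>A\<close> permutes the coefficients of a linear form so that its
  restriction to the chart reads \<open>a s + b t + c\<close>. It spares later proofs the case
  distinction.\<close>

lemma affine_paramsE:
  assumes "\<psi> \<in> affine_params"
  obtains e :: "plane \<Rightarrow> space3" and A :: "space3 \<Rightarrow> space3" where
    "\<forall>q. \<psi> q = span {e q} \<and> e q \<noteq> 0" "inj \<psi>"
    "\<forall>n q. n \<bullet> e q = fst (A n) * fst q + fst (snd (A n)) * snd q + snd (snd (A n))"
    "\<forall>n. A n = 0 \<longrightarrow> n = 0"
proof -
  from assms consider (1) "\<psi> = (\<lambda>(s, t). span {(1, s, t)})" | (2) "\<psi> = (\<lambda>(s, t). span {(s, 1, t)})"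
    | (3) "\<psi> = (\<lambda>(s, t). span {(s, t, 1)})"
    by (auto simp: affine_params_def)
  then show ?thesis
  proof cases
    case 1
    show ?thesis
      by (rule that[of "\<lambda>q. (1, fst q, snd q)" "\<lambda>n. (fst (snd n), snd (snd n), fst n)"])
        (auto simp: 1 inj_on_def zero_prod_def span_singleton_eq_iff)
  next
    case 2
    show ?thesis
      by (rule that[of "\<lambda>q. (fst q, 1, snd q)" "\<lambda>n. (fst n, snd (snd n), fst (snd n))"])
        (auto simp: 2 inj_on_def zero_prod_def span_singleton_eq_iff)
  next
    case 3
    show ?thesis
      by (rule that[of "\<lambda>q. (fst q, snd q, 1)" "\<lambda>n. n"])
        (auto simp: 3 inj_on_def zero_prod_def span_singleton_eq_iff)
  qed
qed

lemma affine_params_in_proj_plane: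
  assumes "\<psi> \<in> affine_params"
  shows "\<psi> q \<in> proj_plane"
proof -
  obtain e where e: "\<psi> q = span {e q}" "e q \<noteq> 0"
    using affine_paramsE[OF assms] by metis
  have "dim (span {e q}) = 1"
    using e(2) by (simp add: dim_span)
  then show ?thesis
    by (simp add: proj_plane_def e(1) subspace_span)
qed

lemma affine_params_cover:
  assumes "P \<in> proj_plane"
  shows "\<exists>\<psi>\<in>affine_params. P \<in> range \<psi>"
proof -
  have P: "subspace P" "dim P = 1"
    using assms by (auto simp: proj_plane_def)
  obtain B where B: "B \<subseteq> P" "independent B" "P \<subseteq> span B" "card B = dim P"
    using basis_exists[of P] by blast
  then obtain x where x: "B = {x}"
    using P(2) by (metis card_1_singletonE)
  then have "x \<noteq> 0"
    using B(2) dependent_zero by blast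
  have Px: "P = span {x}"
    using B P(1) x by (metis span_minimal subset_antisym)
  obtain x1 x2 x3 where x123: "x = (x1, x2, x3)" by (cases x)
  have x': "span {y} = P" if "x = k *\<^sub>R y" for k y
    unfolding Px using that \<open>x \<noteq> 0\<close> span_singleton_eq_iff by metis
  consider "x1 \<noteq> 0" | "x2 \<noteq> 0" | "x3 \<noteq> 0"
    using \<open>x \<noteq> 0\<close> x123 by (auto simp: zero_prod_def)
  then show ?thesis
  proof cases
    case 1
    have "span {(1, x2 / x1, x3 / x1)} = P"
      by (rule x'[of x1]) (use 1 x123 in simp)
    then have "P \<in> range (\<lambda>(s, t). span {(1, s, t)})"
      by (auto intro!: image_eqI[of _ _ "(x2 / x1, x3 / x1)"])
    then show ?thesis by (auto simp: affine_params_def)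
  next
    case 2
    have "span {(x1 / x2, 1, x3 / x2)} = P"
      by (rule x'[of x2]) (use 2 x123 in simp)
    then have "P \<in> range (\<lambda>(s, t). span {(s, 1, t)})"
      by (auto intro!: image_eqI[of _ _ "(x1 / x2, x3 / x2)"])
    then show ?thesis by (auto simp: affine_params_def)
  next
    case 3
    have "span {(x1 / x3, x2 / x3, 1)} = P"
      by (rule x'[of x3]) (use 3 x123 in simp)
    then have "P \<in> range (\<lambda>(s, t). span {(s, t, 1)})"
      by (auto intro!: image_eqI[of _ _ "(x1 / x3, x2 / x3)"])
    then show ?thesis by (auto simp: affine_params_def)
  qed
qed

lemma mult_eq_1_iff_transition:
  fixes s t s' t' :: real
  shows "s * s' = 1 \<and> t = s * t' \<longleftrightarrow> s \<noteq> 0 \<and> s' = 1 / s \<and> t' = t / s"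
    "s * s' = 1 \<and> t = s * t' \<longleftrightarrow> s' \<noteq> 0 \<and> s = 1 / s' \<and> t = t' / s'"
proof -
  show "s * s' = 1 \<and> t = s * t' \<longleftrightarrow> s \<noteq> 0 \<and> s' = 1 / s \<and> t' = t / s"
    by (cases "s = 0") (auto simp: field_simps)
  have "s' \<noteq> 0 \<and> s = 1 / s'" if "s * s' = 1"
  proof -
    have "s' \<noteq> 0" using that by auto
    then show ?thesis using that by (simp add: nonzero_eq_divide_eq)
  qed
  then show "s * s' = 1 \<and> t = s * t' \<longleftrightarrow> s' \<noteq> 0 \<and> s = 1 / s' \<and> t = t' / s'"
    by auto
qed

text \<open>The change of charts is a relation between parameters that is the graph of a smooth map
  in either direction. \<open>\<tau>\<close> serves preimages and maps out of the projective plane,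
  \<open>\<sigma>\<close> maps into it.\<close>

lemma affine_params_transition:
  assumes "\<psi> \<in> affine_params"
  obtains N \<tau> N' \<sigma> where "open N" "smooth_on N \<tau>" "open N'" "smooth_on N' \<sigma>"
    "\<forall>q q'. \<psi> q = affine_chart q' \<longleftrightarrow> q \<in> N \<and> q' = \<tau> q"
    "\<forall>q q'. \<psi> q = affine_chart q' \<longleftrightarrow> q' \<in> N' \<and> q = \<sigma> q'"
proof -
  have open_fst: "open {q::plane. fst q \<noteq> 0}" and open_snd: "open {q::plane. snd q \<noteq> 0}"
    by (auto intro!: open_Collect_neq continuous_intros)
  from assms consider (1) "\<psi> = affine_chart" | (2) "\<psi> = (\<lambda>(s, t). span {(s, 1, t)})"
    | (3) "\<psi> = (\<lambda>(s, t). span {(s, t, 1)})"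
    by (auto simp: affine_params_def affine_chart_def)
  then show ?thesis
  proof cases
    case 1
    have "inj affine_chart"
      using affine_paramsE[OF affine_chart_in_params] by metis
    then have "\<psi> q = affine_chart q' \<longleftrightarrow> q = q'" for q q'
      unfolding 1 by (auto dest: injD)
    then show ?thesis
      by (intro that[of UNIV "\<lambda>q. q" UNIV "\<lambda>q. q"]) (auto intro: smooth)
  next
    case 2
    have *: "\<psi> q = affine_chart q' \<longleftrightarrow> fst q * fst q' = 1 \<and> snd q = fst q * snd q'" for q q'
      by (cases q; cases q') (auto simp: 2 affine_chart_def zero_prod_def span_singleton_eq_iff)
    have "\<psi> q = affine_chart q' \<longleftrightarrow> fst q \<noteq> 0 \<and> q' = (1 / fst q, snd q / fst q)"
      "\<psi> q = affine_chart q' \<longleftrightarrow> fst q' \<noteq> 0 \<and> q = (1 / fst q', snd q' / fst q')" for q q'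
      unfolding * prod_eq_iff fst_conv snd_conv by (rule mult_eq_1_iff_transition)+
    moreover have "smooth_on {q::plane. fst q \<noteq> 0} (\<lambda>q. (1 / fst q, snd q / fst q))"
      using open_fst by (intro smooth) auto
    ultimately show ?thesis
      using open_fst
      by (intro that[of "{q. fst q \<noteq> 0}" "\<lambda>q. (1 / fst q, snd q / fst q)" "{q. fst q \<noteq> 0}"
            "\<lambda>q. (1 / fst q, snd q / fst q)"]) simp_all
  next
    case 3
    have *: "\<psi> q = affine_chart q' \<longleftrightarrow> fst q * snd q' = 1 \<and> snd q = fst q * fst q'" for q q'
      by (cases q; cases q') (auto simp: 3 affine_chart_def zero_prod_def span_singleton_eq_iff)
    have "\<psi> q = affine_chart q' \<longleftrightarrow> fst q \<noteq> 0 \<and> q' = (snd q / fst q, 1 / fst q)"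
      "\<psi> q = affine_chart q' \<longleftrightarrow> snd q' \<noteq> 0 \<and> q = (1 / snd q', fst q' / snd q')" for q q'
      unfolding * prod_eq_iff fst_conv snd_conv
      using mult_eq_1_iff_transition[of "fst q" "snd q'" "snd q" "fst q'"] by blast+
    moreover have "smooth_on {q::plane. fst q \<noteq> 0} (\<lambda>q. (snd q / fst q, 1 / fst q))"
      "smooth_on {q::plane. snd q \<noteq> 0} (\<lambda>q. (1 / snd q, fst q / snd q))"
      using open_fst open_snd by (intro smooth; auto)+
    ultimately show ?thesis
      using open_fst open_snd
      by (intro that[of "{q. fst q \<noteq> 0}" "\<lambda>q. (snd q / fst q, 1 / fst q)" "{q. snd q \<noteq> 0}"
            "\<lambda>q. (1 / snd q, fst q / snd q)"]) simp_all
  qed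
qed

text \<open>The image lies in the standard chart, where the inverse function theorem gives an open
  image and a smooth inverse; the other charts are reached through the transition maps.\<close>

lemma diffeo_affine_chart:
  assumes U: "open U" and u: "smooth_on U u" and v: "smooth_on U v"
    and inj: "inj_on (\<lambda>q. (u q, v q)) U" and J: "\<And>q. q \<in> U \<Longrightarrow> jac u v q \<noteq> 0"
  shows "diffeo_onto_proj_open U (\<lambda>q. affine_chart (u q, v q))"
proof -
  let ?\<phi> = "\<lambda>q. (u q, v q)" and ?\<Phi> = "\<lambda>q. affine_chart (u q, v q)"
  define V where "V = ?\<phi> ` U"
  define g where "g = inv_into U ?\<phi>"
  have V: "open V" and g: "smooth_on V g"
    using inverse_function_smooth(1,2)[OF U u v inj] J unfolding V_def g_def by blast+
  have gU: "g (?\<phi> q) = q" if "q \<in> U" for q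
    unfolding g_def using inv_into_f_f[OF inj that] by simp
  have inj_chart: "inj affine_chart"
    using affine_paramsE[OF affine_chart_in_params] by metis
  have inj\<Phi>: "inj_on ?\<Phi> U"
    using inj inj_chart by (auto simp: inj_on_def)
  have vimage: "\<psi> -` (?\<Phi> ` U) = N \<inter> \<tau> -` V"
    if "\<And>q q'. \<psi> q = affine_chart q' \<longleftrightarrow> q \<in> N \<and> q' = \<tau> q" for \<psi> :: "plane \<Rightarrow> space3 set" and N \<tau>
  proof -
    have "\<psi> q \<in> ?\<Phi> ` U \<longleftrightarrow> (\<exists>p\<in>U. q \<in> N \<and> ?\<phi> p = \<tau> q)" for q
      using that by (auto simp: image_iff)
    then show ?thesis
      unfolding V_def by (auto simp: image_iff) metis+
  qed
  have open_vimage: "open (N \<inter> \<tau> -` V)" if "open N" "smooth_on N \<tau>" for N and \<tau> :: "plane \<Rightarrow> plane"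
    using that V by (intro continuous_open_preimage smooth_on_imp_continuous_on)
  have "proj_open (?\<Phi> ` U)"
    unfolding proj_open_def
  proof (intro conjI ballI)
    show "?\<Phi> ` U \<subseteq> proj_plane"
      using affine_params_in_proj_plane[OF affine_chart_in_params] by auto
    fix \<psi> assume "\<psi> \<in> affine_params"
    then obtain N \<tau> N' \<sigma> where N: "open N" "smooth_on N \<tau>" and "open N'" "smooth_on N' \<sigma>"
      and \<psi>\<tau>: "\<forall>q q'. \<psi> q = affine_chart q' \<longleftrightarrow> q \<in> N \<and> q' = \<tau> q"
      and       "\<forall>q q'. \<psi> q = affine_chart q' \<longleftrightarrow> q' \<in> N' \<and> q = \<sigma> q'"
      by (rule affine_params_transition)
    then show "open (\<psi> -` (?\<Phi> ` U))"
      unfolding vimage[OF \<psi>\<tau>[rule_format]] by (intro open_vimage N)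
  qed
  moreover have "smooth_into_proj U ?\<Phi>"
    unfolding smooth_into_proj_def
  proof (intro conjI ballI)
    show "?\<Phi> ` U \<subseteq> proj_plane"
      using affine_params_in_proj_plane[OF affine_chart_in_params] by auto
    fix \<psi> assume \<psi>: "\<psi> \<in> affine_params"
    obtain N \<tau> N' \<sigma> where "open N" "smooth_on N \<tau>" and N': "open N'" "smooth_on N' \<sigma>"
      and "\<forall>q q'. \<psi> q = affine_chart q' \<longleftrightarrow> q \<in> N \<and> q' = \<tau> q" and \<psi>\<sigma>: "\<forall>q q'. \<psi> q = affine_chart q' \<longleftrightarrow> q' \<in> N' \<and> q = \<sigma> q'"
      by (rule affine_params_transition[OF \<psi>])
    have "inj \<psi>"
      using affine_paramsE[OF \<psi>] by metis
    have "?\<Phi> p \<in> range \<psi> \<longleftrightarrow> (\<exists>q. \<psi> q = ?\<Phi> p)" for p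
      by (metis rangeE rangeI)
    then have eq: "{p \<in> U. ?\<Phi> p \<in> range \<psi>} = U \<inter> ?\<phi> -` N'"
      using \<psi>\<sigma> by auto
    show op: "open {p \<in> U. ?\<Phi> p \<in> range \<psi>}"
      unfolding eq using u v U N'
      by (intro continuous_open_preimage continuous_on_Pair smooth_on_imp_continuous_on)
    have "smooth_on (U \<inter> ?\<phi> -` N') (\<lambda>p. \<sigma> (?\<phi> p))"
    proof (rule smooth_on_compose[OF _ N'(1) _ N'(2)])
      show "smooth_on (U \<inter> ?\<phi> -` N') ?\<phi>"
        using op eq smooth_on_subset[OF u] smooth_on_subset[OF v] by (intro smooth_on_Pair) auto
    qed (use op eq in auto)
    moreover have "inv \<psi> (?\<Phi> p) = \<sigma> (?\<phi> p)" if "p \<in> U \<inter> ?\<phi> -` N'" for p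
    proof -
      have "\<psi> (\<sigma> (?\<phi> p)) = ?\<Phi> p"
        using that \<psi>\<sigma> by blast
      then show ?thesis
        using \<open>inj \<psi>\<close> by (metis inv_f_f)
    qed
    ultimately show "smooth_on {p \<in> U. ?\<Phi> p \<in> range \<psi>} (\<lambda>p. inv \<psi> (?\<Phi> p))"
      using op unfolding eq by (auto intro: smooth_on_cong)
  qed
  moreover have "smooth_from_proj (?\<Phi> ` U) (inv_into U ?\<Phi>)"
    unfolding smooth_from_proj_def
  proof
    fix \<psi> assume \<psi>: "\<psi> \<in> affine_params"
    then obtain N \<tau> N' \<sigma> where N: "open N" "smooth_on N \<tau>" and "open N'" "smooth_on N' \<sigma>"
      and \<psi>\<tau>: "\<forall>q q'. \<psi> q = affine_chart q' \<longleftrightarrow> q \<in> N \<and> q' = \<tau> q"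
      and "\<forall>q q'. \<psi> q = affine_chart q' \<longleftrightarrow> q' \<in> N' \<and> q = \<sigma> q'"
      by (rule affine_params_transition)
    have op: "open (N \<inter> \<tau> -` V)"
      using open_vimage N by blast
    have "smooth_on (N \<inter> \<tau> -` V) (\<lambda>q. g (\<tau> q))"
      by (rule smooth_on_compose[OF op V smooth_on_subset[OF N(2)] g]) auto
    moreover have "g (\<tau> q) = inv_into U ?\<Phi> (\<psi> q)" if q: "q \<in> N \<inter> \<tau> -` V" for q
    proof -
      obtain p where p: "p \<in> U" "\<tau> q = ?\<phi> p"
        using q by (auto simp: V_def simp del: split_paired_All)
      then have "\<psi> q = ?\<Phi> p"
        using q p(2) by (simp add: \<psi>\<tau>)
      then show ?thesis
        using p gU inv_into_f_f[OF inj\<Phi> p(1)] by simp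
    qed
    ultimately show "smooth_on (\<psi> -` (?\<Phi> ` U)) (\<lambda>q. inv_into U ?\<Phi> (\<psi> q))"
      unfolding vimage[OF \<psi>\<tau>[rule_format]] by (rule smooth_on_cong[OF op, rotated])
  qed
  ultimately show ?thesis
    using inj\<Phi> by (simp add: diffeo_onto_proj_open_def)
qed

lemma proj_line_hyperplane: "n \<noteq> 0 \<Longrightarrow> proj_line {P \<in> proj_plane. P \<subseteq> {x. n \<bullet> x = 0}}"
  unfolding proj_line_def
  by (intro exI[of _ "{x. n \<bullet> x = 0}"]) (simp add: subspace_hyperplane dim_hyperplane)

lemma proj_lineE:
  assumes "proj_line l"
  obtains n where "n \<noteq> 0" "\<And>P x. P \<in> l \<Longrightarrow> x \<in> P \<Longrightarrow> n \<bullet> x = 0"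
proof -
  obtain W where W: "dim W = 2" "l = {P \<in> proj_plane. P \<subseteq> W}"
    using assms by (auto simp: proj_line_def)
  have "dim W < DIM(space3)"
    using W(1) by simp
  then obtain n where "n \<noteq> 0" "span W \<subseteq> {x. n \<bullet> x = 0}"
    using lowdim_subset_hyperplane by blast
  then show ?thesis
    using W(2) span_base[of _ W] by (intro that[of n]) blast+
qed

text \<open>The disjunction is there for lines parallel to an axis. The coefficients of the affine
  equation, constant term first, form the normal vector of a plane through the origin.\<close>

lemma affine_chart_line:
  assumes "(\<forall>p\<in>L. v p = \<kappa> * u p + e) \<or> (\<forall>p\<in>L. u p = \<kappa> * v p + e)"
  shows "\<exists>l. proj_line l \<and> (\<lambda>p. affine_chart (u p, v p)) ` L \<subseteq> l"
proof -
  obtain n :: space3 where n: "n \<noteq> 0" "\<And>p. p \<in> L \<Longrightarrow> n \<bullet> (1, u p, v p) = 0"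
  proof (cases "\<forall>p\<in>L. v p = \<kappa> * u p + e")
    case True
    then show ?thesis
      by (intro that[of "(- e, - \<kappa>, 1)"]) (auto simp: zero_prod_def)
  next
    case False
    then show ?thesis
      using assms by (intro that[of "(- e, 1, - \<kappa>)"]) (auto simp: zero_prod_def)
  qed
  have "affine_chart (u p, v p) \<in> {P \<in> proj_plane. P \<subseteq> {x. n \<bullet> x = 0}}" if "p \<in> L" for p
  proof -
    have "affine_chart (u p, v p) \<subseteq> {x. n \<bullet> x = 0}"
      unfolding affine_chart_def prod.case
      by (rule span_minimal) (use n(2)[OF that] in \<open>auto simp: subspace_hyperplane simp del: inner_Pair\<close>)
    then show ?thesis
      using affine_params_in_proj_plane[OF affine_chart_in_params] by blast
  qed
  then show ?thesis
    using proj_line_hyperplane[OF n(1)] by blast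
qed

section \<open>Linearizations and affine coordinates\<close>

text \<open>By the chain rule the derivative \<open>D\<close> of \<open>\<theta>\<close> inverts
  that of \<open>(u, v)\<close> on the left. If the Jacobian vanished, the derivative of
  \<open>(u, v)\<close> would kill \<open>(u_y, - u_x)\<close> and \<open>(v_y, - v_x)\<close>; both
  would then be zero, hence so would the whole derivative.\<close>

lemma left_invertible_imp_jac_nonzero:
  assumes U: "open U" "q \<in> U" and uv: "u differentiable (at q)" "v differentiable (at q)"
    and \<theta>: "\<theta> differentiable (at (u q, v q))" and inv: "\<And>q. q \<in> U \<Longrightarrow> \<theta> (u q, v q) = q"
  shows "jac u v q \<noteq> 0"
proof
  assume J: "jac u v q = 0"
  define D where "D = frechet_derivative \<theta> (at (u q, v q))"
  have \<theta>D: "(\<theta> has_derivative D) (at (u q, v q))"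
    unfolding D_def using \<theta> by (simp add: frechet_derivative_works[symmetric])
  have "((\<lambda>q. q) has_derivative (\<lambda>h. D (fst h * pdx u q + snd h * pdy u q, fst h * pdx v q + snd h * pdy v q))) (at q)"
    by (rule has_derivative_transform_within_open[OF has_derivative_compose[OF has_derivative_Pair_pd[OF uv] \<theta>D] U inv])
  from has_derivative_unique[OF this has_derivative_ident]
  have D: "D (fst h * pdx u q + snd h * pdy u q, fst h * pdx v q + snd h * pdy v q) = h" for h
    by metis
  have D0: "D (0, 0) = (0, 0)"
    using linear_0[OF has_derivative_linear[OF \<theta>D]] by (simp add: zero_prod_def)
  have "(pdy u q, - pdx u q) = (0, 0)" "(pdy v q, - pdx v q) = (0, 0)"
    using D[of "(pdy u q, - pdx u q)"] D[of "(pdy v q, - pdx v q)"] J D0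
    by (simp_all add: jac_def algebra_simps)
  then show False
    using D[of "(1, 0)"] D0 by simp
qed

text \<open>Along a leaf mapped into a line, some \<open>a u + b v + c\<close> vanishes, and so do
  its first and second derivatives along the leaf. A nonzero pair \<open>(a, b)\<close> annihilating
  both derivative vectors makes their determinant zero. The quantifier over \<open>w\<close> lets
  one pair \<open>u\<close>, \<open>v\<close> serve all foliations.\<close>

lemma linearization_affine_coordinates:
  assumes U: "open U" "p \<in> U" and \<Phi>: "diffeo_onto_proj_open U \<Phi>"
  obtains U' u v where "open U'" "p \<in> U'" "U' \<subseteq> U" "smooth_on U' u" "smooth_on U' v"
    "\<forall>q\<in>U'. jac u v q \<noteq> 0"
    "\<forall>w. smooth_on U w \<longrightarrow> (\<forall>q\<in>U. pdx w q \<noteq> 0 \<or> pdy w q \<noteq> 0) \<longrightarrow>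
      (\<forall>L\<in>leaves U w. \<exists>l. proj_line l \<and> \<Phi> ` L \<subseteq> l) \<longrightarrow> (\<forall>q\<in>U'. geodesic u v w q)"
proof -
  have inj: "inj_on \<Phi> U" and open\<Phi>: "proj_open (\<Phi> ` U)" and into: "smooth_into_proj U \<Phi>"
    and outof: "smooth_from_proj (\<Phi> ` U) (inv_into U \<Phi>)"
    using \<Phi> by (auto simp: diffeo_onto_proj_open_def)
  have "\<Phi> p \<in> proj_plane"
    using into U(2) by (auto simp: smooth_into_proj_def)
  then obtain \<psi> where \<psi>: "\<psi> \<in> affine_params" "\<Phi> p \<in> range \<psi>"
    using affine_params_cover by blast
  obtain e and A :: "space3 \<Rightarrow> space3" where e: "\<forall>q. \<psi> q = span {e q} \<and> e q \<noteq> 0" and inj\<psi>: "inj \<psi>"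
    and A: "\<forall>n q. n \<bullet> e q = fst (A n) * fst q + fst (snd (A n)) * snd q + snd (snd (A n))"
      "\<forall>n. A n = 0 \<longrightarrow> n = 0"
    by (rule affine_paramsE[OF \<psi>(1)])
  define U' where "U' = {q \<in> U. \<Phi> q \<in> range \<psi>}"
  define u v where "u q = fst (inv \<psi> (\<Phi> q))" and "v q = snd (inv \<psi> (\<Phi> q))" for q
  have U': "open U'" "p \<in> U'" "U' \<subseteq> U"
    using into \<psi> U(2) by (auto simp: U'_def smooth_into_proj_def)
  have "smooth_on U' (\<lambda>q. inv \<psi> (\<Phi> q))"
    using into \<psi> by (auto simp: U'_def smooth_into_proj_def)
  then have u: "smooth_on U' u" and v: "smooth_on U' v"
    unfolding u_def[abs_def] v_def[abs_def] using U'(1) by (auto intro: smooth)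
  have \<Phi>eq: "\<Phi> q = \<psi> (u q, v q)" if "q \<in> U'" for q
    using that by (auto simp: U'_def u_def v_def f_inv_into_f)
  have J: "jac u v q \<noteq> 0" if q: "q \<in> U'" for q
  proof (rule left_invertible_imp_jac_nonzero[OF U'(1) q])
    show "u differentiable (at q)" "v differentiable (at q)"
      using u v q by (auto intro: smooth_on_imp_differentiable)
    have "smooth_on (\<psi> -` (\<Phi> ` U)) (\<lambda>q. inv_into U \<Phi> (\<psi> q))"
      using outof \<psi>(1) by (auto simp: smooth_from_proj_def)
    moreover have "(u q, v q) \<in> \<psi> -` (\<Phi> ` U)"
      using \<Phi>eq[OF q] q U'(3) by auto
    ultimately show "(\<lambda>q. inv_into U \<Phi> (\<psi> q)) differentiable (at (u q, v q))"
      by (rule smooth_on_imp_differentiable)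
    show "inv_into U \<Phi> (\<psi> (u q, v q)) = q" if "q \<in> U'" for q
      using \<Phi>eq[OF that] inv_into_f_f[OF inj] that U'(3) by (metis subsetD)
  qed
  have geo: "geodesic u v w q" if w: "smooth_on U w" and dw: "\<forall>q\<in>U. pdx w q \<noteq> 0 \<or> pdy w q \<noteq> 0"
    and lines: "\<forall>L\<in>leaves U w. \<exists>l. proj_line l \<and> \<Phi> ` L \<subseteq> l" and q: "q \<in> U'" for w q
  proof -
    have wU': "smooth_on U' w" and dwq: "pdx w q \<noteq> 0 \<or> pdy w q \<noteq> 0"
      using w dw q U'(3) smooth_on_subset by blast+
    obtain L where L: "q \<in> L" "connected L" "L \<subseteq> {q' \<in> U'. w q' = w q}"
      and test: "\<And>k q. smooth_on U' k \<Longrightarrow> (\<And>q. q \<in> L \<Longrightarrow> k q = 0) \<Longrightarrow> q \<in> L \<Longrightarrow> jac w k q = 0"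
      using level_curve_test_set[OF U'(1) wU' q dwq] by blast
    have sub: "L \<subseteq> {q' \<in> U. w q' = w q}" "{q' \<in> U. w q' = w q} \<noteq> {}"
      using L(1,3) U'(3) by blast+
    \<comment> \<open>Leaves are components in \<open>U\<close>, whereas \<open>L\<close> was built
      inside the smaller chart domain; being connected, it sits in one of them.\<close>
    obtain C where C: "C \<in> components {q' \<in> U. w q' = w q}" "L \<subseteq> C"
      using exists_component_superset[OF sub L(2)] by blast
    then have "C \<in> leaves U w"
      by (auto simp: leaves_def)
    then obtain l where l: "proj_line l" "\<Phi> ` C \<subseteq> l"
      using lines by blast
    obtain m where m: "m \<noteq> 0" "\<And>P x. P \<in> l \<Longrightarrow> x \<in> P \<Longrightarrow> m \<bullet> x = 0"
      using proj_lineE[OF l(1)] by blast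
    obtain a b c where Am: "A m = (a, b, c)"
      by (cases "A m")
    have "A m \<noteq> 0"
      using A(2) m(1) by blast
    then have abc: "(a, b, c) \<noteq> (0, 0, 0)"
      by (simp add: Am zero_prod_def)
    have me: "m \<bullet> e q = a * fst q + b * snd q + c" for q
      using A(1)[rule_format, of m q] by (simp add: Am)
    have k0: "a * u q' + b * v q' + c = 0" if "q' \<in> L" for q'
    proof -
      have "\<psi> (u q', v q') \<in> l"
        using that L(3) C(2) l(2) \<Phi>eq[of q'] by force
      then have "m \<bullet> e (u q', v q') = 0"
        using m(2) e by (metis span_base singletonI)
      then show ?thesis
        by (simp add: me)
    qed
    have sj: "smooth_on U' (jac w u)" "smooth_on U' (jac w v)"
      using U'(1) wU' u v by (auto intro: smooth)
    have jac_comb: "jac w (\<lambda>q. a * h q + b * k q + d) q' = a * jac w h q' + b * jac w k q'"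
      if "smooth_on U' h" "smooth_on U' k" "q' \<in> U'" for h k d q'
      using that(1,2)[THEN smooth_on_imp_differentiable, OF that(3)]
      by (simp add: jac_def pd_simps differentiable_simps algebra_simps)
    \<comment> \<open>The summand 0 gives this the shape required by \<open>jac_comb\<close>, so
      that \<open>test\<close> can be applied once more.\<close>
    have k1: "a * jac w u q' + b * jac w v q' + 0 = 0" if "q' \<in> L" for q'
    proof -
      have "jac w (\<lambda>q. a * u q + b * v q + c) q' = 0"
        by (rule test[OF _ k0 that]) (intro smooth U'(1) u v)
      moreover have "q' \<in> U'"
        using that L(3) by auto
      ultimately show ?thesis
        using jac_comb[OF u v, of q' c] by simp
    qed
    have "jac w (\<lambda>q. a * jac w u q + b * jac w v q + 0) q = 0"
      by (rule test[OF _ k1 L(1)]) (intro smooth U'(1) sj)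
    then have k2: "a * jac w (jac w u) q + b * jac w (jac w v) q = 0"
      using jac_comb[OF sj q, of 0] by simp
    \<comment> \<open>With \<open>a = b = 0\<close> the equation at \<open>q\<close> would give
      \<open>c = 0\<close> as well: the line would be the one at infinity of this chart.\<close>
    have ab: "a \<noteq> 0 \<or> b \<noteq> 0"
      using abc k0[OF L(1)] by auto
    have "a * (jac w u q * jac w (jac w v) q - jac w v q * jac w (jac w u) q) =
        jac w (jac w v) q * (a * jac w u q + b * jac w v q) - jac w v q * (a * jac w (jac w u) q + b * jac w (jac w v) q)"
      "b * (jac w u q * jac w (jac w v) q - jac w v q * jac w (jac w u) q) =
        jac w u q * (a * jac w (jac w u) q + b * jac w (jac w v) q) - jac w (jac w u) q * (a * jac w u q + b * jac w v q)"
      by (simp_all add: algebra_simps)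
    then show "geodesic u v w q"
      using ab k1[OF L(1)] k2 by (auto simp: geodesic_def)
  qed
  show ?thesis
    by (rule that[OF U' u v]) (use J geo in blast)+
qed

lemma geodesic_swap: "geodesic v u w p \<longleftrightarrow> geodesic u v w p"
  by (auto simp: geodesic_def)

lemma jac_swap: "jac v u p = - jac u v p"
  by (simp add: jac_def)

text \<open>At \<open>p\<close> the leaf is not stationary under \<open>(u, v)\<close>, so slopes
  over \<open>u\<close> or over \<open>v\<close> are defined nearby. The neighborhood must work for
  all smaller open \<open>U\<close>, because leaves depend on \<open>U\<close> and it is to be
  intersected with the neighborhoods for the other foliations.\<close>

lemma geodesic_neighborhood:
  assumes T: "open T" "p \<in> T" and u: "smooth_on T u" and v: "smooth_on T v"
    and J: "\<And>q. q \<in> T \<Longrightarrow> jac u v q \<noteq> 0"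
    and w: "smooth_on T w" and dw: "\<And>q. q \<in> T \<Longrightarrow> pdx w q \<noteq> 0 \<or> pdy w q \<noteq> 0"
    and geo: "\<And>q. q \<in> T \<Longrightarrow> geodesic u v w q"
  shows "\<exists>T'. open T' \<and> p \<in> T' \<and> (\<forall>U. open U \<and> U \<subseteq> T \<inter> T' \<longrightarrow>
    (\<forall>L\<in>leaves U w. \<exists>l. proj_line l \<and> (\<lambda>q. affine_chart (u q, v q)) ` L \<subseteq> l))"
proof -
  have "jac w u p \<noteq> 0 \<or> jac w v p \<noteq> 0"
  proof (rule ccontr)
    assume "\<not> ?thesis"
    then have "- pdy w p * pdx u p + pdx w p * pdy u p = 0" "- pdy w p * pdx v p + pdx w p * pdy v p = 0"
      by (simp_all add: jac_def)
    then have "- pdy w p = 0" "pdx w p = 0"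
      by (rule jac_eq_0_imp; use J[OF T(2)] in simp)+
    then show False
      using dw[OF T(2)] by simp
  qed
  then show ?thesis
  proof
    assume nz: "jac w u p \<noteq> 0"
    define T' where "T' = T \<inter> jac w u -` (- {0})"
    have "open T'"
      unfolding T'_def using T w u by (intro continuous_open_preimage smooth_on_imp_continuous_on smooth) auto
    moreover have "\<exists>l. proj_line l \<and> (\<lambda>q. affine_chart (u q, v q)) ` L \<subseteq> l"
      if U: "open U" "U \<subseteq> T \<inter> T'" and L: "L \<in> leaves U w" for U L
    proof -
      obtain c where c: "L \<in> components {q \<in> U. w q = c}"
        using L by (auto simp: leaves_def)
      have sm: "smooth_on U u" "smooth_on U v" "smooth_on U w"
        using u v w U(2) by (auto intro: smooth_on_subset)
      obtain \<kappa> e where "\<And>q. q \<in> L \<Longrightarrow> v q = \<kappa> * u q + e"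
        by (rule geodesic_leaf_affine[OF U(1) sm(1,2) _ sm(3) _ _ _ in_components_connected[OF c]
              in_components_subset[OF c]])
          (use U(2) J dw geo in \<open>auto simp: T'_def\<close>)
      then show ?thesis
        by (intro affine_chart_line) auto
    qed
    ultimately show ?thesis
      using nz T(2) by (intro exI[of _ T']) (auto simp: T'_def)
  next
    assume nz: "jac w v p \<noteq> 0"
    define T' where "T' = T \<inter> jac w v -` (- {0})"
    have "open T'"
      unfolding T'_def using T w v by (intro continuous_open_preimage smooth_on_imp_continuous_on smooth) auto
    moreover have "\<exists>l. proj_line l \<and> (\<lambda>q. affine_chart (u q, v q)) ` L \<subseteq> l"
      if U: "open U" "U \<subseteq> T \<inter> T'" and L: "L \<in> leaves U w" for U L
    proof -
      obtain c where c: "L \<in> components {q \<in> U. w q = c}"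
        using L by (auto simp: leaves_def)
      have sm: "smooth_on U u" "smooth_on U v" "smooth_on U w"
        using u v w U(2) by (auto intro: smooth_on_subset)
      obtain \<kappa> e where "\<And>q. q \<in> L \<Longrightarrow> u q = \<kappa> * v q + e"
        by (rule geodesic_leaf_affine[OF U(1) sm(2,1) _ sm(3) _ _ _ in_components_connected[OF c]
              in_components_subset[OF c]])
          (use U(2) J dw geo in \<open>auto simp: T'_def geodesic_swap jac_swap[of v u]\<close>)
      then show ?thesis
        by (intro affine_chart_line) auto
    qed
    ultimately show ?thesis
      using nz T(2) by (intro exI[of _ T']) (auto simp: T'_def)
  qed
qed

lemma liouville_cong:
  assumes S: "open S" "p \<in> S" and m: "smooth_on S m" and n: "smooth_on S n"
    and eq: "\<And>q. q \<in> S \<Longrightarrow> m q = m' q" "\<And>q. q \<in> S \<Longrightarrow> n q = n' q" and L: "liouville m n p"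
  shows "liouville m' n' p"
proof -
  have 1: "pdy m q = pdy m' q" "pdx n q = pdx n' q" if "q \<in> S" for q
    using smooth_on_imp_differentiable[OF m that] smooth_on_imp_differentiable[OF n that]
    by (intro pd_cong[OF S(1) that]; auto simp: eq)+
  have diff: "pdy m differentiable (at p)" "pdx n differentiable (at p)"
    using m n S(2) by (auto intro!: smooth_on_imp_differentiable smooth)
  have "pdx (pdy m) p = pdx (pdy m') p" "pdy (pdy m) p = pdy (pdy m') p"
    "pdx (pdx n) p = pdx (pdx n') p" "pdy (pdx n) p = pdy (pdx n') p"
    using diff by (intro pd_cong[OF S]; auto simp: 1)+
  then show ?thesis
    using L 1[OF S(2)] eq[OF S(2)] by (simp add: liouville_def)
qed

lemma straight_cong: "m p = m' p \<Longrightarrow> n p = n' p \<Longrightarrow> straight m n w p = straight m' n' w p"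
  by (simp add: straight_def)

lemma straight_coordinates: "straight m n fst p" "straight m n snd p"
proof -
  have "pdx fst = (\<lambda>_. 1)" "pdy fst = (\<lambda>_. 0)" "pdx snd = (\<lambda>_. 0)" "pdy snd = (\<lambda>_. 1)"
    by (simp_all add: fun_eq_iff)
  then show "straight m n fst p" "straight m n snd p"
    by (simp_all add: straight_def)
qed

text \<open>Three solutions whose values and first derivatives at \<open>p\<close> are the standard
  basis vectors serve as homogeneous coordinates; \<open>u = U1 / U0\<close> and
  \<open>v = U2 / U0\<close> then have Jacobian 1 at \<open>p\<close>.\<close>

lemma affine_coordinates_exist:
  assumes S: "open S" "p \<in> S" and m: "smooth_on S m" and n: "smooth_on S n"
    and L: "\<And>q. q \<in> S \<Longrightarrow> liouville m n q"
  obtains T u v where "open T" "p \<in> T" "T \<subseteq> S" "smooth_on T u" "smooth_on T v" "\<forall>q\<in>T. jac u v q \<noteq> 0"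
    "\<forall>w q. smooth_on T w \<longrightarrow> q \<in> T \<longrightarrow> straight m n w q \<longrightarrow> geodesic u v w q"
proof -
  let ?sys = "\<lambda>T U. \<forall>q\<in>T. pdx (pdx U) q = m q / 3 * pdx U q + coeff_xx m q * U q \<and>
      pdx (pdy U) q = - n q / 3 * pdx U q - m q / 3 * pdy U q + coeff_xy m n q * U q \<and>
      pdy (pdy U) q = n q / 3 * pdy U q + coeff_yy n q * U q"
  note solution = linear_system_solution[OF S(1) m n S(2) L]
  obtain T0 U0 where U0: "open T0" "p \<in> T0" "T0 \<subseteq> S" "smooth_on T0 U0" "U0 p = 1" "pdx U0 p = 0" "pdy U0 p = 0" "?sys T0 U0"
    by (rule solution)
  obtain T1 U1 where U1: "open T1" "p \<in> T1" "T1 \<subseteq> S" "smooth_on T1 U1" "U1 p = 0" "pdx U1 p = 1" "pdy U1 p = 0" "?sys T1 U1"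
    by (rule solution)
  obtain T2 U2 where U2: "open T2" "p \<in> T2" "T2 \<subseteq> S" "smooth_on T2 U2" "U2 p = 0" "pdx U2 p = 0" "pdy U2 p = 1" "?sys T2 U2"
    by (rule solution)
  define T3 where "T3 = (T0 \<inter> T1 \<inter> T2) \<inter> U0 -` (- {0})"
  define u v where "u q = U1 q / U0 q" and "v q = U2 q / U0 q" for q
  have smT: "smooth_on (T0 \<inter> T1 \<inter> T2) U0"
    by (rule smooth_on_subset[OF U0(4)]) auto
  have T3: "open T3"
    unfolding T3_def using U0(1) U1(1) U2(1)
    by (intro continuous_open_preimage smooth_on_imp_continuous_on smT open_Int) auto
  have pT3: "p \<in> T3"
    using U0 U1 U2 by (auto simp: T3_def)
  have U0nz: "U0 q \<noteq> 0" if "q \<in> T3" for q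
    using that by (auto simp: T3_def)
  have sm: "smooth_on T3 U0" "smooth_on T3 U1" "smooth_on T3 U2"
    using U0(4) U1(4) U2(4) by (auto intro: smooth_on_subset simp: T3_def)
  have u: "smooth_on T3 u" and v: "smooth_on T3 v"
    unfolding u_def[abs_def] v_def[abs_def] by (intro smooth T3 sm U0nz; assumption)+
  have "smooth_on T3 (jac u v)"
    by (intro smooth T3 u v)
  define T where "T = T3 \<inter> jac u v -` (- {0})"
  have T: "open T"
    unfolding T_def using \<open>smooth_on T3 (jac u v)\<close> T3
    by (intro continuous_open_preimage smooth_on_imp_continuous_on) auto
  have TT3: "T \<subseteq> T3" "T3 \<subseteq> S"
    using U0(3) by (auto simp: T_def T3_def)
  \<comment> \<open>Found by inserting \<open>U = U0 * k\<close> into the system: the terms with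
    \<open>k\<close> itself cancel because \<open>U0\<close> is a solution. The logarithmic
    derivatives of \<open>U0\<close> drop out of \<open>a - 2 t\<close> and \<open>b - 2 s\<close>,
    which are \<open>m\<close> and \<open>n\<close>.\<close>
  define a where "a q = m q / 3 - 2 * (pdx U0 q / U0 q)" for q
  define b where "b q = n q / 3 - 2 * (pdy U0 q / U0 q)" for q
  define s where "s q = - n q / 3 - pdy U0 q / U0 q" for q
  define t where "t q = - m q / 3 - pdx U0 q / U0 q" for q
  have quotient: "affine_system a b s t T3 k"
    if k: "\<And>q. k q = U q / U0 q" and U: "smooth_on T3 U" "?sys T3 U" for k U
  proof -
    have kdef: "k = (\<lambda>q. U q / U0 q)"
      by (simp add: k fun_eq_iff)
    have ksm: "smooth_on T3 k"
      unfolding kdef by (intro smooth T3 sm U U0nz)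
    have Uk: "U q = U0 q * k q" if "q \<in> T3" for q
      using U0nz[OF that] by (simp add: k)
    have 1: "pdx U q = pdx U0 q * k q + U0 q * pdx k q" "pdy U q = pdy U0 q * k q + U0 q * pdy k q"
      if q: "q \<in> T3" for q
      using pd_cong[OF T3 q Uk smooth_on_imp_differentiable[OF U(1) q]]
        smooth_on_imp_differentiable[OF sm(1) q] smooth_on_imp_differentiable[OF ksm q]
      by (simp_all add: pd_mult)
    have "pdx (pdx k) q = a q * pdx k q \<and> pdy (pdy k) q = b q * pdy k q \<and>
        pdx (pdy k) q = s q * pdx k q + t q * pdy k q" if q: "q \<in> T3" for q
    proof -
      have diff: "U0 differentiable (at q)" "k differentiable (at q)" "pdx U0 differentiable (at q)"
        "pdy U0 differentiable (at q)" "pdx k differentiable (at q)" "pdy k differentiable (at q)"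
        "pdx U differentiable (at q)" "pdy U differentiable (at q)"
        using sm(1) ksm U(1) q by (auto intro!: smooth_on_imp_differentiable smooth)
      have "pdx (pdx U) q = pdx (\<lambda>q. pdx U0 q * k q + U0 q * pdx k q) q"
        by (rule pd_cong(1)[OF T3 q 1(1) diff(7)])
      then have xx: "pdx (pdx U) q = pdx (pdx U0) q * k q + 2 * pdx U0 q * pdx k q + U0 q * pdx (pdx k) q"
        using diff by (simp add: pd_simps differentiable_simps)
      have "pdx (pdy U) q = pdx (\<lambda>q. pdy U0 q * k q + U0 q * pdy k q) q"
        by (rule pd_cong(1)[OF T3 q 1(2) diff(8)])
      then have xy: "pdx (pdy U) q = pdx (pdy U0) q * k q + pdy U0 q * pdx k q + pdx U0 q * pdy k q + U0 q * pdx (pdy k) q"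
        using diff by (simp add: pd_simps differentiable_simps)
      have "pdy (pdy U) q = pdy (\<lambda>q. pdy U0 q * k q + U0 q * pdy k q) q"
        by (rule pd_cong(2)[OF T3 q 1(2) diff(8)])
      then have yy: "pdy (pdy U) q = pdy (pdy U0) q * k q + 2 * pdy U0 q * pdy k q + U0 q * pdy (pdy k) q"
        using diff by (simp add: pd_simps differentiable_simps)
      have sys0: "pdx (pdx U0) q = m q / 3 * pdx U0 q + coeff_xx m q * U0 q"
        "pdx (pdy U0) q = - n q / 3 * pdx U0 q - m q / 3 * pdy U0 q + coeff_xy m n q * U0 q"
        "pdy (pdy U0) q = n q / 3 * pdy U0 q + coeff_yy n q * U0 q"
        using U0(8) q by (auto simp: T3_def)
      have sysU: "pdx (pdx U) q = m q / 3 * pdx U q + coeff_xx m q * U q"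
        "pdx (pdy U) q = - n q / 3 * pdx U q - m q / 3 * pdy U q + coeff_xy m n q * U q"
        "pdy (pdy U) q = n q / 3 * pdy U q + coeff_yy n q * U q"
        using U(2) q by blast+
      have nz: "U0 q \<noteq> 0"
        by (rule U0nz[OF q])
      have "U0 q * (pdx (pdx k) q - a q * pdx k q) = 0" "U0 q * (pdy (pdy k) q - b q * pdy k q) = 0"
        "U0 q * (pdx (pdy k) q - (s q * pdx k q + t q * pdy k q)) = 0"
      proof -
        have coeffs: "U0 q * a q = m q / 3 * U0 q - 2 * pdx U0 q" "U0 q * b q = n q / 3 * U0 q - 2 * pdy U0 q"
          "U0 q * s q = - n q / 3 * U0 q - pdy U0 q" "U0 q * t q = - m q / 3 * U0 q - pdx U0 q"
          using nz by (simp_all add: a_def b_def s_def t_def right_diff_distrib)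
        have "U0 q * (pdx (pdx k) q - a q * pdx k q) = U0 q * pdx (pdx k) q - (U0 q * a q) * pdx k q"
          "U0 q * (pdy (pdy k) q - b q * pdy k q) = U0 q * pdy (pdy k) q - (U0 q * b q) * pdy k q"
          "U0 q * (pdx (pdy k) q - (s q * pdx k q + t q * pdy k q)) =
            U0 q * pdx (pdy k) q - ((U0 q * s q) * pdx k q + (U0 q * t q) * pdy k q)"
          by (simp_all add: algebra_simps)
        moreover have "U0 q * pdx (pdx k) q = (m q / 3 * U0 q - 2 * pdx U0 q) * pdx k q"
          using sysU(1) unfolding xx sys0 1[OF q] Uk[OF q] by (simp add: algebra_simps)
        moreover have "U0 q * pdy (pdy k) q = (n q / 3 * U0 q - 2 * pdy U0 q) * pdy k q"
          using sysU(3) unfolding yy sys0 1[OF q] Uk[OF q] by (simp add: algebra_simps)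
        moreover have "U0 q * pdx (pdy k) q = (- n q / 3 * U0 q - pdy U0 q) * pdx k q + (- m q / 3 * U0 q - pdx U0 q) * pdy k q"
          using sysU(2) unfolding xy sys0 1[OF q] Uk[OF q] by (simp add: algebra_simps)
        ultimately show "U0 q * (pdx (pdx k) q - a q * pdx k q) = 0" "U0 q * (pdy (pdy k) q - b q * pdy k q) = 0"
          "U0 q * (pdx (pdy k) q - (s q * pdx k q + t q * pdy k q)) = 0"
          unfolding coeffs by simp_all
      qed
      then show ?thesis
        using nz by simp
    qed
    then show ?thesis
      by (simp add: affine_system_def)
  qed
  have sys: "affine_system a b s t T3 u" "affine_system a b s t T3 v"
  proof -
    have "T3 \<subseteq> T1" "T3 \<subseteq> T2"
      by (auto simp: T3_def)
    then have "?sys T3 U1" "?sys T3 U2"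
      using U1(8) U2(8) by blast+
    then show "affine_system a b s t T3 u" "affine_system a b s t T3 v"
      using quotient[OF u_def sm(2)] quotient[OF v_def sm(3)] by blast+
  qed
  have sysT: "affine_system a b s t T u" "affine_system a b s t T v"
    using sys TT3(1) unfolding affine_system_def by blast+
  have uvT: "smooth_on T u" "smooth_on T v"
    using u v TT3 by (auto intro: smooth_on_subset)
  have JT: "jac u v q \<noteq> 0" if "q \<in> T" for q
    using that by (auto simp: T_def)
  have mn: "a q - 2 * t q = m q" "b q - 2 * s q = n q" for q
    by (simp_all add: a_def b_def s_def t_def)
  show ?thesis
  proof (rule that[OF T _ _ uvT])
    have diff: "U0 differentiable (at p)" "U1 differentiable (at p)" "U2 differentiable (at p)"
      using sm pT3 by (auto intro: smooth_on_imp_differentiable)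
    have "jac u v p = 1"
      unfolding jac_def u_def[abs_def] v_def[abs_def]
      using diff U0(5-7) U1(5-7) U2(5-7) by (simp add: pd_divide)
    then show "p \<in> T"
      using pT3 by (simp add: T_def)
    show "T \<subseteq> S" using TT3 by blast
    show "\<forall>q\<in>T. jac u v q \<noteq> 0" using JT by blast
    show "\<forall>w q. smooth_on T w \<longrightarrow> q \<in> T \<longrightarrow> straight m n w q \<longrightarrow> geodesic u v w q"
    proof (intro allI impI)
      fix w q assume w: "smooth_on T w" and q: "q \<in> T" and "straight m n w q"
      then have "straight (\<lambda>q. a q - 2 * t q) (\<lambda>q. b q - 2 * s q) w q"
        by (simp add: mn)
      then show "geodesic u v w q"
        using geodesic_iff_straight[OF T uvT _ w q sysT] JT by blast
    qed
  qed
qed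

section \<open>The linearizability criterion\<close>

lemma web_jac_nonzero:
  assumes "web M d w" "i \<in> {1..d}" "j \<in> {1..d}" "i \<noteq> j" "p \<in> M"
  shows "jac (w i) (w j) p \<noteq> 0"
proof
  assume J: "jac (w i) (w j) p = 0"
  have diff: "w i differentiable (at p)" "w j differentiable (at p)"
    using assms by (auto simp: web_def intro: smooth_on_imp_differentiable)
  have *: "\<forall>s t :: real. (\<forall>v. s * frechet_derivative (w i) (at p) v + t * frechet_derivative (w j) (at p) v = 0)
      \<longrightarrow> s = 0 \<and> t = 0"
    using assms unfolding web_def by blast
  have ind: "s = 0 \<and> t = 0" if st: "s * pdx (w i) p + t * pdx (w j) p = 0" "s * pdy (w i) p + t * pdy (w j) p = 0" for s t
  proof -
    have e: "s * frechet_derivative (w i) (at p) v + t * frechet_derivative (w j) (at p) v =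
        fst v * (s * pdx (w i) p + t * pdx (w j) p) + snd v * (s * pdy (w i) p + t * pdy (w j) p)" for v
      by (simp add: frechet_derivative_pd[OF diff(1)] frechet_derivative_pd[OF diff(2)] algebra_simps)
    show ?thesis
      by (rule *[THEN spec, THEN spec, THEN mp]) (simp only: e st, simp)
  qed
  have "pdx (w i) p = 0" "pdx (w j) p = 0"
    using ind[of "pdx (w j) p" "- pdx (w i) p"] J by (simp_all add: jac_def algebra_simps)
  moreover have "pdy (w i) p = 0" "pdy (w j) p = 0"
    using ind[of "pdy (w j) p" "- pdy (w i) p"] J by (simp_all add: jac_def algebra_simps)
  ultimately show False
    using ind[of 1 1] by simp
qed

section \<open>Application to the given web\<close>

context
  fixes M :: "plane set" and d :: nat and f :: "plane \<Rightarrow> real" and g :: "nat \<Rightarrow> plane \<Rightarrow> real"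
  assumes d: "d \<ge> 4" and M: "open M" and web: "web M d (web_funs f g)"
begin

lemma web_funs_simps [simp]:
  "web_funs f g 1 = fst" "web_funs f g (Suc 0) = fst" "web_funs f g 2 = snd" "web_funs f g 3 = f"
  "i \<ge> 4 \<Longrightarrow> web_funs f g i = g i"
  by (simp_all add: web_funs_def fun_eq_iff)

lemma web_smooth: "i \<in> {1..d} \<Longrightarrow> smooth_on M (web_funs f g i)"
  using web by (auto simp: web_def)

lemma web_regular:
  assumes "i \<in> {1..d}" "p \<in> M"
  shows "pdx (web_funs f g i) p \<noteq> 0 \<or> pdy (web_funs f g i) p \<noteq> 0"
proof -
  have "(if i = 1 then 2 else 1) \<in> {1..d}" "i \<noteq> (if i = 1 then 2 else 1)"
    using d by auto
  then obtain j where j: "j \<in> {1..d}" "i \<noteq> j"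
    by metis
  show ?thesis
    using web_jac_nonzero[OF web assms(1) j assms(2)] by (auto simp: jac_def)
qed

lemma web_transversal_coordinates:
  assumes "i \<in> {3..d}" "p \<in> M"
  shows "pdx (web_funs f g i) p \<noteq> 0" "pdy (web_funs f g i) p \<noteq> 0"
  using web_jac_nonzero[OF web, of 1 i p] web_jac_nonzero[OF web, of 2 i p] assms
  by (auto simp: jac_fst jac_snd)

lemma web_f: "smooth_on M f" "p \<in> M \<Longrightarrow> pdx f p \<noteq> 0" "p \<in> M \<Longrightarrow> pdy f p \<noteq> 0"
  using web_smooth[of 3] web_transversal_coordinates[of 3 p] d by auto

lemma web_g:
  assumes "i \<in> {4..d}"
  shows "smooth_on M (g i)" "p \<in> M \<Longrightarrow> pdx (g i) p \<noteq> 0" "p \<in> M \<Longrightarrow> pdy (g i) p \<noteq> 0"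
    "p \<in> M \<Longrightarrow> jac f (g i) p \<noteq> 0"
  using web_smooth[of i] web_transversal_coordinates[of i p] web_jac_nonzero[OF web, of 3 i p] assms by auto

lemma web_straight_iff:
  assumes "i \<in> {4..d}" "p \<in> M"
  shows "straight (web_m f \<nu>) (web_n f \<nu>) (g i) p \<longleftrightarrow> \<nu> p = mu f (g i) p"
  by (rule straight_iff[OF M web_f web_g[OF assms(1)] assms(2)])

lemma web_mu_eq:
  assumes "i \<in> {4..d}" "p \<in> M"
  shows "mu f (g i) p = I_pair f (g i) p + HH f p"
  by (rule mu_eq_I_pair[OF M web_f web_g[OF assms(1)] assms(2)])

lemma smooth_on_web_mu: "smooth_on M (mu f (g 4))"
  using d by (intro smooth_on_mu[OF M web_f web_g]) auto

lemma linearizable_imp_invariants: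
  assumes lin: "linearizable M d (web_funs f g)" and p: "p \<in> M"
  shows "I1 f (g 4) p = 0 \<and> I2 f (g 4) p = 0 \<and> (\<forall>i\<in>{5..d}. I_triple f (g 4) (g i) p = 0)"
proof -
  obtain U \<Phi> where U: "open U" "p \<in> U" "U \<subseteq> M" "diffeo_onto_proj_open U \<Phi>"
    and lines: "\<forall>i\<in>{1..d}. \<forall>L\<in>leaves U (web_funs f g i). \<exists>l. proj_line l \<and> \<Phi> ` L \<subseteq> l"
    using lin[unfolded linearizable_def, THEN bspec, OF p] by (elim exE conjE) (rule that)
  obtain T u v where T: "open T" "p \<in> T" "T \<subseteq> U" and uv: "smooth_on T u" "smooth_on T v" "\<forall>q\<in>T. jac u v q \<noteq> 0"
    and geo: "\<forall>w. smooth_on U w \<longrightarrow> (\<forall>q\<in>U. pdx w q \<noteq> 0 \<or> pdy w q \<noteq> 0) \<longrightarrow>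
      (\<forall>L\<in>leaves U w. \<exists>l. proj_line l \<and> \<Phi> ` L \<subseteq> l) \<longrightarrow> (\<forall>q\<in>T. geodesic u v w q)"
    by (rule linearization_affine_coordinates[OF U(1,2,4)])
  have J: "jac u v q \<noteq> 0" if "q \<in> T" for q
    using uv(3) that by blast
  have geo: "geodesic u v (web_funs f g i) q" if "i \<in> {1..d}" "q \<in> T" for i q
    using geo lines that smooth_on_subset[OF web_smooth[OF that(1)] U(3)] web_regular[OF that(1)] U(3) by blast
  have coords: "geodesic u v fst q" "geodesic u v snd q" if "q \<in> T" for q
    using geo[of 1 q] geo[of 2 q] d that by auto
  obtain a b s t where sm: "smooth_on T a" "smooth_on T b" "smooth_on T s" "smooth_on T t"
    and sys: "affine_system a b s t T u" "affine_system a b s t T v"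
    by (rule affine_system_exists[OF T(1) uv(1,2) J coords])
  define m n where "m q = a q - 2 * t q" and "n q = b q - 2 * s q" for q
  have mn: "smooth_on T m" "smooth_on T n"
    unfolding m_def[abs_def] n_def[abs_def] by (intro smooth T(1) sm)+
  have straight: "straight m n (web_funs f g i) q" if "i \<in> {1..d}" "q \<in> T" for i q
    using geodesic_iff_straight[OF T(1) uv(1,2) J smooth_on_subset[OF web_smooth[OF that(1)]] that(2) sys]
      geo[OF that] T(3) U(3) unfolding m_def[abs_def] n_def[abs_def] by blast
  \<comment> \<open>This solves \<open>m = web_m f \<nu>\<close> for \<open>\<nu>\<close>;
    straightness of \<open>f\<close> then gives \<open>n = web_n f \<nu>\<close>.\<close>
  define \<nu> where "\<nu> q = (pdx (pdx f) q / pdx f q - HH f q * pdx f q - m q) / pdx f q" for q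
  have m\<nu>: "m q = web_m f \<nu> q" and n\<nu>: "n q = web_n f \<nu> q" if "q \<in> T" for q
  proof -
    have "q \<in> M" "straight m n f q"
      using straight[of 3 q] that d T(3) U(3) by auto
    then show "m q = web_m f \<nu> q" "n q = web_n f \<nu> q"
      using straight_f_imp[OF M web_f, of q m n \<nu>] by (auto simp: \<nu>_def)
  qed
  have \<nu>: "\<nu> q = mu f (g i) q" if "i \<in> {4..d}" "q \<in> T" for i q
  proof -
    have "straight (web_m f \<nu>) (web_n f \<nu>) (g i) q"
      using straight[of i q] straight_cong[of m q "web_m f \<nu>" n "web_n f \<nu>", OF m\<nu>[OF that(2)] n\<nu>[OF that(2)]] that by auto
    then show ?thesis
      using web_straight_iff[OF that(1), of q \<nu>] that(2) T(3) U(3) by blast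
  qed
  have "liouville m n p"
    unfolding m_def[abs_def] n_def[abs_def] by (rule affine_system_liouville[OF T(1) uv(1,2) J sm sys T(2)])
  \<comment> \<open>\<open>\<nu>\<close> is tied to the chart domain \<open>T\<close>, while
    \<open>mu f (g 4)\<close> is smooth on all of \<open>M\<close>, as
    \<open>liouville_web_iff\<close> requires. Both agree on the open set \<open>T\<close>, so
    derivatives may be transferred.\<close>
  moreover have "m q = web_m f (mu f (g 4)) q" "n q = web_n f (mu f (g 4)) q" if "q \<in> T" for q
    using m\<nu>[OF that] n\<nu>[OF that] \<nu>[of 4 q] that d by (simp_all add: web_m_def web_n_def)
  ultimately have "liouville (web_m f (mu f (g 4))) (web_n f (mu f (g 4))) p"
    using liouville_cong[OF T(1,2) mn] by blast
  then have "I1_op f (mu f (g 4)) p = 0 \<and> I2_op f (mu f (g 4)) p = 0"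
    using liouville_web_iff[OF M web_f smooth_on_web_mu p] by blast
  moreover have "I_triple f (g 4) (g i) p = 0" if "i \<in> {5..d}" for i
    using \<nu>[of i p] \<nu>[of 4 p] web_mu_eq[of i p] web_mu_eq[of 4 p] that d p T(2)
    by (simp add: I_triple_def)
  ultimately show ?thesis
    by (simp add: I1_def I2_def)
qed

lemma invariants_imp_linearizable:
  assumes I1: "\<forall>p\<in>M. I1 f (g 4) p = 0" and I2: "\<forall>p\<in>M. I2 f (g 4) p = 0"
    and I3: "\<forall>\<alpha>\<in>{5..d}. \<forall>p\<in>M. I_triple f (g 4) (g \<alpha>) p = 0"
  shows "linearizable M d (web_funs f g)"
  unfolding linearizable_def
proof
  fix p assume p: "p \<in> M"
  define \<nu> where "\<nu> = mu f (g 4)"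
  have \<nu>: "smooth_on M \<nu>"
    unfolding \<nu>_def by (rule smooth_on_web_mu)
  have mn: "smooth_on M (web_m f \<nu>)" "smooth_on M (web_n f \<nu>)"
    by (rule smooth_on_web_m[OF M web_f \<nu>] smooth_on_web_n[OF M web_f \<nu>]; assumption)+
  have "liouville (web_m f \<nu>) (web_n f \<nu>) q" if "q \<in> M" for q
    using liouville_web_iff[OF M web_f \<nu> that] I1 I2 that by (simp add: \<nu>_def I1_def I2_def)
  then obtain T u v where T: "open T" "p \<in> T" "T \<subseteq> M" and uv: "smooth_on T u" "smooth_on T v" "\<forall>q\<in>T. jac u v q \<noteq> 0"
    and geo: "\<forall>w q. smooth_on T w \<longrightarrow> q \<in> T \<longrightarrow> straight (web_m f \<nu>) (web_n f \<nu>) w q \<longrightarrow> geodesic u v w q"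
    using affine_coordinates_exist[OF M p mn] by metis
  have J: "jac u v q \<noteq> 0" if "q \<in> T" for q
    using uv(3) that by blast
  have straight: "straight (web_m f \<nu>) (web_n f \<nu>) (web_funs f g i) q" if i: "i \<in> {1..d}" and q: "q \<in> M" for i q
  proof -
    consider "i = 1" | "i = 2" | "i = 3" | "i \<in> {4..d}"
      using i by force
    then show ?thesis
    proof cases
      case 4
      have "\<nu> q = mu f (g i) q"
      proof (cases "i = 4")
        case False
        then have "I_triple f (g 4) (g i) q = 0"
          using I3 4 q by auto
        then show ?thesis
          using web_mu_eq[OF 4 q] web_mu_eq[of 4 q] d q by (simp add: \<nu>_def I_triple_def)
      qed (simp add: \<nu>_def)
      then show ?thesis
        using web_straight_iff[OF 4 q, of \<nu>] 4 by simp
    qed (use straight_coordinates straight_f[OF M web_f q] in auto)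
  qed
  have nbhd: "\<forall>i\<in>{1..d}. \<exists>T'. open T' \<and> p \<in> T' \<and> (\<forall>U. open U \<and> U \<subseteq> T \<inter> T' \<longrightarrow>
      (\<forall>L\<in>leaves U (web_funs f g i). \<exists>l. proj_line l \<and> (\<lambda>q. affine_chart (u q, v q)) ` L \<subseteq> l))"
  proof (intro ballI, rule geodesic_neighborhood[OF T(1,2) uv(1,2) J])
    fix i assume i: "i \<in> {1..d}"
    show w: "smooth_on T (web_funs f g i)"
      using web_smooth[OF i] T(3) by (rule smooth_on_subset)
    show "pdx (web_funs f g i) q \<noteq> 0 \<or> pdy (web_funs f g i) q \<noteq> 0" if "q \<in> T" for q
      using web_regular[OF i] that T(3) by blast
    show "geodesic u v (web_funs f g i) q" if "q \<in> T" for q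
      using geo w straight[OF i] that T(3) by blast
  qed
  obtain T' where T': "\<forall>i\<in>{1..d}. open (T' i) \<and> p \<in> T' i \<and> (\<forall>U. open U \<and> U \<subseteq> T \<inter> T' i \<longrightarrow>
      (\<forall>L\<in>leaves U (web_funs f g i). \<exists>l. proj_line l \<and> (\<lambda>q. affine_chart (u q, v q)) ` L \<subseteq> l))"
    using bchoice[OF nbhd] by (elim exE) (rule that)
  \<comment> \<open>A finite intersection, hence open. Shrinking it further to a ball, for
    injectivity, is harmless: the line property was obtained for all smaller open sets.\<close>
  define S where "S = T \<inter> (\<Inter>i\<in>{1..d}. T' i)"
  have S: "open S" "p \<in> S" "S \<subseteq> T"
    using T T' by (auto simp: S_def intro!: open_INT)
  have uvS: "smooth_on S u" "smooth_on S v"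
    using uv S(3) by (auto intro: smooth_on_subset)
  obtain r where r: "r > 0" "ball p r \<subseteq> S" "inj_on (\<lambda>q. (u q, v q)) (ball p r)"
    using jac_nonzero_locally_injective[OF S(1) uvS S(2) J[OF T(2)]] by metis
  have "smooth_on (ball p r) u" "smooth_on (ball p r) v"
    using uvS r(2) by (auto intro: smooth_on_subset)
  moreover have Jr: "jac u v q \<noteq> 0" if "q \<in> ball p r" for q
    using J r(2) S(3) that by blast
  ultimately have "diffeo_onto_proj_open (ball p r) (\<lambda>q. affine_chart (u q, v q))"
    by (intro diffeo_affine_chart r(3) open_ball Jr)
  moreover have "\<exists>l. proj_line l \<and> (\<lambda>q. affine_chart (u q, v q)) ` L \<subseteq> l"
    if "i \<in> {1..d}" "L \<in> leaves (ball p r) (web_funs f g i)" for i L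
  proof -
    have "ball p r \<subseteq> T \<inter> T' i"
      using r(2) that(1) by (auto simp: S_def)
    then show ?thesis
      using T' that open_ball by blast
  qed
  moreover have "ball p r \<subseteq> M" "p \<in> ball p r"
    using r S(3) T(3) by auto
  ultimately show "\<exists>U \<Phi>. open U \<and> p \<in> U \<and> U \<subseteq> M \<and> diffeo_onto_proj_open U \<Phi> \<and>
      (\<forall>i\<in>{1..d}. \<forall>L\<in>leaves U (web_funs f g i). \<exists>l. proj_line l \<and> \<Phi> ` L \<subseteq> l)"
    using open_ball by blast
qed

end

theorem theorem11:
  fixes M :: "plane set" and d :: nat
    and f :: "plane \<Rightarrow> real" and g :: "nat \<Rightarrow> plane \<Rightarrow> real"
  assumes "d \<ge> 4"
    and "open M" "M \<noteq> {}" "connected M" "simply_connected M"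
    and "web M d (web_funs f g)"
  shows "linearizable M d (web_funs f g) \<longleftrightarrow>
    (\<forall>p\<in>M. I1 f (g 4) p = 0) \<and> (\<forall>p\<in>M. I2 f (g 4) p = 0) \<and>
    (\<forall>\<alpha>\<in>{5..d}. \<forall>p\<in>M. I_triple f (g 4) (g \<alpha>) p = 0)"
  using linearizable_imp_invariants[OF assms(1,2,6)] invariants_imp_linearizable[OF assms(1,2,6)] by blast

end
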